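(* Let $\mathcal H$ and $\mathcal K$ be complex Hilbert spaces of arbitrary dimensions, let $T\in\mathcal B(\mathcal H,\mathcal K)$ and let $T=U|T|$ be its polar decomposition. Then the following statements are equivalent. (1) $T\in\mathcal{AN}_{[k]}(\mathcal H,\mathcal K)$ for every $k\in\mathbb N$. (2) $T\in\mathcal{AN}_{[k]}(\mathcal H,\mathcal K)$ for some $k\in\mathbb N$. (3) $|T|$ is of the form $|T|=\alpha I+F+K$, where $\alpha\ge0$, $K$ is a positive compact operator and $F$ is a self-adjoint finite-rank operator.
   Context: For a positive $A\in\mathcal B(\mathcal H)$ define $\lambda_j(A)$ as follows. The essential spectrum $\sigma_e(A)$ is the set of points of $\sigma(A)$ that are accumulation points of $\sigma(A)$ or eigenvalues of infinite multiplicity. Let $\mu=\sup\sigma(A)$. If $\mu\in\sigma_e(A)$, put $\lambda_j(A)=\mu$ for $j=1,\dots,\operatorname{rank}(A)$. Otherwise $\mu$ is an eigenvalue of finite multiplicity $m$; put $\lambda_j(A)=\mu$ for $1\le j\le m$ and $\lambda_{m+j}(A)=\lambda_j(A_1)$ for $1\le j\le\operatorname{rank}(A_1)$, where $A_1=A-\mu P_{E_\mu}$ and $P_{E_\mu}$ is the orthogonal projection onto the eigenspace of $\mu$. If $\operatorname{rank}(A)<\infty$, put $\lambda_j(A)=0$ for $j>\operatorname{rank}(A)$. For $T\in\mathcal B(\mathcal H,\mathcal K)$, with $|T|=\sqrt{T^*T}$, the s-numbers are $s_j(T)=\lambda_j(|T|)$. The Ky Fan $k$-norm is $\|T\|_{[k]}=\sum_{j=1}^ks_j(T)$.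 $T\in\mathcal B(\mathcal H,\mathcal K)$ is $[k]$-norming, written $T\in\mathcal N_{[k]}(\mathcal H,\mathcal K)$, if there are orthonormal $x_1,\dots,x_k\in\mathcal H$ with $\|T\|_{[k]}=\sum_{j=1}^k\|Tx_j\|$; if $\dim\mathcal H=r<k$, the requirement is instead that there are orthonormal $x_1,\dots,x_r\in\mathcal H$ with $\|T\|_{[k]}=\sum_{j=1}^r\|Tx_j\|$. $T$ is absolutely $[k]$-norming, written $T\in\mathcal{AN}_{[k]}(\mathcal H,\mathcal K)$, if for every nontrivial (nonzero; $\mathcal M=\mathcal H$ allowed) closed subspace $\mathcal M\subseteq\mathcal H$ the restriction $T|_{\mathcal M}:\mathcal M\to\mathcal K$ is $[k]$-norming. *)

theory Defs
  imports "HOL-Analysis.Analysis" "HOL-Library.Extended_Nat"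
begin

section \<open>Complex Hilbert spaces\<close>

text \<open>The inner product is linear in its first argument.\<close>

class complex_hilbert = banach +
  fixes scaleC :: "complex \<Rightarrow> 'a \<Rightarrow> 'a" (infixr "*\<^sub>C" 75)
    and cinner :: "'a \<Rightarrow> 'a \<Rightarrow> complex"
  assumes scaleC_add_right: "a *\<^sub>C (x + y) = a *\<^sub>C x + a *\<^sub>C y"
    and scaleC_add_left: "(a + b) *\<^sub>C x = a *\<^sub>C x + b *\<^sub>C x"
    and scaleC_scaleC: "a *\<^sub>C (b *\<^sub>C x) = (a * b) *\<^sub>C x"
    and scaleC_one: "1 *\<^sub>C x = x"
    and scaleR_scaleC: "r *\<^sub>R x = complex_of_real r *\<^sub>C x"
    and cinner_commute: "cinner x y = cnj (cinner y x)"
    and cinner_add_left: "cinner (x + y) z = cinner x z + cinner y z"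
    and cinner_scaleC_left: "cinner (a *\<^sub>C x) y = a * cinner x y"
    and cinner_self: "cinner x x = complex_of_real ((norm x)\<^sup>2)"

global_interpretation complex_vector:
  vector_space "scaleC :: complex \<Rightarrow> 'a \<Rightarrow> 'a :: complex_hilbert"
  by unfold_locales
    (auto simp: scaleC_add_right scaleC_add_left scaleC_scaleC scaleC_one)

text \<open>Complex dimension of a linear subspace, with all infinite dimensions identified.\<close>

definition edim :: "'a::complex_hilbert set \<Rightarrow> enat" where
  "edim V = (if \<exists>B. finite B \<and> V \<subseteq> complex_vector.span B
             then enat (complex_vector.dim V) else \<infinity>)"

definition closed_csubspace :: "'a::complex_hilbert set \<Rightarrow> bool" where
  "closed_csubspace M \<longleftrightarrow> complex_vector.subspace M \<and> closed M"

section \<open>Operators on a closed subspace\<close>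

text \<open>Restrictions of an operator to closed subspaces have to be treated as operators on
  these Hilbert spaces in their own right. Hence each notion carries the closed subspace
  \<open>M\<close> on which the operator lives, and depends only on the values of the operator on \<open>M\<close>;
  the whole space is the case \<open>M = UNIV\<close>.\<close>

definition bounded_op ::
  "'a::complex_hilbert set \<Rightarrow> 'b::complex_hilbert set \<Rightarrow> ('a \<Rightarrow> 'b) \<Rightarrow> bool" where
  "bounded_op M N T \<longleftrightarrow>
     (\<forall>x\<in>M. T x \<in> N) \<and>
     (\<forall>x\<in>M. \<forall>y\<in>M. T (x + y) = T x + T y) \<and>
     (\<forall>c. \<forall>x\<in>M. T (c *\<^sub>C x) = c *\<^sub>C T x) \<and>
     (\<exists>C. \<forall>x\<in>M. norm (T x) \<le> C * norm x)"

text \<open>Adjoint of the operator \<open>T\<close> from \<open>M\<close> into the whole codomain.\<close>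

definition adj ::
  "'a::complex_hilbert set \<Rightarrow> ('a \<Rightarrow> 'b::complex_hilbert) \<Rightarrow> 'b \<Rightarrow> 'a" where
  "adj M T y = (THE z. z \<in> M \<and> (\<forall>x\<in>M. cinner (T x) y = cinner x z))"

definition selfadjoint_op :: "'a::complex_hilbert set \<Rightarrow> ('a \<Rightarrow> 'a) \<Rightarrow> bool" where
  "selfadjoint_op M A \<longleftrightarrow>
     bounded_op M M A \<and> (\<forall>x\<in>M. \<forall>y\<in>M. cinner (A x) y = cinner x (A y))"

definition positive_op :: "'a::complex_hilbert set \<Rightarrow> ('a \<Rightarrow> 'a) \<Rightarrow> bool" where
  "positive_op M A \<longleftrightarrow> bounded_op M M A \<and> (\<forall>x\<in>M. cinner (A x) x \<in> \<real>\<^sub>\<ge>\<^sub>0)"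

text \<open>Extensionality pins down the irrelevant values outside \<open>M\<close>, so that the positive
  square root is unique as a function.\<close>

definition op_sqrt :: "'a::complex_hilbert set \<Rightarrow> ('a \<Rightarrow> 'a) \<Rightarrow> 'a \<Rightarrow> 'a" where
  "op_sqrt M A = (THE S. S \<in> extensional M \<and> positive_op M S \<and> (\<forall>x\<in>M. S (S x) = A x))"

definition abs_op ::
  "'a::complex_hilbert set \<Rightarrow> ('a \<Rightarrow> 'b::complex_hilbert) \<Rightarrow> 'a \<Rightarrow> 'a" where
  "abs_op M T = op_sqrt M (\<lambda>x. adj M T (T x))"

definition op_rank :: "'a::complex_hilbert set \<Rightarrow> ('a \<Rightarrow> 'b::complex_hilbert) \<Rightarrow> enat" where
  "op_rank M A = edim (A ` M)"

definition compact_op :: "'a::complex_hilbert set \<Rightarrow> ('a \<Rightarrow> 'a) \<Rightarrow> bool" where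
  "compact_op M A \<longleftrightarrow> bounded_op M M A \<and> compact (closure (A ` (M \<inter> cball 0 1)))"

text \<open>\<open>U\<close> is the partial isometry in the polar decomposition of \<open>T\<close> on the whole space:
  \<open>U\<close> is isometric on the orthogonal complement of its kernel, and its kernel is that of \<open>T\<close>.\<close>

definition polar_decomposition ::
  "('a::complex_hilbert \<Rightarrow> 'b::complex_hilbert) \<Rightarrow> ('a \<Rightarrow> 'b) \<Rightarrow> bool" where
  "polar_decomposition T U \<longleftrightarrow>
     bounded_op UNIV UNIV U \<and>
     (\<forall>x. (\<forall>y. U y = 0 \<longrightarrow> cinner x y = 0) \<longrightarrow> norm (U x) = norm x) \<and>
     (\<forall>x. U x = 0 \<longleftrightarrow> T x = 0) \<and>
     (\<forall>x. T x = U (abs_op UNIV T x))"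

section \<open>Spectrum\<close>

definition spectrum :: "'a::complex_hilbert set \<Rightarrow> ('a \<Rightarrow> 'a) \<Rightarrow> complex set" where
  "spectrum M A = {z. \<not> (\<exists>B. bounded_op M M B \<and>
     (\<forall>x\<in>M. B (A x - z *\<^sub>C x) = x \<and> A (B x) - z *\<^sub>C B x = x))}"

definition eigenspace :: "'a::complex_hilbert set \<Rightarrow> ('a \<Rightarrow> 'a) \<Rightarrow> complex \<Rightarrow> 'a set" where
  "eigenspace M A z = {x\<in>M. A x = z *\<^sub>C x}"

definition ess_spectrum :: "'a::complex_hilbert set \<Rightarrow> ('a \<Rightarrow> 'a) \<Rightarrow> complex set" where
  "ess_spectrum M A =
     {z \<in> spectrum M A. z islimpt spectrum M A \<or> edim (eigenspace M A z) = \<infinity>}"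

text \<open>The spectrum of a positive operator is real, and this is its supremum.\<close>

definition spec_sup :: "'a::complex_hilbert set \<Rightarrow> ('a \<Rightarrow> 'a) \<Rightarrow> real" where
  "spec_sup M A = Sup {r. complex_of_real r \<in> spectrum M A}"

definition orth_proj :: "'a::complex_hilbert set \<Rightarrow> 'a \<Rightarrow> 'a" where
  "orth_proj E x = (THE y. y \<in> E \<and> (\<forall>z\<in>E. cinner (x - y) z = 0))"

section \<open>Singular numbers and norming operators\<close>

text \<open>\<open>eig_num M A j\<close> is $\lambda_j(A)$ for a positive operator \<open>A\<close> on \<open>M\<close>, with \<open>j \<ge> 1\<close>.
  The rank condition is tested first; this agrees with the recursive clause because
  \<open>A - \<mu> P\<close> has rank \<open>rank A - m\<close> if \<open>\<mu> > 0\<close>, and for \<open>A = 0\<close> all values are \<open>0\<close>.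
  The alternative \<open>m = 0\<close> only ensures termination on arbitrary arguments: for positive \<open>A\<close>,
  a point \<open>\<mu>\<close> outside the essential spectrum is an eigenvalue.\<close>

function eig_num :: "'a::complex_hilbert set \<Rightarrow> ('a \<Rightarrow> 'a) \<Rightarrow> nat \<Rightarrow> real" where
  "eig_num M A j =
     (let \<mu> = spec_sup M A;
          E = eigenspace M A (complex_of_real \<mu>);
          m = complex_vector.dim E
      in if op_rank M A < enat j then 0
         else if complex_of_real \<mu> \<in> ess_spectrum M A then \<mu>
         else if j \<le> m \<or> m = 0 then \<mu>
         else eig_num M (\<lambda>x. A x - complex_of_real \<mu> *\<^sub>C orth_proj E x) (j - m))"
  by pat_completeness auto
termination
  by (relation "Wellfounded.measure (\<lambda>(M, A, j). j)") auto

declare eig_num.simps [simp del]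

definition s_num ::
  "'a::complex_hilbert set \<Rightarrow> ('a \<Rightarrow> 'b::complex_hilbert) \<Rightarrow> nat \<Rightarrow> real" where
  "s_num M T j = eig_num M (abs_op M T) j"

definition ky_fan_norm ::
  "nat \<Rightarrow> 'a::complex_hilbert set \<Rightarrow> ('a \<Rightarrow> 'b::complex_hilbert) \<Rightarrow> real" where
  "ky_fan_norm k M T = (\<Sum>j=1..k. s_num M T j)"

definition orthonormal_upto :: "nat \<Rightarrow> (nat \<Rightarrow> 'a::complex_hilbert) \<Rightarrow> bool" where
  "orthonormal_upto r x \<longleftrightarrow>
     (\<forall>i\<in>{1..r}. \<forall>j\<in>{1..r}. cinner (x i) (x j) = (if i = j then 1 else 0))"

definition norming ::
  "nat \<Rightarrow> 'a::complex_hilbert set \<Rightarrow> ('a \<Rightarrow> 'b::complex_hilbert) \<Rightarrow> bool" where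
  "norming k M T \<longleftrightarrow>
     (let r = (if edim M < enat k then complex_vector.dim M else k)
      in \<exists>x. (\<forall>i\<in>{1..r}. x i \<in> M) \<and> orthonormal_upto r x \<and>
             ky_fan_norm k M T = (\<Sum>j=1..r. norm (T (x j))))"

definition absolutely_norming ::
  "nat \<Rightarrow> ('a::complex_hilbert \<Rightarrow> 'b::complex_hilbert) \<Rightarrow> bool" where
  "absolutely_norming k T \<longleftrightarrow>
     (\<forall>M. closed_csubspace M \<and> M \<noteq> {0} \<longrightarrow> norming k M T)"

end

theory Submission
  imports Defs
begin

text \<open>The link between the three conditions is attainment of the norm on every nontrivial closed subspace
  \<open>M\<close>. If \<open>\<parallel>T|\<^sub>M\<parallel>\<close> is not attained, then every \<open>s\<^sub>j(T|\<^sub>M)\<close> equals it and no orthonormal family can reach the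
  Ky Fan norm. (For \<open>k \<ge> 2\<close> a sum \<open>\<Sum> \<parallel>T x\<^sub>j\<parallel>\<close> may exceed the Ky Fan norm, so being \<open>[k]\<close>-norming is not a
  maximality statement.) If the norm is attained on all closed subspaces, the eigenvalues of the modulus of
  \<open>T|\<^sub>M\<close> can be split off from the top, each of them being isolated or of infinite multiplicity, and the
  eigenvectors witness the \<open>[k]\<close>-norming property for every \<open>k\<close>.

  If \<open>|T| = \<alpha> I + F + K\<close>, a maximising sequence on \<open>M\<close> has a convergent subsequence unless the supremum
  is \<open>\<alpha>\<close>, and then it is attained on \<open>M \<inter> ker F\<close>. Conversely, successive maximisers give orthonormal
  eigenvectors \<open>e\<^sub>n\<close> of \<open>|T|\<close> whose eigenvalues decrease to some \<open>\<alpha>\<close>; infinitely many eigenvectors with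
  eigenvalues below \<open>\<alpha>\<close> could be mixed with the \<open>e\<^sub>n\<close> to span a closed subspace on which the norm is
  not attained.\<close>

section \<open>Inner products and closed subspaces\<close>

text \<open>The modulus of \<open>T\<close> restricted to \<open>M\<close> is not the restriction of
  the modulus of \<open>T\<close>, since \<open>M\<close> need not be invariant. These operators
  share only the function sending \<open>x\<close> to \<open>norm (T x)\<close>. Attainment is
  therefore phrased through norms alone, and the operator studied on \<open>M\<close> is
  \<open>adj M T (T x)\<close>, the compression of the squared modulus. This explains the squares:
  \<alpha> plus a compact operator compresses to \<open>\<alpha>\<^sup>2\<close> plus a compact
  operator, and the mixed vectors are orthonormal with orthogonal images, so that they diagonalise
  the compressed square with strictly increasing eigenvalues and no largest one. For the
  decomposition in infinite dimension, the space splits into the closed span of the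
  \<open>e\<^sub>n\<close>, the remaining eigenvectors for \<alpha>, and a rest that the mixing
  argument forces to be finite-dimensional. Subtracting \<alpha> from the modulus leaves
  \<open>K\<close>, zero and \<open>F\<close> on these three pieces; \<open>K\<close> is positive
  because the eigenvalues approach \<alpha> from above.\<close>

lemma cinner_add_right: "cinner x (y + z) = cinner x y + cinner x (z :: 'a::complex_hilbert)"
  by (metis cinner_commute cinner_add_left complex_cnj_add)

lemma cinner_scaleC_right: "cinner x (a *\<^sub>C y) = cnj a * cinner x (y :: 'a::complex_hilbert)"
  by (metis cinner_commute cinner_scaleC_left complex_cnj_mult)

lemma cinner_scaleR_left: "cinner (r *\<^sub>R x) y = r *\<^sub>R cinner x (y :: 'a::complex_hilbert)"
  by (simp add: scaleR_scaleC cinner_scaleC_left scaleR_conv_of_real)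

lemma cinner_scaleR_right: "cinner x (r *\<^sub>R y) = r *\<^sub>R cinner x (y :: 'a::complex_hilbert)"
  by (simp add: scaleR_scaleC cinner_scaleC_right scaleR_conv_of_real)

lemma norm_sq_cinner: "(norm x)\<^sup>2 = Re (cinner x (x :: 'a::complex_hilbert))"
  by (simp add: cinner_self)

lemma cinner_self_eq_0 [simp]: "cinner x x = 0 \<longleftrightarrow> x = (0 :: 'a::complex_hilbert)"
  by (simp add: cinner_self)

lemma cinner_eq_0_commute: "cinner x y = 0 \<longleftrightarrow> cinner y (x :: 'a::complex_hilbert) = 0"
  by (metis cinner_commute complex_cnj_zero)

lemma norm_scaleC: "norm (a *\<^sub>C x) = cmod a * norm (x :: 'a::complex_hilbert)"
proof -
  have "complex_of_real ((norm (a *\<^sub>C x))\<^sup>2) = a * cnj a * complex_of_real ((norm x)\<^sup>2)"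
    unfolding cinner_self [symmetric]
    by (simp add: cinner_scaleC_left cinner_scaleC_right mult.assoc)
  also have "\<dots> = complex_of_real ((cmod a * norm x)\<^sup>2)"
    by (simp only: complex_norm_square [symmetric] power_mult_distrib of_real_mult)
  finally have "(norm (a *\<^sub>C x))\<^sup>2 = (cmod a * norm x)\<^sup>2"
    by (simp only: of_real_eq_iff)
  then show ?thesis by (simp add: power2_eq_iff_nonneg)
qed

text \<open>The squared norm of \<open>n x - a y\<close> with \<open>n = (norm y)^2\<close> and
  \<open>a = cinner x y\<close> has a factor \<open>n\<close> that can be cancelled; this scaling
  keeps the vector free of division.\<close>

lemma cinner_cauchy_schwarz: "cmod (cinner x y) \<le> norm x * norm (y :: 'a::complex_hilbert)"
proof (cases "y = 0")
  case True
  have "cinner x 0 = 0"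
    using cinner_scaleC_right [of x 0 0] by simp
  then show ?thesis using True by simp
next
  case False
  define a where "a = cinner x y"
  define n where "n = (norm y)\<^sup>2"
  let ?z = "complex_of_real n *\<^sub>C x + (- a) *\<^sub>C y"
  have yx: "cinner y x = cnj a" unfolding a_def by (rule cinner_commute)
  have "cinner ?z ?z = of_real n * of_real n * cinner x x - of_real n * (a * cnj a)"
    unfolding cinner_add_left cinner_add_right cinner_scaleC_left cinner_scaleC_right yx a_def [symmetric]
    by (simp add: cinner_self n_def algebra_simps)
  also have "\<dots> = of_real (n * n * (norm x)\<^sup>2 - n * (cmod a)\<^sup>2)"
    by (simp only: complex_norm_square [symmetric] of_real_mult of_real_diff cinner_self)
  finally have "(norm ?z)\<^sup>2 = n * n * (norm x)\<^sup>2 - n * (cmod a)\<^sup>2"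
    unfolding cinner_self of_real_eq_iff .
  then have "0 \<le> n * (n * (norm x)\<^sup>2 - (cmod a)\<^sup>2)"
    by (metis mult.assoc right_diff_distrib' zero_le_power2)
  moreover have "n > 0" using False by (simp add: n_def)
  ultimately have "(cmod a)\<^sup>2 \<le> n * (norm x)\<^sup>2" by (simp add: zero_le_mult_iff)
  then have "(cmod a)\<^sup>2 \<le> (norm x * norm y)\<^sup>2" by (simp add: n_def power_mult_distrib mult.commute)
  then show ?thesis unfolding a_def by (rule power2_le_imp_le) simp
qed

interpretation cinner: bounded_bilinear "cinner :: 'a::complex_hilbert \<Rightarrow> 'a \<Rightarrow> complex"
proof
  show "\<exists>K. \<forall>a b :: 'a. norm (cinner a b) \<le> norm a * norm b * K"
    by (rule exI [of _ 1]) (simp add: cinner_cauchy_schwarz)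
qed (rule cinner_add_left cinner_add_right cinner_scaleR_left cinner_scaleR_right)+

interpretation scaleC: bounded_bilinear "scaleC :: complex \<Rightarrow> 'a::complex_hilbert \<Rightarrow> 'a"
proof
  show "\<exists>K. \<forall>a (b :: 'a). norm (a *\<^sub>C b) \<le> norm a * norm b * K"
    by (rule exI [of _ 1]) (simp add: norm_scaleC)
qed (simp_all add: scaleC_add_left scaleC_add_right scaleR_scaleC scaleC_scaleC scaleR_conv_of_real mult.commute)

declare cinner.zero_left [simp] cinner.zero_right [simp]

lemmas cinner_simps = cinner_add_left cinner_add_right cinner.diff_left cinner.diff_right
  cinner.minus_left cinner.minus_right cinner_scaleC_left cinner_scaleC_right
  cinner_scaleR_left cinner_scaleR_right

lemma Re_cinner_commute: "Re (cinner x y) = Re (cinner y (x :: 'a::complex_hilbert))"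
  by (metis cinner_commute cnj.simps(1))

lemma norm_add_sq: "(norm (x + y))\<^sup>2 = (norm x)\<^sup>2 + 2 * Re (cinner x y) + (norm (y :: 'a::complex_hilbert))\<^sup>2"
  using Re_cinner_commute [of x y] by (simp add: norm_sq_cinner cinner_simps)

lemma norm_diff_sq: "(norm (x - y))\<^sup>2 = (norm x)\<^sup>2 - 2 * Re (cinner x y) + (norm (y :: 'a::complex_hilbert))\<^sup>2"
  using Re_cinner_commute [of x y] by (simp add: norm_sq_cinner cinner_simps)

lemma pythagoras: "cinner x y = 0 \<Longrightarrow> (norm (x + y))\<^sup>2 = (norm x)\<^sup>2 + (norm (y :: 'a::complex_hilbert))\<^sup>2"
  by (simp add: norm_add_sq)

section \<open>Closed complex subspaces and bounded operators between them\<close>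

lemma closed_csubspaceD:
  assumes "closed_csubspace (M :: 'a::complex_hilbert set)"
  shows csubspace_subspace: "complex_vector.subspace M"
    and csubspace_closed: "closed M"
    and csubspace_0: "0 \<in> M"
    and csubspace_add: "x \<in> M \<Longrightarrow> y \<in> M \<Longrightarrow> x + y \<in> M"
    and csubspace_diff: "x \<in> M \<Longrightarrow> y \<in> M \<Longrightarrow> x - y \<in> M"
    and csubspace_minus: "x \<in> M \<Longrightarrow> - x \<in> M"
    and csubspace_scaleC: "x \<in> M \<Longrightarrow> c *\<^sub>C x \<in> M"
    and csubspace_scaleR: "x \<in> M \<Longrightarrow> r *\<^sub>R x \<in> M"
proof -
  show *: "complex_vector.subspace M" "closed M"
    using assms by (auto simp: closed_csubspace_def)
  show "0 \<in> M" "x \<in> M \<Longrightarrow> y \<in> M \<Longrightarrow> x + y \<in> M" "x \<in> M \<Longrightarrow> y \<in> M \<Longrightarrow> x - y \<in> M"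
    "x \<in> M \<Longrightarrow> c *\<^sub>C x \<in> M" "x \<in> M \<Longrightarrow> r *\<^sub>R x \<in> M" "x \<in> M \<Longrightarrow> - x \<in> M"
    using * by (auto simp: complex_vector.subspace_0 complex_vector.subspace_add complex_vector.subspace_neg
        complex_vector.subspace_diff complex_vector.subspace_scale scaleR_scaleC)
qed

lemma closed_csubspace_UNIV: "closed_csubspace UNIV"
  by (simp add: closed_csubspace_def complex_vector.subspace_UNIV)

lemma bounded_opD:
  assumes "bounded_op M N T"
  shows bop_in: "x \<in> M \<Longrightarrow> T x \<in> N"
    and bop_add: "x \<in> M \<Longrightarrow> y \<in> M \<Longrightarrow> T (x + y) = T x + T y"
    and bop_scaleC: "x \<in> M \<Longrightarrow> T (c *\<^sub>C x) = c *\<^sub>C T x"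
    and bop_scaleR: "x \<in> M \<Longrightarrow> T (r *\<^sub>R x) = r *\<^sub>R T x"
  using assms by (auto simp: bounded_op_def scaleR_scaleC)

lemma bop_minus:
  assumes "bounded_op M N T" "x \<in> M"
  shows "T (- x) = - T x"
  using bop_scaleR [OF assms, of "- 1"] by simp

lemma bop_diff:
  assumes "bounded_op M N T" "closed_csubspace M" "x \<in> M" "y \<in> M"
  shows "T (x - y) = T x - T y"
  using bop_add [OF assms(1,3) csubspace_minus [OF assms(2,4)]] bop_minus [OF assms(1,4)] by simp

lemma bop_0:
  assumes "bounded_op M N T" "closed_csubspace M"
  shows "T 0 = 0"
  using bop_diff [OF assms csubspace_0 csubspace_0] assms(2) by simp

lemma bop_bound:
  assumes "bounded_op M N T"
  obtains C where "C > 0" "\<And>x. x \<in> M \<Longrightarrow> norm (T x) \<le> C * norm x"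
proof -
  obtain C where C: "\<And>x. x \<in> M \<Longrightarrow> norm (T x) \<le> C * norm x"
    using assms unfolding bounded_op_def by blast
  show thesis
  proof (rule that [of "\<bar>C\<bar> + 1"])
    fix x assume "x \<in> M"
    have "C * norm x \<le> (\<bar>C\<bar> + 1) * norm x" by (intro mult_right_mono) auto
    with C [OF \<open>x \<in> M\<close>] show "norm (T x) \<le> (\<bar>C\<bar> + 1) * norm x" by linarith
  qed auto
qed

lemma bounded_opI:
  assumes "\<And>x. x \<in> M \<Longrightarrow> T x \<in> N"
    and "\<And>x y. x \<in> M \<Longrightarrow> y \<in> M \<Longrightarrow> T (x + y) = T x + T y"
    and "\<And>c x. x \<in> M \<Longrightarrow> T (c *\<^sub>C x) = c *\<^sub>C T x"
    and "\<And>x. x \<in> M \<Longrightarrow> norm (T x) \<le> C * norm x"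
  shows "bounded_op M N T"
  using assms unfolding bounded_op_def by blast

lemma bop_tendsto:
  assumes T: "bounded_op M N T" and M: "closed_csubspace M"
    and x: "\<And>n. x n \<in> M" "l \<in> M" "x \<longlonglongrightarrow> l"
  shows "(\<lambda>n. T (x n)) \<longlonglongrightarrow> T l"
proof -
  obtain C where C: "\<And>x. x \<in> M \<Longrightarrow> norm (T x) \<le> C * norm x"
    using bop_bound [OF T] by blast
  have "(\<lambda>n. T (x n) - T l) \<longlonglongrightarrow> 0"
  proof (rule Lim_null_comparison)
    show "\<forall>\<^sub>F n in sequentially. norm (T (x n) - T l) \<le> C * norm (x n - l)"
      using C [OF csubspace_diff [OF M x(1,2)]] bop_diff [OF T M x(1,2)] by simp
    show "(\<lambda>n. C * norm (x n - l)) \<longlonglongrightarrow> 0"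
      using x(3) by (auto intro!: tendsto_eq_intros simp: LIM_zero_iff tendsto_norm_zero_iff)
  qed
  then show ?thesis by (simp add: LIM_zero_iff)
qed

lemma bounded_op_mono:
  assumes "bounded_op M N T" "M' \<subseteq> M" "\<And>x. x \<in> M' \<Longrightarrow> T x \<in> N'"
  shows "bounded_op M' N' T"
  using assms unfolding bounded_op_def by blast

lemma bounded_op_compose:
  assumes T: "bounded_op M N T" and S: "bounded_op N P S"
  shows "bounded_op M P (\<lambda>x. S (T x))"
proof -
  obtain C where C: "C > 0" "\<And>x. x \<in> M \<Longrightarrow> norm (T x) \<le> C * norm x"
    using bop_bound [OF T] by blast
  obtain D where D: "D > 0" "\<And>x. x \<in> N \<Longrightarrow> norm (S x) \<le> D * norm x"
    using bop_bound [OF S] by blast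
  show ?thesis
  proof (rule bounded_opI)
    fix x assume "x \<in> M"
    then have "norm (S (T x)) \<le> D * norm (T x)" using D bop_in [OF T] by blast
    also have "\<dots> \<le> D * (C * norm x)" using C \<open>x \<in> M\<close> D by (intro mult_left_mono) auto
    finally show "norm (S (T x)) \<le> D * C * norm x" by (simp add: mult.assoc)
  qed (auto simp: bounded_opD [OF T] bounded_opD [OF S])
qed

lemma bounded_op_scaleR_id:
  "closed_csubspace M \<Longrightarrow> bounded_op M M (\<lambda>x. r *\<^sub>R x)"
  by (rule bounded_opI [where C = "\<bar>r\<bar>"])
    (auto simp: csubspace_scaleR scaleR_add_right scaleR_scaleC [symmetric] scaleC.scaleR_right)

lemma bounded_op_add:
  assumes N: "closed_csubspace N" and T: "bounded_op M N T" and S: "bounded_op M N S"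
  shows "bounded_op M N (\<lambda>x. T x + S x)"
proof -
  obtain C where C: "C > 0" "\<And>x. x \<in> M \<Longrightarrow> norm (T x) \<le> C * norm x"
    using bop_bound [OF T] by blast
  obtain D where D: "D > 0" "\<And>x. x \<in> M \<Longrightarrow> norm (S x) \<le> D * norm x"
    using bop_bound [OF S] by blast
  show ?thesis
  proof (rule bounded_opI)
    fix x assume "x \<in> M"
    then show "norm (T x + S x) \<le> (C + D) * norm x"
      using C(2) [of x] D(2) [of x] norm_triangle_ineq [of "T x" "S x"] by (simp add: distrib_right)
  qed (auto simp: bounded_opD [OF T] bounded_opD [OF S] csubspace_add [OF N] scaleC_add_right)
qed

lemma bounded_op_scaleR:
  assumes N: "closed_csubspace N" and T: "bounded_op M N T"
  shows "bounded_op M N (\<lambda>x. r *\<^sub>R T x)"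
  using bounded_op_compose [OF T bounded_op_scaleR_id [OF N]] .

lemma bounded_op_diff:
  assumes N: "closed_csubspace N" and T: "bounded_op M N T" and S: "bounded_op M N S"
  shows "bounded_op M N (\<lambda>x. T x - S x)"
  using bounded_op_add [OF N T bounded_op_scaleR [OF N S, of "-1"]] by simp

lemma closed_csubspace_complete: "closed_csubspace M \<Longrightarrow> complete M"
  by (simp add: closed_csubspace_def complete_eq_closed)

lemma closed_csubspace_Int:
  "closed_csubspace M \<Longrightarrow> closed_csubspace N \<Longrightarrow> closed_csubspace (M \<inter> N)"
  by (auto simp: closed_csubspace_def complex_vector.subspace_inter)

lemma closed_csubspace_orth: "closed_csubspace {x. \<forall>y\<in>Y. cinner x y = 0}"
proof -
  have "closed (\<Inter>y\<in>Y. {x. cinner x y = 0})"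
    by (intro closed_INT ballI closed_Collect_eq continuous_intros cinner.continuous_on)
  moreover have "(\<Inter>y\<in>Y. {x. cinner x y = 0}) = {x. \<forall>y\<in>Y. cinner x y = 0}" by auto
  ultimately show ?thesis
    by (auto simp: closed_csubspace_def complex_vector.subspace_def cinner_simps)
qed

lemma closed_csubspace_closure:
  assumes "complex_vector.subspace M"
  shows "closed_csubspace (closure M)"
proof -
  have "x + y \<in> closure M" if xy: "x \<in> closure M" "y \<in> closure M" for x y
  proof -
    obtain f where f: "\<And>n. f n \<in> M" "f \<longlonglongrightarrow> x" using xy(1) unfolding closure_sequential by blast
    obtain g where g: "\<And>n. g n \<in> M" "g \<longlonglongrightarrow> y" using xy(2) unfolding closure_sequential by blast
    have "(\<lambda>n. f n + g n) \<longlonglongrightarrow> x + y" using f g by (intro tendsto_add)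
    moreover have "\<forall>n. f n + g n \<in> M" using assms f g by (simp add: complex_vector.subspace_add)
    ultimately show ?thesis unfolding closure_sequential by (intro exI [of _ "\<lambda>n. f n + g n"] conjI)
  qed
  moreover have "c *\<^sub>C x \<in> closure M" if x: "x \<in> closure M" for x c
  proof -
    obtain f where f: "\<And>n. f n \<in> M" "f \<longlonglongrightarrow> x" using x unfolding closure_sequential by blast
    have "(\<lambda>n. c *\<^sub>C f n) \<longlonglongrightarrow> c *\<^sub>C x" using f by (intro scaleC.tendsto tendsto_const)
    moreover have "\<forall>n. c *\<^sub>C f n \<in> M" using assms f by (simp add: complex_vector.subspace_scale)
    ultimately show ?thesis unfolding closure_sequential by (intro exI [of _ "\<lambda>n. c *\<^sub>C f n"] conjI)
  qed
  moreover have "0 \<in> closure M"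
    using assms closure_subset complex_vector.subspace_0 by blast
  ultimately show ?thesis by (simp add: closed_csubspace_def complex_vector.subspace_def)
qed

section \<open>Riesz representation, adjoints and projections\<close>

text \<open>The representing vector minimises \<open>\<parallel>z\<parallel>\<^sup>2 - 2 Re (f z)\<close>; minimising sequences are Cauchy by the
  parallelogram law.\<close>

lemma riesz:
  fixes f :: "'a::complex_hilbert \<Rightarrow> complex"
  assumes M: "closed_csubspace M"
    and add: "\<And>x y. x \<in> M \<Longrightarrow> y \<in> M \<Longrightarrow> f (x + y) = f x + f y"
    and scale: "\<And>c x. x \<in> M \<Longrightarrow> f (c *\<^sub>C x) = c * f x"
    and bound: "\<And>x. x \<in> M \<Longrightarrow> cmod (f x) \<le> C * norm x"
  shows "\<exists>!z. z \<in> M \<and> (\<forall>x\<in>M. f x = cinner x z)"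
proof -
  define J where "J z = (norm z)\<^sup>2 - 2 * Re (f z)" for z
  have scaleR: "f (r *\<^sub>R x) = of_real r * f x" if "x \<in> M" for r x
    using scale [OF that] by (simp add: scaleR_scaleC)
  have diff: "f (x - y) = f x - f y" if "x \<in> M" "y \<in> M" for x y
    using add [OF that(1) csubspace_minus [OF M that(2)]] scaleR [OF that(2), of "-1"] by simp
  \<comment> \<open>Completing the square: \<open>J z\<close> is at least
    \<open>(norm z - C)^2 - C^2\<close>.\<close>
  have lower: "- C\<^sup>2 \<le> J z" if "z \<in> M" for z
  proof -
    have "Re (f z) \<le> C * norm z" using bound [OF that] complex_Re_le_cmod [of "f z"] by linarith
    moreover have "0 \<le> (norm z - C)\<^sup>2" by simp
    ultimately show ?thesis unfolding J_def by (simp add: power2_diff mult.commute)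
  qed
  define m where "m = Inf (J ` M)"
  have bdd: "bdd_below (J ` M)" using lower by (auto intro!: bdd_belowI2)
  have ne: "J ` M \<noteq> {}" using csubspace_0 [OF M] by auto
  have m_le: "m \<le> J z" if "z \<in> M" for z
    unfolding m_def using that bdd by (intro cInf_lower) auto
  have "\<exists>z\<in>M. J z < m + 1 / real (Suc n)" for n
    using cInf_less_iff [OF ne bdd, of "m + 1 / real (Suc n)"] by (auto simp: m_def)
  then obtain z where z: "\<And>n. z n \<in> M" "\<And>n. J (z n) < m + 1 / real (Suc n)" by metis
  \<comment> \<open>Parallelogram law: \<open>J\<close> at the midpoint is at least
    \<open>m\<close>, so distances are controlled by the excesses over the infimum.\<close>
  have par: "(norm (x - y))\<^sup>2 \<le> 2 * (J x - m) + 2 * (J y - m)" if "x \<in> M" "y \<in> M" for x y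
  proof -
    let ?w = "(1/2) *\<^sub>R (x + y)"
    have w: "?w \<in> M" using that M by (simp add: csubspace_add csubspace_scaleR)
    have "f ?w = (f x + f y) / 2"
      using that scaleR [OF csubspace_add [OF M that], of "1/2"] by (simp add: add)
    then have "Re (f ?w) = Re ((f x + f y) / 2)" by (simp only:)
    then have "Re (f ?w) = (Re (f x) + Re (f y)) / 2" by simp
    moreover have "(norm ?w)\<^sup>2 = (norm (x + y))\<^sup>2 / 4" by (simp add: power_divide)
    ultimately have "(norm (x - y))\<^sup>2 = 2 * J x + 2 * J y - 4 * J ?w"
      unfolding J_def norm_diff_sq norm_add_sq by (simp del: scaleR_right_distrib add: algebra_simps norm_add_sq)
    then show ?thesis using m_le [OF w] by simp
  qed
  have small: "(norm (z i - z j))\<^sup>2 \<le> 4 / real (Suc n)" if "n \<le> i" "n \<le> j" for i j n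
  proof -
    have "1 / real (Suc i) \<le> 1 / real (Suc n)" "1 / real (Suc j) \<le> 1 / real (Suc n)"
      using that by (auto simp: field_simps)
    then have "J (z i) < m + 1 / real (Suc n)" "J (z j) < m + 1 / real (Suc n)"
      using z(2) [of i] z(2) [of j] by (meson add_left_mono less_le_trans)+
    then have "(norm (z i - z j))\<^sup>2 < 4 * (1 / real (Suc n))"
      using par [OF z(1) z(1), of i j] by argo
    then show ?thesis by simp
  qed
  have "Cauchy z"
  proof (rule metric_CauchyI)
    fix e :: real assume "e > 0"
    then obtain n where n: "4 / e\<^sup>2 < real (Suc n)"
      using reals_Archimedean2 [of "4 / e\<^sup>2"] by (metis less_trans of_nat_less_iff lessI)
    have "dist (z i) (z j) < e" if "n \<le> i" "n \<le> j" for i j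
    proof -
      have "4 / real (Suc n) < e\<^sup>2" using n \<open>e > 0\<close> by (simp add: field_simps)
      then have "(norm (z i - z j))\<^sup>2 < e\<^sup>2" using small [OF that] by linarith
      then show ?thesis using \<open>e > 0\<close> by (simp add: dist_norm power_less_imp_less_base)
    qed
    then show "\<exists>M. \<forall>m\<ge>M. \<forall>n\<ge>M. dist (z m) (z n) < e" by blast
  qed
  then obtain l where l: "z \<longlonglongrightarrow> l" using convergent_eq_Cauchy by blast
  have lM: "l \<in> M" using closed_sequentially [OF csubspace_closed [OF M]] z(1) l by blast
  have fl: "(\<lambda>n. f (z n)) \<longlonglongrightarrow> f l"
  proof (rule LIM_zero_cancel, rule Lim_null_comparison)
    show "\<forall>\<^sub>F n in sequentially. norm (f (z n) - f l) \<le> C * norm (z n - l)"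
      using bound [OF csubspace_diff [OF M z(1) lM]] diff [OF z(1) lM] by simp
    show "(\<lambda>n. C * norm (z n - l)) \<longlonglongrightarrow> 0"
      using l by (auto intro!: tendsto_eq_intros simp: LIM_zero_iff tendsto_norm_zero_iff)
  qed
  have Jl: "J l \<le> m"
  proof (rule LIMSEQ_le)
    show "(\<lambda>n. J (z n)) \<longlonglongrightarrow> J l" unfolding J_def by (intro tendsto_intros l fl)
    have "(\<lambda>n. m + 1 / real (Suc n)) \<longlonglongrightarrow> m + 0"
      by (intro tendsto_intros LIMSEQ_Suc lim_1_over_n)
    then show "(\<lambda>n. m + 1 / real (Suc n)) \<longlonglongrightarrow> m" by simp
    show "\<exists>N. \<forall>n\<ge>N. J (z n) \<le> m + 1 / real (Suc n)" using z(2) less_imp_le by blast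
  qed
  \<comment> \<open>Minimality along the line \<open>l + t y\<close> makes a quadratic polynomial in
    \<open>t\<close> nonnegative; its value at the minimum \<open>t = - d / n\<close> forces the
    linear coefficient to vanish.\<close>
  have Re_eq: "Re (f y) = Re (cinner y l)" if y: "y \<in> M" for y
  proof -
    define d where "d = Re (cinner y l) - Re (f y)"
    have q: "0 \<le> t\<^sup>2 * (norm y)\<^sup>2 + 2 * t * d" for t
    proof -
      have "J l \<le> J (l + t *\<^sub>R y)"
        using Jl m_le [OF csubspace_add [OF M lM csubspace_scaleR [OF M y, of t]]] by linarith
      moreover have "f (l + t *\<^sub>R y) = f l + of_real t * f y"
        using lM y by (simp add: add scaleR csubspace_scaleR [OF M])
      ultimately show ?thesis
        unfolding J_def norm_add_sq d_def using Re_cinner_commute [of y l]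
        by (simp add: cinner_scaleR_right power_mult_distrib algebra_simps)
    qed
    have "d = 0"
    proof (cases "y = 0")
      case True then show ?thesis using scale [OF csubspace_0 [OF M], of 0] by (simp add: d_def)
    next
      case False
      define n where "n = (norm y)\<^sup>2"
      have n: "n > 0" using False by (simp add: n_def)
      have "0 \<le> (d / n)\<^sup>2 * n + 2 * (- d / n) * d" using q [of "- d / n"] by (simp add: n_def)
      also have "\<dots> = - (d\<^sup>2 / n)" using n by (simp add: field_simps power2_eq_square)
      finally show ?thesis using n by (simp add: field_simps)
    qed
    then show ?thesis by (simp add: d_def)
  qed
  \<comment> \<open>The imaginary part is the real part tested on the multiple of \<open>y\<close>
    by \<i>.\<close>
  have eq: "f y = cinner y l" if y: "y \<in> M" for y
  proof (rule complex_eqI)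
    show "Re (f y) = Re (cinner y l)" using Re_eq [OF y] .
    have "Re (\<i> * f y) = Re (\<i> * cinner y l)"
      using Re_eq [OF csubspace_scaleC [OF M y, of \<i>]] scale [OF y, of \<i>] by (simp add: cinner_scaleC_left)
    then show "Im (f y) = Im (cinner y l)" by simp
  qed
  show ?thesis
  proof (rule ex1I [of _ l])
    show "l \<in> M \<and> (\<forall>x\<in>M. f x = cinner x l)" using lM eq by blast
    fix w assume w: "w \<in> M \<and> (\<forall>x\<in>M. f x = cinner x w)"
    have wl: "w - l \<in> M" using w lM M by (simp add: csubspace_diff)
    then have "cinner (w - l) (w - l) = 0"
      using w eq by (metis cinner.diff_right diff_self)
    then show "w = l" by simp
  qed
qed

section \<open>Adjoints and orthogonal projections\<close>

lemma adj_ex1: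
  fixes T :: "'a::complex_hilbert \<Rightarrow> 'b::complex_hilbert"
  assumes M: "closed_csubspace M" and T: "bounded_op M UNIV T"
  shows "\<exists>!z. z \<in> M \<and> (\<forall>x\<in>M. cinner (T x) y = cinner x z)"
proof -
  obtain C where C: "C > 0" "\<And>x. x \<in> M \<Longrightarrow> norm (T x) \<le> C * norm x"
    using bop_bound [OF T] by blast
  show ?thesis
  proof (rule riesz [OF M])
    fix x assume x: "x \<in> M"
    have "cmod (cinner (T x) y) \<le> norm (T x) * norm y" by (rule cinner_cauchy_schwarz)
    also have "\<dots> \<le> C * norm x * norm y" using C(2) [OF x] by (intro mult_right_mono) auto
    finally show "cmod (cinner (T x) y) \<le> (C * norm y) * norm x" by (simp add: ac_simps)
  qed (auto simp: bounded_opD [OF T] cinner_simps)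
qed

lemma
  fixes T :: "'a::complex_hilbert \<Rightarrow> 'b::complex_hilbert"
  assumes M: "closed_csubspace M" and T: "bounded_op M UNIV T"
  shows adj_in: "adj M T y \<in> M"
    and cinner_adj: "x \<in> M \<Longrightarrow> cinner x (adj M T y) = cinner (T x) y"
  using theI' [OF adj_ex1 [OF assms, of y]] unfolding adj_def [symmetric] by metis+

lemma adj_eqI:
  fixes T :: "'a::complex_hilbert \<Rightarrow> 'b::complex_hilbert"
  assumes M: "closed_csubspace M" and T: "bounded_op M UNIV T"
    and "z \<in> M" "\<And>x. x \<in> M \<Longrightarrow> cinner (T x) y = cinner x z"
  shows "adj M T y = z"
  unfolding adj_def using assms by (intro the1_equality [OF adj_ex1]) auto

lemma cinner_adj_left:
  assumes M: "closed_csubspace M" and T: "bounded_op M UNIV T" and x: "x \<in> M"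
  shows "cinner (adj M T y) x = cinner y (T x)"
  by (metis cinner_adj [OF M T x] cinner_commute)

lemma bounded_op_adj:
  fixes T :: "'a::complex_hilbert \<Rightarrow> 'b::complex_hilbert"
  assumes M: "closed_csubspace M" and T: "bounded_op M UNIV T"
  shows "bounded_op UNIV M (adj M T)"
proof -
  obtain C where C: "C > 0" "\<And>x. x \<in> M \<Longrightarrow> norm (T x) \<le> C * norm x"
    using bop_bound [OF T] by blast
  show ?thesis
  proof (rule bounded_opI [where C = C])
    fix y
    let ?z = "adj M T y"
    have z: "?z \<in> M" by (rule adj_in [OF M T])
    have "(norm ?z)\<^sup>2 = cmod (cinner (T ?z) y)"
      by (simp add: cinner_adj [OF M T z, symmetric] cinner_self norm_power)
    also have "\<dots> \<le> norm (T ?z) * norm y" by (rule cinner_cauchy_schwarz)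
    also have "\<dots> \<le> C * norm ?z * norm y" using C(2) [OF z] by (intro mult_right_mono) auto
    finally have "norm ?z * norm ?z \<le> norm ?z * (C * norm y)" by (simp add: power2_eq_square ac_simps)
    then show "norm ?z \<le> C * norm y"
      using C(1) by (cases "norm ?z = 0") (auto simp: mult_le_cancel_left)
  next
    show "adj M T (x + y) = adj M T x + adj M T y" for x y
      by (rule adj_eqI [OF M T])
        (auto simp: csubspace_add [OF M] adj_in [OF M T] cinner_simps cinner_adj [OF M T])
    show "adj M T (c *\<^sub>C x) = c *\<^sub>C adj M T x" for c x
      by (rule adj_eqI [OF M T])
        (auto simp: csubspace_scaleC [OF M] adj_in [OF M T] cinner_simps cinner_adj [OF M T])
  qed (rule adj_in [OF M T])
qed

lemma bounded_op_id: "bounded_op M UNIV (\<lambda>x. x)"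
  by (rule bounded_opI [where C = 1]) auto

text \<open>The projection onto \<open>M\<close> is the adjoint of the inclusion of
  \<open>M\<close>. Its existence, uniqueness and boundedness thus come from the results on
  adjoints.\<close>

lemma orth_proj_eq_adj:
  assumes M: "closed_csubspace M"
  shows "orth_proj M = adj M (\<lambda>x. x)"
proof
  fix x
  note P = adj_in [OF M bounded_op_id] cinner_adj_left [OF M bounded_op_id]
  show "orth_proj M x = adj M (\<lambda>x. x) x"
    unfolding orth_proj_def
  proof (rule the_equality)
    show "adj M (\<lambda>x. x) x \<in> M \<and> (\<forall>z\<in>M. cinner (x - adj M (\<lambda>x. x) x) z = 0)"
      by (simp add: P cinner_simps)
    fix y assume y: "y \<in> M \<and> (\<forall>z\<in>M. cinner (x - y) z = 0)"
    have "cinner z x = cinner z y" if "z \<in> M" for z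
      using y that by (metis cinner_commute cinner.diff_left eq_iff_diff_eq_0)
    then show "y = adj M (\<lambda>x. x) x" using adj_eqI [OF M bounded_op_id, of y x] y by simp
  qed
qed

lemma
  assumes M: "closed_csubspace M"
  shows orth_proj_in: "orth_proj M x \<in> M"
    and cinner_orth_proj: "z \<in> M \<Longrightarrow> cinner (x - orth_proj M x) z = 0"
    and bounded_op_orth_proj: "bounded_op UNIV M (orth_proj M)"
  using adj_in [OF M bounded_op_id] cinner_adj_left [OF M bounded_op_id]
    bounded_op_adj [OF M bounded_op_id]
  by (auto simp: orth_proj_eq_adj [OF M] cinner_simps)

lemma orth_proj_eqI:
  assumes M: "closed_csubspace M" and "y \<in> M" "\<And>z. z \<in> M \<Longrightarrow> cinner (x - y) z = 0"
  shows "orth_proj M x = y"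
proof -
  have "orth_proj M x - y \<in> M" using assms orth_proj_in csubspace_diff by blast
  then have "cinner (orth_proj M x - y) (orth_proj M x - y) = 0"
    using assms(3) [of "orth_proj M x - y"] cinner_orth_proj [OF M, of "orth_proj M x - y" x]
    by (simp add: cinner.diff_left)
  then show ?thesis by simp
qed

section \<open>Positive operators and square roots\<close>

lemma selfadjoint_opD:
  assumes "selfadjoint_op M A"
  shows sa_bounded: "bounded_op M M A"
    and sa_sym: "x \<in> M \<Longrightarrow> y \<in> M \<Longrightarrow> cinner (A x) y = cinner x (A y)"
  using assms by (auto simp: selfadjoint_op_def)

lemma positive_opD:
  assumes "positive_op M A"
  shows pos_bounded: "bounded_op M M A"
    and pos_Re: "x \<in> M \<Longrightarrow> 0 \<le> Re (cinner (A x) x)"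
    and pos_Im: "x \<in> M \<Longrightarrow> Im (cinner (A x) x) = 0"
  using assms by (auto simp: positive_op_def complex_nonneg_Reals_iff)

text \<open>Polarisation: the form is real at \<open>x + y\<close> and at \<open>x\<close> plus \<i>
  times \<open>y\<close>, which gives the imaginary and the real part of the symmetry
  identity.\<close>

lemma positive_selfadjoint:
  assumes M: "closed_csubspace M" and A: "positive_op M A"
  shows "selfadjoint_op M A"
proof -
  note b = pos_bounded [OF A]
  have "cinner (A x) y = cinner x (A y)" if x: "x \<in> M" and y: "y \<in> M" for x y
  proof -
    have iy: "\<i> *\<^sub>C y \<in> M" using y M by (simp add: csubspace_scaleC)
    have "Im (cinner (A x) y + cinner (A y) x) = 0"
      using pos_Im [OF A csubspace_add [OF M x y]] pos_Im [OF A x] pos_Im [OF A y]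
      by (simp add: bop_add [OF b x y] cinner_simps)
    moreover have "Im (cinner (A x) (\<i> *\<^sub>C y) + cinner (A (\<i> *\<^sub>C y)) x) = 0"
      using pos_Im [OF A csubspace_add [OF M x iy]] pos_Im [OF A x] pos_Im [OF A iy]
      by (simp add: bop_add [OF b x iy] cinner_simps)
    then have "Re (cinner (A y) x) = Re (cinner (A x) y)"
      by (simp add: cinner_simps bop_scaleC [OF b y])
    ultimately have "cinner (A x) y = cnj (cinner (A y) x)"
      by (intro complex_eqI) auto
    then show ?thesis by (simp add: cinner_commute [of x "A y"])
  qed
  then show ?thesis using b by (simp add: selfadjoint_op_def)
qed

lemma selfadjoint_Im:
  assumes "selfadjoint_op M A" "x \<in> M"
  shows "Im (cinner (A x) x) = 0"
proof -
  have "cinner (A x) x = cnj (cinner (A x) x)"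
    using sa_sym [OF assms(1) assms(2) assms(2)] cinner_commute [of x "A x"] by simp
  then show ?thesis by (metis Reals_cnj_iff complex_is_Real_iff)
qed

lemma positive_opI:
  assumes "selfadjoint_op M A" "\<And>x. x \<in> M \<Longrightarrow> 0 \<le> Re (cinner (A x) x)"
  shows "positive_op M A"
  using assms selfadjoint_Im [OF assms(1)]
  by (auto simp: positive_op_def complex_nonneg_Reals_iff selfadjoint_op_def)

text \<open>The form is nonnegative at \<open>x - (1/c) A x\<close>; expanding and bounding the
  quadratic term by \<open>c\<close> gives the claim. This is how a small value of the form is
  turned into a small vector \<open>A x\<close>.\<close>

lemma positive_norm_sq_le:
  assumes M: "closed_csubspace M" and A: "positive_op M A" and c: "c > 0"
    and le: "\<And>x. x \<in> M \<Longrightarrow> Re (cinner (A x) x) \<le> c * (norm x)\<^sup>2" and x: "x \<in> M"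
  shows "(norm (A x))\<^sup>2 \<le> c * Re (cinner (A x) x)"
proof -
  note b = pos_bounded [OF A] and s = sa_sym [OF positive_selfadjoint [OF M A]]
  define t where "t = 1 / c"
  let ?y = "A x"
  have y: "?y \<in> M" using b x by (rule bop_in)
  have ty: "t *\<^sub>R ?y \<in> M" using M y by (simp add: csubspace_scaleR)
  have "0 \<le> Re (cinner (A (x - t *\<^sub>R ?y)) (x - t *\<^sub>R ?y))"
    by (rule pos_Re [OF A csubspace_diff [OF M x ty]])
  also have "\<dots> = Re (cinner (A x) x) - 2 * t * (norm ?y)\<^sup>2 + t\<^sup>2 * Re (cinner (A ?y) ?y)"
    using s [OF y x] norm_sq_cinner [of ?y]
    by (simp add: bop_diff [OF b M x ty] bop_scaleR [OF b y] cinner_simps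
        algebra_simps power2_eq_square)
  also have "\<dots> \<le> Re (cinner (A x) x) - 2 * t * (norm ?y)\<^sup>2 + t\<^sup>2 * (c * (norm ?y)\<^sup>2)"
    using le [OF y] by (intro add_left_mono mult_left_mono) auto
  also have "\<dots> = Re (cinner (A x) x) - (norm ?y)\<^sup>2 / c"
    using c by (simp add: t_def power2_eq_square field_simps)
  finally show ?thesis using c by (simp add: field_simps)
qed

lemma positive_norm_le:
  assumes M: "closed_csubspace M" and A: "positive_op M A" and c: "c > 0"
    and le: "\<And>x. x \<in> M \<Longrightarrow> Re (cinner (A x) x) \<le> c * (norm x)\<^sup>2" and x: "x \<in> M"
  shows "norm (A x) \<le> c * norm x"
proof -
  have "(norm (A x))\<^sup>2 \<le> c * (c * (norm x)\<^sup>2)"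
    using positive_norm_sq_le [OF assms] mult_left_mono [OF le [OF x], of c] c by linarith
  then have "(norm (A x))\<^sup>2 \<le> (c * norm x)\<^sup>2" by (simp add: power2_eq_square ac_simps)
  then show ?thesis using c by (auto intro: power2_le_imp_le)
qed

lemma Re_cinner_le_bound:
  assumes "norm (A x) \<le> c * norm x"
  shows "Re (cinner (A x) x) \<le> c * (norm (x :: 'a::complex_hilbert))\<^sup>2"
proof -
  have "Re (cinner (A x) x) \<le> norm (A x) * norm x"
    using complex_Re_le_cmod [of "cinner (A x) x"] cinner_cauchy_schwarz [of "A x" x] by linarith
  also have "\<dots> \<le> c * norm x * norm x" using assms by (intro mult_right_mono) auto
  finally show ?thesis by (simp add: power2_eq_square ac_simps)
qed

lemma positive_eq_0:
  assumes M: "closed_csubspace M" and A: "positive_op M A"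
    and x: "x \<in> M" and "Re (cinner (A x) x) = 0"
  shows "A x = 0"
proof -
  obtain c where c: "c > 0" "\<And>x. x \<in> M \<Longrightarrow> norm (A x) \<le> c * norm x"
    using bop_bound [OF pos_bounded [OF A]] by blast
  have "(norm (A x))\<^sup>2 \<le> c * Re (cinner (A x) x)"
    by (rule positive_norm_sq_le [OF M A c(1) _ x]) (use c(2) Re_cinner_le_bound in blast)
  then show ?thesis using assms(4) by simp
qed

section \<open>Sums and squares of self-adjoint operators, and square roots\<close>

lemma selfadjoint_op_scaleR_id: "closed_csubspace M \<Longrightarrow> selfadjoint_op M (\<lambda>x. r *\<^sub>R x)"
  by (simp add: selfadjoint_op_def bounded_op_scaleR_id cinner_simps)

lemma selfadjoint_op_add:
  "closed_csubspace M \<Longrightarrow> selfadjoint_op M A \<Longrightarrow> selfadjoint_op M B \<Longrightarrow>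
    selfadjoint_op M (\<lambda>x. A x + B x)"
  by (simp add: selfadjoint_op_def bounded_op_add cinner_simps)

lemma selfadjoint_op_scaleR:
  "closed_csubspace M \<Longrightarrow> selfadjoint_op M A \<Longrightarrow> selfadjoint_op M (\<lambda>x. r *\<^sub>R A x)"
  by (simp add: selfadjoint_op_def bounded_op_scaleR cinner_simps)

lemma selfadjoint_op_diff:
  "closed_csubspace M \<Longrightarrow> selfadjoint_op M A \<Longrightarrow> selfadjoint_op M B \<Longrightarrow>
    selfadjoint_op M (\<lambda>x. A x - B x)"
  by (simp add: selfadjoint_op_def bounded_op_diff cinner_simps)

lemma selfadjoint_op_square:
  assumes A: "selfadjoint_op M A"
  shows "selfadjoint_op M (\<lambda>x. A (A x))"
  unfolding selfadjoint_op_def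
proof (intro conjI ballI)
  note b = sa_bounded [OF A]
  show "bounded_op M M (\<lambda>x. A (A x))" by (rule bounded_op_compose [OF b b])
  show "cinner (A (A x)) y = cinner x (A (A y))" if "x \<in> M" "y \<in> M" for x y
    using sa_sym [OF A bop_in [OF b that(1)] that(2)] sa_sym [OF A that(1) bop_in [OF b that(2)]] by simp
qed

text \<open>Newton-type iteration \<open>Y\<^sub>0 = 0\<close>, \<open>Y\<^sub>n\<^sub>+\<^sub>1 = (B + Y\<^sub>n\<^sup>2) / 2\<close>. The scalar iteration started with
  \<open>B = 1\<close> dominates all norms, so that even \<open>\<parallel>B\<parallel> = 1\<close> is allowed.\<close>

lemma sqrt_iteration:
  fixes B :: "'a::complex_hilbert \<Rightarrow> 'a"
  assumes M: "closed_csubspace M" and B: "selfadjoint_op M B"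
    and B1: "\<And>x. x \<in> M \<Longrightarrow> norm (B x) \<le> norm x"
  shows "\<exists>Y. selfadjoint_op M Y \<and> (\<forall>x\<in>M. norm (Y x) \<le> norm x) \<and>
    (\<forall>x\<in>M. 2 *\<^sub>R Y x = B x + Y (Y x)) \<and>
    (\<forall>C. bounded_op M M C \<longrightarrow> (\<forall>x\<in>M. C (B x) = B (C x)) \<longrightarrow> (\<forall>x\<in>M. C (Y x) = Y (C x)))"
proof -
  define Y where "Y = rec_nat (\<lambda>x. 0) (\<lambda>n f x. (1/2) *\<^sub>R (B x + f (f x)))"
  define y where "y = rec_nat (0::real) (\<lambda>n v. (1 + v\<^sup>2) / 2)"
  have Y0: "Y 0 = (\<lambda>x. 0)" and YS: "Y (Suc n) = (\<lambda>x. (1/2) *\<^sub>R (B x + Y n (Y n x)))" for n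
    by (simp_all add: Y_def)
  have y0: "y 0 = 0" and yS: "y (Suc n) = (1 + (y n)\<^sup>2) / 2" for n
    by (simp_all add: y_def)
  have y01: "0 \<le> y n \<and> y n \<le> 1" for n
  proof (induction n)
    case (Suc n)
    then have "(y n)\<^sup>2 \<le> 1" by (simp add: power_le_one)
    then show ?case by (simp add: yS)
  qed (simp add: y0)
  have sa: "selfadjoint_op M (Y n)" for n
  proof (induction n)
    case 0 show ?case
      using selfadjoint_op_scaleR_id [OF M, of 0] by (simp add: Y0)
  next
    case (Suc n)
    show ?case unfolding YS
      by (intro selfadjoint_op_scaleR [OF M] selfadjoint_op_add [OF M B] selfadjoint_op_square Suc)
  qed
  note bY = sa_bounded [OF sa]
  note inY = bop_in [OF bY]
  have nY: "norm (Y n x) \<le> y n * norm x" if "x \<in> M" for n x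
    using that
  proof (induction n arbitrary: x)
    case (Suc n)
    have "norm (Y n (Y n x)) \<le> y n * (y n * norm x)"
      using Suc.IH [OF inY [OF Suc.prems, of n]] mult_left_mono [OF Suc.IH [OF Suc.prems], of "y n"] y01 [of n]
      by linarith
    then have "norm (B x + Y n (Y n x)) \<le> norm x + y n * (y n * norm x)"
      using norm_triangle_ineq [of "B x" "Y n (Y n x)"] B1 [OF Suc.prems] by linarith
    then show ?case by (simp add: YS yS power2_eq_square algebra_simps del: scaleR_add_right)
  qed (simp add: Y0 y0)
  have dY: "norm (Y (Suc n) x - Y n x) \<le> (y (Suc n) - y n) * norm x" if "x \<in> M" for n x
    using that
  proof (induction n arbitrary: x)
    case 0
    then show ?case using B1 [of x] by (simp add: Y0 YS y0 yS)
  next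
    case (Suc n)
    let ?d = "y (Suc n) - y n"
    have x: "x \<in> M" by fact
    have d: "?d \<ge> 0"
    proof -
      have "0 \<le> (1 - y n)\<^sup>2" by simp
      then show ?thesis by (simp add: yS power2_diff)
    qed
    \<comment> \<open>The difference of the squares is split into two products, each containing the
      previous difference. The same splitting for the scalars \<open>y n\<close> is an exact
      identity, so the scalar increments dominate.\<close>
    have "Y (Suc (Suc n)) x - Y (Suc n) x = (1/2) *\<^sub>R (Y (Suc n) (Y (Suc n) x) - Y n (Y n x))"
      unfolding YS [of "Suc n"] YS [of n] by (simp add: algebra_simps)
    also have "Y (Suc n) (Y (Suc n) x) - Y n (Y n x)
        = Y (Suc n) (Y (Suc n) x - Y n x) + (Y (Suc n) (Y n x) - Y n (Y n x))"
      by (simp add: bop_diff [OF bY M inY [OF x] inY [OF x]])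
    finally have "norm (Y (Suc (Suc n)) x - Y (Suc n) x)
        \<le> (norm (Y (Suc n) (Y (Suc n) x - Y n x)) + norm (Y (Suc n) (Y n x) - Y n (Y n x))) / 2"
      by (simp add: norm_triangle_ineq)
    also have "norm (Y (Suc n) (Y (Suc n) x - Y n x)) \<le> y (Suc n) * (?d * norm x)"
      using nY [OF csubspace_diff [OF M inY [OF x] inY [OF x]], of "Suc n" "Suc n" n]
        mult_left_mono [OF Suc.IH [OF x], of "y (Suc n)"] y01 [of "Suc n"] by linarith
    also have "norm (Y (Suc n) (Y n x) - Y n (Y n x)) \<le> ?d * (y n * norm x)"
      using Suc.IH [OF inY [OF x, of n]] mult_left_mono [OF nY [OF x, of n] d] by linarith
    finally have "norm (Y (Suc (Suc n)) x - Y (Suc n) x)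
        \<le> (y (Suc n) * (?d * norm x) + ?d * (y n * norm x)) / 2" by simp
    also have "\<dots> = (((y (Suc n))\<^sup>2 - (y n)\<^sup>2) / 2) * norm x"
      by (simp add: algebra_simps power2_eq_square)
    also have "((y (Suc n))\<^sup>2 - (y n)\<^sup>2) / 2 = y (Suc (Suc n)) - y (Suc n)"
      unfolding yS [of "Suc n"] yS [of n] by (simp add: field_simps)
    finally show ?case .
  qed
  have dYk: "norm (Y (n + k) x - Y n x) \<le> (y (n + k) - y n) * norm x" if x: "x \<in> M" for n k x
  proof (induction k)
    case (Suc k)
    have "norm (Y (n + Suc k) x - Y n x) \<le> norm (Y (Suc (n + k)) x - Y (n + k) x) + norm (Y (n + k) x - Y n x)"
      using norm_triangle_ineq [of "Y (Suc (n + k)) x - Y (n + k) x" "Y (n + k) x - Y n x"] by simp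
    also have "\<dots> \<le> (y (Suc (n + k)) - y (n + k)) * norm x + (y (n + k) - y n) * norm x"
      using dY [OF x] Suc by (intro add_mono)
    finally show ?case by (simp add: algebra_simps)
  qed simp
  \<comment> \<open>The increment from \<open>y n\<close> is \<open>(1 - y n)^2 / 2\<close>.\<close>
  have "incseq y"
  proof (rule incseq_SucI)
    fix n
    have "0 \<le> (1 - y n)\<^sup>2" by simp
    then show "y n \<le> y (Suc n)" by (simp add: yS power2_diff)
  qed
  then have ycau: "Cauchy y"
    using y01 by (intro convergent_Cauchy Bseq_mono_convergent BseqI' [of _ 1]) (auto simp: incseq_def)
  have conv: "convergent (\<lambda>n. Y n x)" if x: "x \<in> M" for x
  proof (rule Cauchy_convergent, rule metric_CauchyI)
    fix e :: real assume e: "e > 0"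
    define N where "N = norm x + 1"
    have N: "N > 0" "norm x \<le> N" by (auto simp: N_def add_nonneg_pos)
    obtain n0 where n0: "\<And>m n. m \<ge> n0 \<Longrightarrow> n \<ge> n0 \<Longrightarrow> dist (y m) (y n) < e / N"
      using metric_CauchyD [OF ycau, of "e / N"] e N by auto
    have *: "dist (Y m x) (Y n x) < e" if "n \<ge> n0" "m \<ge> n" for m n
    proof -
      have "norm (Y m x - Y n x) \<le> (y m - y n) * norm x"
        using dYk [OF x, of n "m - n"] that by simp
      also have "\<dots> \<le> dist (y m) (y n) * N"
        using N by (intro mult_mono) (auto simp: dist_real_def)
      also have "\<dots> < e / N * N" using n0 [of m n] that N by (intro mult_strict_right_mono) auto
      finally show ?thesis using N by (simp add: dist_norm)
    qed
    have "dist (Y m x) (Y n x) < e" if "n \<ge> n0" "m \<ge> n0" for m n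
      using * [of n m] * [of m n] that by (cases "m \<ge> n") (auto simp: dist_commute)
    then show "\<exists>n0. \<forall>m\<ge>n0. \<forall>n\<ge>n0. dist (Y m x) (Y n x) < e" by blast
  qed
  define Z where "Z x = lim (\<lambda>n. Y n x)" for x
  have L: "(\<lambda>n. Y n x) \<longlonglongrightarrow> Z x" if "x \<in> M" for x
    using conv [OF that] unfolding Z_def by (simp add: convergent_LIMSEQ_iff)
  have ZM: "Z x \<in> M" if "x \<in> M" for x
    using closed_sequentially [OF csubspace_closed [OF M] _ L [OF that]] inY [OF that] by blast
  have Zn: "norm (Z x) \<le> norm x" if "x \<in> M" for x
  proof (rule LIMSEQ_le_const2 [OF tendsto_norm [OF L [OF that]]])
    have "norm (Y n x) \<le> norm x" for n
      using nY [OF that, of n] y01 [of n] mult_right_mono [of "y n" 1 "norm x"] by simp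
    then show "\<exists>N. \<forall>n\<ge>N. norm (Y n x) \<le> norm x" by blast
  qed
  have Zsa: "selfadjoint_op M Z"
    unfolding selfadjoint_op_def
  proof (intro conjI ballI)
    show "bounded_op M M Z"
    proof (rule bounded_opI [where C = 1])
      fix x y assume xy: "x \<in> M" "y \<in> M"
      have "(\<lambda>n. Y n (x + y)) \<longlonglongrightarrow> Z x + Z y"
        using tendsto_add [OF L [OF xy(1)] L [OF xy(2)]] by (simp add: bop_add [OF bY xy])
      then show "Z (x + y) = Z x + Z y"
        using L [OF csubspace_add [OF M xy]] LIMSEQ_unique by blast
    next
      fix c x assume x: "x \<in> M"
      have "(\<lambda>n. Y n (c *\<^sub>C x)) \<longlonglongrightarrow> c *\<^sub>C Z x"
        using scaleC.tendsto [OF tendsto_const L [OF x]] by (simp add: bop_scaleC [OF bY x])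
      then show "Z (c *\<^sub>C x) = c *\<^sub>C Z x"
        using L [OF csubspace_scaleC [OF M x]] LIMSEQ_unique by blast
    qed (use ZM Zn in auto)
    fix u v assume uv: "u \<in> M" "v \<in> M"
    have "(\<lambda>n. cinner (Y n u) v) \<longlonglongrightarrow> cinner (Z u) v"
      by (intro cinner.tendsto L uv tendsto_const)
    moreover have "(\<lambda>n. cinner u (Y n v)) \<longlonglongrightarrow> cinner u (Z v)"
      by (intro cinner.tendsto L uv tendsto_const)
    ultimately show "cinner (Z u) v = cinner u (Z v)"
      using LIMSEQ_unique by (simp add: sa_sym [OF sa uv])
  qed
  have ZZ: "2 *\<^sub>R Z x = B x + Z (Z x)" if x: "x \<in> M" for x
  proof -
    have "(\<lambda>n. Y n (Y n x) - Y n (Z x)) \<longlonglongrightarrow> 0"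
    proof (rule Lim_null_comparison)
      have "norm (Y n (Y n x) - Y n (Z x)) \<le> norm (Y n x - Z x)" for n
      proof -
        have d: "Y n x - Z x \<in> M" using M inY [OF x] ZM [OF x] by (rule csubspace_diff)
        show ?thesis
          using nY [OF d, of n] y01 [of n] mult_right_mono [of "y n" 1 "norm (Y n x - Z x)"]
          by (simp add: bop_diff [OF bY M inY [OF x] ZM [OF x]])
      qed
      then show "\<forall>\<^sub>F n in sequentially. norm (Y n (Y n x) - Y n (Z x)) \<le> norm (Y n x - Z x)" by simp
      show "(\<lambda>n. norm (Y n x - Z x)) \<longlonglongrightarrow> 0"
        using L [OF x] by (simp add: LIM_zero_iff tendsto_norm_zero_iff)
    qed
    from tendsto_add [OF this L [OF ZM [OF x]]]
    have "(\<lambda>n. Y n (Y n x)) \<longlonglongrightarrow> Z (Z x)" by simp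
    then have "(\<lambda>n. Y (Suc n) x) \<longlonglongrightarrow> (1/2) *\<^sub>R (B x + Z (Z x))"
      unfolding YS by (intro tendsto_intros)
    with LIMSEQ_Suc [OF L [OF x]] have "Z x = (1/2) *\<^sub>R (B x + Z (Z x))"
      by (rule LIMSEQ_unique)
    then have "2 *\<^sub>R Z x = 2 *\<^sub>R (1/2) *\<^sub>R (B x + Z (Z x))" by (rule arg_cong)
    then show ?thesis by simp
  qed
  \<comment> \<open>Each \<open>Y n\<close> is a polynomial in \<open>B\<close> and so commutes with
    everything that commutes with \<open>B\<close>; the limit inherits this. Uniqueness of the
    square root rests on it.\<close>
  have comm: "C (Z x) = Z (C x)"
    if C: "bounded_op M M C" and CB: "\<And>x. x \<in> M \<Longrightarrow> C (B x) = B (C x)" and x: "x \<in> M" for C x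
  proof -
    have "C (Y n x) = Y n (C x)" if "x \<in> M" for n x
      using that
    proof (induction n arbitrary: x)
      case 0 then show ?case using bop_0 [OF C M] by (simp add: Y0)
    next
      case (Suc n)
      have i: "B x \<in> M" "Y n (Y n x) \<in> M" "B x + Y n (Y n x) \<in> M"
        using bop_in [OF sa_bounded [OF B] Suc.prems] inY Suc.prems csubspace_add [OF M] by auto
      have "C (Y n (Y n x)) = Y n (Y n (C x))"
        using Suc.IH [OF inY [OF Suc.prems, of n]] Suc.IH [OF Suc.prems] by simp
      then show ?case unfolding YS using CB [OF Suc.prems]
        by (simp only: bop_scaleR [OF C i(3)] bop_add [OF C i(1) i(2)])
    qed
    note * = this
    have "(\<lambda>n. C (Y n x)) \<longlonglongrightarrow> C (Z x)"
      by (rule bop_tendsto [OF C M inY [OF x] ZM [OF x] L [OF x]])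
    moreover have "(\<lambda>n. C (Y n x)) \<longlonglongrightarrow> Z (C x)"
      using L [OF bop_in [OF C x]] by (simp add: * [OF x])
    ultimately show ?thesis by (rule LIMSEQ_unique)
  qed
  show ?thesis using Zsa Zn ZZ comm by (intro exI [of _ Z]) blast
qed

text \<open>Scale \<open>G\<close> by a bound \<open>c\<close> and put \<open>B = 1 - G/c\<close>,
  which is positive and of norm at most 1. The fixed point equation \<open>2 Y = B + Y^2\<close>
  says \<open>(1 - Y)^2 = 1 - B = G/c\<close>, so \<open>sqrt c * (1 - Y)\<close> is a root; it is
  positive because \<open>norm Y\<close> is at most 1.\<close>

lemma positive_sqrt_exists:
  fixes G :: "'a::complex_hilbert \<Rightarrow> 'a"
  assumes M: "closed_csubspace M" and G: "positive_op M G"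
  shows "\<exists>S. positive_op M S \<and> (\<forall>x\<in>M. S (S x) = G x) \<and>
    (\<forall>C. bounded_op M M C \<longrightarrow> (\<forall>x\<in>M. C (G x) = G (C x)) \<longrightarrow> (\<forall>x\<in>M. C (S x) = S (C x)))"
proof -
  obtain c where c: "c > 0" "\<And>x. x \<in> M \<Longrightarrow> norm (G x) \<le> c * norm x"
    using bop_bound [OF pos_bounded [OF G]] by blast
  have sG: "selfadjoint_op M G" using M G by (rule positive_selfadjoint)
  define B where "B x = x - (1/c) *\<^sub>R G x" for x
  have sB: "selfadjoint_op M B"
    using selfadjoint_op_diff [OF M selfadjoint_op_scaleR_id [OF M, of 1] selfadjoint_op_scaleR [OF M sG]]
    unfolding B_def by simp
  have form: "Re (cinner (B x) x) = (norm x)\<^sup>2 - Re (cinner (G x) x) / c" for x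
    by (simp add: B_def cinner_simps norm_sq_cinner)
  have pB: "positive_op M B"
  proof (rule positive_opI [OF sB])
    fix x assume "x \<in> M"
    then have "Re (cinner (G x) x) \<le> c * (norm x)\<^sup>2"
      by (intro Re_cinner_le_bound c(2))
    then show "0 \<le> Re (cinner (B x) x)"
      using c(1) unfolding form by (simp add: field_simps)
  qed
  have B1: "norm (B x) \<le> norm x" if "x \<in> M" for x
  proof -
    have "norm (B x) \<le> 1 * norm x"
      by (rule positive_norm_le [OF M pB _ _ that]) (use c(1) pos_Re [OF G] in \<open>auto simp: form\<close>)
    then show ?thesis by simp
  qed
  obtain Y where Y: "selfadjoint_op M Y" "\<forall>x\<in>M. norm (Y x) \<le> norm x"
    "\<forall>x\<in>M. 2 *\<^sub>R Y x = B x + Y (Y x)"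
    "\<forall>C. bounded_op M M C \<longrightarrow> (\<forall>x\<in>M. C (B x) = B (C x)) \<longrightarrow> (\<forall>x\<in>M. C (Y x) = Y (C x))"
    using sqrt_iteration [OF M sB B1] by blast
  note bY = sa_bounded [OF Y(1)]
  define S where "S x = sqrt c *\<^sub>R (x - Y x)" for x
  have sS: "selfadjoint_op M S"
    using selfadjoint_op_scaleR [OF M selfadjoint_op_diff [OF M selfadjoint_op_scaleR_id [OF M, of 1] Y(1)]]
    unfolding S_def by simp
  have pS: "positive_op M S"
  proof (rule positive_opI [OF sS])
    fix x assume "x \<in> M"
    then have "Re (cinner (Y x) x) \<le> 1 * (norm x)\<^sup>2"
      using Y(2) by (intro Re_cinner_le_bound) simp
    then show "0 \<le> Re (cinner (S x) x)"
      using c(1) by (simp add: S_def cinner_simps norm_sq_cinner)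
  qed
  have SS: "S (S x) = G x" if x: "x \<in> M" for x
  proof -
    have yx: "Y x \<in> M" using bop_in [OF bY x] .
    have "Y (sqrt c *\<^sub>R (x - Y x)) = sqrt c *\<^sub>R (Y x - Y (Y x))"
      by (simp only: bop_scaleR [OF bY csubspace_diff [OF M x yx]] bop_diff [OF bY M x yx])
    then have "S (S x) = (sqrt c * sqrt c) *\<^sub>R ((x - Y x) - (Y x - Y (Y x)))"
      by (simp add: S_def scaleR_diff_right)
    also have "\<dots> = c *\<^sub>R (x - 2 *\<^sub>R Y x + Y (Y x))" using c(1) by (simp add: algebra_simps scaleR_2)
    also have "\<dots> = c *\<^sub>R (x - B x)" using Y(3) x by simp
    also have "\<dots> = G x" using c(1) by (simp add: B_def)
    finally show ?thesis .
  qed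
  have comm: "C (S x) = S (C x)"
    if C: "bounded_op M M C" "\<forall>x\<in>M. C (G x) = G (C x)" and x: "x \<in> M" for C x
  proof -
    have "C (B x) = B (C x)" if x: "x \<in> M" for x
      using C(2) x bop_in [OF pos_bounded [OF G] x]
      by (simp add: B_def bop_diff [OF C(1) M] bop_scaleR [OF C(1)] csubspace_scaleR [OF M])
    then have "C (Y x) = Y (C x)" using Y(4) C(1) x by blast
    then show ?thesis
      using x bop_in [OF bY x]
      by (simp only: S_def bop_diff [OF C(1) M] bop_scaleR [OF C(1)] csubspace_diff [OF M])
  qed
  show ?thesis using pS SS comm by (intro exI [of _ S]) blast
qed

text \<open>A second root \<open>R\<close> commutes with \<open>G = R^2\<close>, hence with
  \<open>S\<close>. For \<open>y = (S - R) x\<close> this gives \<open>(S + R) y = 0\<close>; both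
  forms are nonnegative, so \<open>S y = R y = 0\<close>, and
  \<open>cinner y y = cinner x ((S - R) y) = 0\<close>.\<close>

lemma positive_sqrt_ex1:
  fixes G :: "'a::complex_hilbert \<Rightarrow> 'a"
  assumes M: "closed_csubspace M" and G: "positive_op M G"
  shows "\<exists>!S. S \<in> extensional M \<and> positive_op M S \<and> (\<forall>x\<in>M. S (S x) = G x)"
proof -
  obtain S where S: "positive_op M S" "\<forall>x\<in>M. S (S x) = G x"
    and comm: "\<forall>C. bounded_op M M C \<longrightarrow> (\<forall>x\<in>M. C (G x) = G (C x)) \<longrightarrow> (\<forall>x\<in>M. C (S x) = S (C x))"
    using positive_sqrt_exists [OF M G] by blast
  note bS = pos_bounded [OF S(1)]
  have unique: "R x = S x" if R: "positive_op M R" "\<And>x. x \<in> M \<Longrightarrow> R (R x) = G x" and x: "x \<in> M" for R x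
  proof -
    note bR = pos_bounded [OF R(1)]
    have "R (G x) = G (R x)" if "x \<in> M" for x
      by (metis R(2) bR bop_in that)
    then have RS: "R (S x) = S (R x)" if "x \<in> M" for x using comm bR that by blast
    have i: "S x \<in> M" "R x \<in> M" using x bop_in bS bR by blast+
    define y where "y = S x - R x"
    have y: "y \<in> M" unfolding y_def using M i by (simp add: csubspace_diff)
    have Sy: "S y = G x - S (R x)" and Ry: "R y = S (R x) - G x"
      unfolding y_def using x i S(2) R(2) RS by (simp_all add: bop_diff [OF bS M] bop_diff [OF bR M])
    have "S y + R y = 0" by (simp add: Sy Ry)
    then have "Re (cinner (S y) y) + Re (cinner (R y) y) = 0"
      by (metis cinner_add_left cinner.zero_left plus_complex.simps(1) zero_complex.simps(1))
    then have "Re (cinner (S y) y) = 0" "Re (cinner (R y) y) = 0"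
      using pos_Re [OF S(1) y] pos_Re [OF R(1) y] by linarith+
    then have "S y = 0" "R y = 0"
      using positive_eq_0 [OF M S(1) y] positive_eq_0 [OF M R(1) y] by auto
    moreover have "cinner y y = cinner x (S y) - cinner x (R y)"
      using sa_sym [OF positive_selfadjoint [OF M S(1)] x y] sa_sym [OF positive_selfadjoint [OF M R(1)] x y]
      by (simp add: y_def cinner.diff_left)
    ultimately have "y = 0" by simp
    then show ?thesis by (simp add: y_def)
  qed
  show ?thesis
  proof (rule ex1I [of _ "restrict S M"])
    have "positive_op M (restrict S M)"
      using S(1) M unfolding positive_op_def bounded_op_def
      by (auto simp: csubspace_add csubspace_scaleC)
    then show "restrict S M \<in> extensional M \<and> positive_op M (restrict S M) \<and>
        (\<forall>x\<in>M. restrict S M (restrict S M x) = G x)"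
      using S(2) bop_in [OF bS] by simp
    fix R assume R: "R \<in> extensional M \<and> positive_op M R \<and> (\<forall>x\<in>M. R (R x) = G x)"
    show "R = restrict S M"
    proof (rule extensionalityI [of _ M])
      show "R x = restrict S M x" if "x \<in> M" for x using unique [of R x] R that by simp
    qed (use R in auto)
  qed
qed

text \<open>The squared modulus is \<open>adj M T (T x)\<close>, whose form at \<open>x\<close> is
  \<open>(norm (T x))^2\<close>. Beyond positivity, equality of norms is all that is kept of the
  modulus on \<open>M\<close>.\<close>

lemma
  fixes T :: "'a::complex_hilbert \<Rightarrow> 'b::complex_hilbert"
  assumes M: "closed_csubspace M" and T: "bounded_op M UNIV T"
  shows positive_abs_op: "positive_op M (abs_op M T)"
    and norm_abs_op: "x \<in> M \<Longrightarrow> norm (abs_op M T x) = norm (T x)"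
proof -
  let ?G = "\<lambda>x. adj M T (T x)"
  have form: "cinner (?G x) y = cinner (T x) (T y)" if "y \<in> M" for x y
    using cinner_adj_left [OF M T that] .
  have "positive_op M ?G"
  proof (rule positive_opI)
    show "selfadjoint_op M ?G"
      using bounded_op_compose [OF T bounded_op_adj [OF M T]]
      by (simp add: selfadjoint_op_def form cinner_adj [OF M T])
    show "0 \<le> Re (cinner (?G x) x)" if "x \<in> M" for x
      using that by (simp add: form norm_sq_cinner [symmetric])
  qed
  from theI' [OF positive_sqrt_ex1 [OF M this]]
  have S: "positive_op M (abs_op M T)" "\<forall>x\<in>M. abs_op M T (abs_op M T x) = ?G x"
    unfolding abs_op_def op_sqrt_def by blast+
  show "positive_op M (abs_op M T)" by (rule S)
  show "norm (abs_op M T x) = norm (T x)" if x: "x \<in> M"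
  proof -
    have "(norm (abs_op M T x))\<^sup>2 = Re (cinner (abs_op M T (abs_op M T x)) x)"
      using sa_sym [OF positive_selfadjoint [OF M S(1)] bop_in [OF pos_bounded [OF S(1)] x] x]
      by (simp add: norm_sq_cinner)
    also have "\<dots> = (norm (T x))\<^sup>2"
      using S(2) x by (simp add: form norm_sq_cinner)
    finally show ?thesis by (simp add: power2_eq_iff_nonneg)
  qed
qed

section \<open>Orthonormal sets and finite-dimensional subspaces\<close>

definition orthonormal_set :: "'a::complex_hilbert set \<Rightarrow> bool" where
  "orthonormal_set S \<longleftrightarrow> (\<forall>x\<in>S. \<forall>y\<in>S. cinner x y = (if x = y then 1 else 0))"

lemma orthonormal_setD:
  "orthonormal_set S \<Longrightarrow> x \<in> S \<Longrightarrow> y \<in> S \<Longrightarrow> cinner x y = (if x = y then 1 else 0)"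
  by (simp add: orthonormal_set_def)

lemma orthonormal_set_subset: "orthonormal_set S \<Longrightarrow> S' \<subseteq> S \<Longrightarrow> orthonormal_set S'"
  unfolding orthonormal_set_def by blast

lemma cinner_eq_1_norm: "cinner x x = 1 \<longleftrightarrow> norm (x :: 'a::complex_hilbert) = 1"
  by (metis cinner_self norm_ge_zero of_real_1 of_real_eq_iff one_power2 power2_eq_iff_nonneg zero_le_one)

lemma orthonormal_set_norm: "orthonormal_set S \<Longrightarrow> x \<in> S \<Longrightarrow> norm x = 1"
  using orthonormal_setD [of S x x] by (simp add: cinner_eq_1_norm)

lemma orthonormal_set_insert:
  assumes "orthonormal_set S" "norm u = 1" "\<And>s. s \<in> S \<Longrightarrow> cinner u s = 0"
  shows "orthonormal_set (insert u S)" and "u \<notin> S"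
proof -
  have "cinner s u = 0" if "s \<in> S" for s using assms(3) [OF that] by (simp add: cinner_eq_0_commute)
  moreover show "u \<notin> S"
    using assms(3) [of u] assms(2) by auto
  ultimately show "orthonormal_set (insert u S)"
    using assms cinner_eq_1_norm [of u] by (auto simp: orthonormal_set_def)
qed

lemma cinner_orthonormal_sum:
  assumes S: "orthonormal_set S" "finite S" and t: "t \<in> S"
  shows "cinner (\<Sum>s\<in>S. u s *\<^sub>C s) t = u t"
proof -
  have "cinner (\<Sum>s\<in>S. u s *\<^sub>C s) t = (\<Sum>s\<in>S. if s = t then u s else 0)"
    unfolding cinner.sum_left
    by (intro sum.cong) (auto simp: cinner_scaleC_left orthonormal_setD [OF S(1) _ t])
  then show ?thesis using S(2) t by simp
qed

lemma orthonormal_expansion: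
  assumes S: "orthonormal_set S" "finite S" and x: "x \<in> complex_vector.span S"
  shows "x = (\<Sum>s\<in>S. cinner x s *\<^sub>C s)"
proof -
  obtain u where u: "x = (\<Sum>s\<in>S. u s *\<^sub>C s)"
    using x complex_vector.span_finite [OF S(2)] by auto
  have "(\<Sum>s\<in>S. cinner x s *\<^sub>C s) = (\<Sum>s\<in>S. u s *\<^sub>C s)"
    by (intro sum.cong) (auto simp: u cinner_orthonormal_sum [OF S])
  then show ?thesis by (simp add: u)
qed

lemma orthonormal_residual:
  assumes S: "orthonormal_set S" "finite S" and t: "t \<in> S"
  shows "cinner (x - (\<Sum>s\<in>S. cinner x s *\<^sub>C s)) t = 0"
  by (simp add: cinner.diff_left cinner_orthonormal_sum [OF S t])

lemma orthonormal_sum_in_span: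
  "(\<Sum>s\<in>S. u s *\<^sub>C s) \<in> complex_vector.span S"
  by (intro complex_vector.span_sum complex_vector.span_scale complex_vector.span_base)

lemma closed_csubspace_span_orthonormal:
  assumes S: "orthonormal_set S" "finite S"
  shows "closed_csubspace (complex_vector.span S)"
  unfolding closed_csubspace_def closed_sequential_limits
proof (intro conjI allI impI)
  fix x l assume x: "(\<forall>n. x n \<in> complex_vector.span S) \<and> x \<longlonglongrightarrow> l"
  have "(\<lambda>n. \<Sum>s\<in>S. cinner (x n) s *\<^sub>C s) \<longlonglongrightarrow> (\<Sum>s\<in>S. cinner l s *\<^sub>C s)"
    using x by (intro tendsto_sum scaleC.tendsto cinner.tendsto tendsto_const) auto
  moreover have "(\<lambda>n. \<Sum>s\<in>S. cinner (x n) s *\<^sub>C s) = x"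
    using x by (intro ext orthonormal_expansion [OF S, symmetric]) auto
  ultimately have "l = (\<Sum>s\<in>S. cinner l s *\<^sub>C s)" using x LIMSEQ_unique by metis
  then show "l \<in> complex_vector.span S" using orthonormal_sum_in_span by metis
qed (rule complex_vector.subspace_span)

lemma orthonormal_set_independent:
  assumes S: "orthonormal_set S" "finite S"
  shows "complex_vector.independent S"
  unfolding complex_vector.dependent_finite [OF S(2)]
  using cinner_orthonormal_sum [OF S] by (metis cinner.zero_left)

lemma orthonormal_extend:
  assumes S: "orthonormal_set S" "finite S" "S \<subseteq> V" and V: "complex_vector.subspace V"
    and "\<not> V \<subseteq> complex_vector.span S"
  obtains u where "u \<in> V" "norm u = 1" "\<And>s. s \<in> S \<Longrightarrow> cinner u s = 0"
proof -
  obtain v where v: "v \<in> V" "v \<notin> complex_vector.span S" using assms by blast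
  define p where "p = (\<Sum>s\<in>S. cinner v s *\<^sub>C s)"
  have p: "p \<in> complex_vector.span S" unfolding p_def by (rule orthonormal_sum_in_span)
  then have pV: "p \<in> V" using complex_vector.span_minimal [OF S(3) V] by blast
  have ne: "v - p \<noteq> 0" using v p by auto
  define c where "c = complex_of_real (inverse (norm (v - p)))"
  show thesis
  proof
    show "c *\<^sub>C (v - p) \<in> V"
      using V v pV by (intro complex_vector.subspace_scale complex_vector.subspace_diff)
    show "norm (c *\<^sub>C (v - p)) = 1" using ne by (simp add: norm_scaleC c_def norm_inverse)
    show "cinner (c *\<^sub>C (v - p)) s = 0" if "s \<in> S" for s
      using orthonormal_residual [OF S(1,2) that, of v] by (simp add: cinner_scaleC_left p_def)
  qed
qed

text \<open>An orthonormal subset of \<open>V\<close> of largest cardinality spans \<open>V\<close>: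
  the cardinalities are bounded by \<open>card B\<close>, and a vector outside the span would leave
  a residual to adjoin.\<close>

lemma orthonormal_basis_exists:
  assumes V: "complex_vector.subspace V" and B: "finite B" "V \<subseteq> complex_vector.span B"
  obtains S where "finite S" "orthonormal_set S" "S \<subseteq> V" "complex_vector.span S = V"
proof -
  define P where "P n \<longleftrightarrow> (\<exists>S. finite S \<and> orthonormal_set S \<and> S \<subseteq> V \<and> card S = n)" for n
  have bound: "n \<le> card B" if "P n" for n
  proof -
    obtain S where S: "finite S" "orthonormal_set S" "S \<subseteq> V" "card S = n"
      using \<open>P n\<close> unfolding P_def by blast
    have "S \<subseteq> complex_vector.span B" using S B by blast
    then show ?thesis
      using complex_vector.independent_span_bound [OF B(1) orthonormal_set_independent [OF S(2,1)]] S(4)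
      by simp
  qed
  have "P 0" unfolding P_def by (intro exI [of _ "{}"]) (simp add: orthonormal_set_def)
  define m where "m = (GREATEST n. P n)"
  have "P m" unfolding m_def using \<open>P 0\<close> bound by (rule GreatestI_nat)
  then obtain S where S: "finite S" "orthonormal_set S" "S \<subseteq> V" "card S = m" unfolding P_def by blast
  have "V \<subseteq> complex_vector.span S"
  proof (rule ccontr)
    assume "\<not> V \<subseteq> complex_vector.span S"
    then obtain u where u: "u \<in> V" "norm u = 1" "\<And>s. s \<in> S \<Longrightarrow> cinner u s = 0"
      using orthonormal_extend [OF S(2,1,3) V] by metis
    have "P (Suc m)"
      unfolding P_def using S u orthonormal_set_insert [OF S(2) u(2,3)]
      by (intro exI [of _ "insert u S"]) auto
    then have "Suc m \<le> m" unfolding m_def using bound by (rule Greatest_le_nat)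
    then show False by simp
  qed
  moreover have "complex_vector.span S \<subseteq> V" using S(3) V by (rule complex_vector.span_minimal)
  ultimately show thesis using S that by blast
qed

section \<open>Dimension counted by finite orthonormal sets\<close>

lemma edim_finiteD: "edim V < \<infinity> \<Longrightarrow> \<exists>B. finite B \<and> V \<subseteq> complex_vector.span B"
  by (auto simp: edim_def split: if_splits)

text \<open>Dimensions are compared through this criterion, which treats finite and infinite
  dimension alike and makes orthogonality available in every count.\<close>

lemma enat_le_edim_iff:
  assumes V: "complex_vector.subspace V"
  shows "enat n \<le> edim V \<longleftrightarrow> (\<exists>S. finite S \<and> orthonormal_set S \<and> S \<subseteq> V \<and> card S = n)"
proof (cases "\<exists>B. finite B \<and> V \<subseteq> complex_vector.span B")
  case True
  then obtain B where B: "finite B" "V \<subseteq> complex_vector.span B" by blast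
  obtain S where S: "finite S" "orthonormal_set S" "S \<subseteq> V" "complex_vector.span S = V"
    using orthonormal_basis_exists [OF V B] by metis
  have d: "complex_vector.dim V = card S"
    using complex_vector.dim_span [of S] S(4)
      complex_vector.dim_eq_card_independent [OF orthonormal_set_independent [OF S(2,1)]] by simp
  show ?thesis
  proof
    assume "enat n \<le> edim V"
    then have "n \<le> card S" using True d by (simp add: edim_def)
    then obtain S' where "S' \<subseteq> S" "card S' = n" by (meson obtain_subset_with_card_n)
    then show "\<exists>S. finite S \<and> orthonormal_set S \<and> S \<subseteq> V \<and> card S = n"
      using S orthonormal_set_subset [OF S(2)] by (intro exI [of _ S']) (auto simp: finite_subset)
  next
    assume "\<exists>S. finite S \<and> orthonormal_set S \<and> S \<subseteq> V \<and> card S = n"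
    then obtain S' where S': "finite S'" "orthonormal_set S'" "S' \<subseteq> V" "card S' = n" by blast
    have "card S' \<le> card S"
      using complex_vector.independent_span_bound [OF S(1) orthonormal_set_independent [OF S'(2,1)]] S S' by simp
    then show "enat n \<le> edim V" using True d S' by (simp add: edim_def)
  qed
next
  case False
  have "\<exists>S. finite S \<and> orthonormal_set S \<and> S \<subseteq> V \<and> card S = n"
  proof (induction n)
    case 0 show ?case by (intro exI [of _ "{}"]) (simp add: orthonormal_set_def)
  next
    case (Suc n)
    then obtain S where S: "finite S" "orthonormal_set S" "S \<subseteq> V" "card S = n" by blast
    then have "\<not> V \<subseteq> complex_vector.span S" using False by blast
    then obtain u where u: "u \<in> V" "norm u = 1" "\<And>s. s \<in> S \<Longrightarrow> cinner u s = 0"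
      using orthonormal_extend [OF S(2,1,3) V] by metis
    show ?case
      using S u orthonormal_set_insert [OF S(2) u(2,3)] by (intro exI [of _ "insert u S"]) auto
  qed
  moreover have "edim V = \<infinity>" unfolding edim_def using False by (simp only: if_False)
  ultimately show ?thesis by simp
qed

lemma orthonormal_upto_set:
  assumes "orthonormal_upto n x"
  shows "orthonormal_set (x ` {1..n})" "card (x ` {1..n}) = n"
proof -
  have *: "cinner (x i) (x j) = (if i = j then 1 else 0)" if "i \<in> {1..n}" "j \<in> {1..n}" for i j
    using assms that by (auto simp: orthonormal_upto_def)
  have inj: "inj_on x {1..n}"
  proof (rule inj_onI)
    fix i j assume ij: "i \<in> {1..n}" "j \<in> {1..n}" "x i = x j"
    then show "i = j" using * [OF ij(1,1)] * [OF ij(1,2)] by (auto split: if_splits)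
  qed
  then show "card (x ` {1..n}) = n" by (simp add: card_image)
  show "orthonormal_set (x ` {1..n})"
    using * inj by (auto simp: orthonormal_set_def inj_on_eq_iff)
qed

lemma orthonormal_set_upto:
  assumes "finite S" "orthonormal_set S" "card S = n"
  obtains x where "orthonormal_upto n x" "x ` {1..n} = S"
proof -
  obtain x where x: "bij_betw x {1..n} S"
    using finite_same_card_bij [of "{1..n}" S] assms by auto
  have "orthonormal_upto n x"
    using assms(2) x unfolding orthonormal_upto_def orthonormal_set_def bij_betw_def
    by (auto simp: inj_on_eq_iff)
  then show thesis using x by (intro that) (auto simp: bij_betw_def)
qed

lemma enat_le_edim_upto:
  assumes "complex_vector.subspace V"
  shows "enat n \<le> edim V \<longleftrightarrow> (\<exists>x. orthonormal_upto n x \<and> (\<forall>i\<in>{1..n}. x i \<in> V))"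
proof
  assume "enat n \<le> edim V"
  then obtain S where S: "finite S" "orthonormal_set S" "S \<subseteq> V" "card S = n"
    using enat_le_edim_iff [OF assms] by blast
  then show "\<exists>x. orthonormal_upto n x \<and> (\<forall>i\<in>{1..n}. x i \<in> V)"
    using orthonormal_set_upto [OF S(1,2,4)] by (metis image_eqI subsetD)
next
  assume "\<exists>x. orthonormal_upto n x \<and> (\<forall>i\<in>{1..n}. x i \<in> V)"
  then obtain x where x: "orthonormal_upto n x" "x ` {1..n} \<subseteq> V" by blast
  show "enat n \<le> edim V"
    unfolding enat_le_edim_iff [OF assms]
    using orthonormal_upto_set [OF x(1)] x(2) by (intro exI [of _ "x ` {1..n}"]) simp
qed

lemma edim_mono:
  assumes "complex_vector.subspace V" "complex_vector.subspace W" "V \<subseteq> W"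
  shows "edim V \<le> edim W"
proof -
  have "enat n \<le> edim V \<longrightarrow> enat n \<le> edim W" for n
    unfolding enat_le_edim_iff [OF assms(1)] enat_le_edim_iff [OF assms(2)] using assms(3) by blast
  then show ?thesis by (cases "edim V"; cases "edim W") (auto simp: less_le_not_le, meson Suc_n_not_le_n)
qed

section \<open>Compactness and images in finite dimension\<close>

lemma compact_orthonormal_sums:
  assumes "finite S"
  shows "compact {y. \<exists>u. (\<forall>s\<in>S. cmod (u s) \<le> R) \<and> y = (\<Sum>s\<in>S. u s *\<^sub>C (s :: 'a::complex_hilbert))}"
  using assms
proof (induction S rule: finite_induct)
  case (insert a S)
  let ?K = "\<lambda>S. {y. \<exists>u. (\<forall>s\<in>S. cmod (u s) \<le> R) \<and> y = (\<Sum>s\<in>S. u s *\<^sub>C s)}"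
  have "?K (insert a S) = (\<lambda>(c, y). c *\<^sub>C a + y) ` (cball 0 R \<times> ?K S)"
  proof (intro equalityI subsetI)
    fix y assume "y \<in> ?K (insert a S)"
    then obtain u where u: "\<forall>s\<in>insert a S. cmod (u s) \<le> R" "y = (\<Sum>s\<in>insert a S. u s *\<^sub>C s)" by blast
    then show "y \<in> (\<lambda>(c, y). c *\<^sub>C a + y) ` (cball 0 R \<times> ?K S)"
      using insert.hyps by (intro image_eqI [of _ _ "(u a, \<Sum>s\<in>S. u s *\<^sub>C s)"]) auto
  next
    fix y assume "y \<in> (\<lambda>(c, y). c *\<^sub>C a + y) ` (cball 0 R \<times> ?K S)"
    then obtain c u where u: "cmod c \<le> R" "\<forall>s\<in>S. cmod (u s) \<le> R" "y = c *\<^sub>C a + (\<Sum>s\<in>S. u s *\<^sub>C s)"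
      by auto
    have "(\<Sum>s\<in>S. (u(a := c)) s *\<^sub>C s) = (\<Sum>s\<in>S. u s *\<^sub>C s)"
      using insert.hyps by (intro sum.cong) auto
    then have "y = (\<Sum>s\<in>insert a S. (u(a := c)) s *\<^sub>C s)"
      using insert.hyps u(3) by simp
    moreover have "\<forall>s\<in>insert a S. cmod ((u(a := c)) s) \<le> R" using u by auto
    ultimately show "y \<in> ?K (insert a S)" by blast
  qed
  moreover have "compact ((\<lambda>(c, y). c *\<^sub>C a + y) ` (cball 0 R \<times> ?K S))"
    unfolding case_prod_beta
    by (intro compact_continuous_image compact_Times compact_cball insert.IH continuous_intros
        scaleC.continuous_on)
  ultimately show ?case by metis
qed simp

lemma compact_finite_dim_ball:
  assumes V: "complex_vector.subspace V" and B: "finite B" "V \<subseteq> complex_vector.span B"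
  shows "compact {x \<in> V. norm x \<le> R}"
proof -
  obtain S where S: "finite S" "orthonormal_set S" "S \<subseteq> V" "complex_vector.span S = V"
    using orthonormal_basis_exists [OF V B] by metis
  let ?K = "{y. \<exists>u. (\<forall>s\<in>S. cmod (u s) \<le> R) \<and> y = (\<Sum>s\<in>S. u s *\<^sub>C s)}"
  have "{x \<in> V. norm x \<le> R} = ?K \<inter> (V \<inter> cball 0 R)"
  proof -
    have "x \<in> ?K" if x: "x \<in> V" "norm x \<le> R" for x
    proof -
      have "cmod (cinner x s) \<le> R" if "s \<in> S" for s
        using cinner_cauchy_schwarz [of x s] orthonormal_set_norm [OF S(2) that] x(2) by simp
      moreover have "x = (\<Sum>s\<in>S. cinner x s *\<^sub>C s)"
        using x(1) S(4) by (intro orthonormal_expansion [OF S(2,1)]) simp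
      ultimately show ?thesis by blast
    qed
    then show ?thesis by auto
  qed
  moreover have "closed (V \<inter> cball 0 R)"
    using csubspace_closed [OF closed_csubspace_span_orthonormal [OF S(2,1)]] S(4) by (intro closed_Int) auto
  then have "compact (?K \<inter> (V \<inter> cball 0 R))"
    by (rule compact_Int_closed [OF compact_orthonormal_sums [OF S(1)]])
  ultimately show ?thesis by (simp only:)
qed

lemma finite_dim_subsequence:
  assumes V: "complex_vector.subspace V" and B: "finite B" "V \<subseteq> complex_vector.span B"
    and x: "\<And>n::nat. x n \<in> V" "\<And>n. norm (x n) \<le> R"
  shows "\<exists>r l. strict_mono (r :: nat \<Rightarrow> nat) \<and> (x \<circ> r) \<longlonglongrightarrow> l"
proof -
  have "compact {x \<in> V. norm x \<le> R}" using V B by (rule compact_finite_dim_ball)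
  then show ?thesis unfolding compact_def using x by fast
qed

lemma bop_sum:
  assumes T: "bounded_op M N T" and M: "closed_csubspace M" and x: "\<And>i. i \<in> I \<Longrightarrow> x i \<in> M"
  shows "T (\<Sum>i\<in>I. u i *\<^sub>C x i) = (\<Sum>i\<in>I. u i *\<^sub>C T (x i))" (is "?P I")
    and "(\<Sum>i\<in>I. u i *\<^sub>C x i) \<in> M" (is "?Q I")
proof -
  have "?P I \<and> ?Q I"
    using x
  proof (induction I rule: infinite_finite_induct)
    case (insert i I)
    then have i: "x i \<in> M" "u i *\<^sub>C x i \<in> M" and IH: "?P I" "?Q I"
      using M by (auto simp: csubspace_scaleC)
    have sum: "(\<Sum>i\<in>insert i I. u i *\<^sub>C x i) = u i *\<^sub>C x i + (\<Sum>i\<in>I. u i *\<^sub>C x i)"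
      "(\<Sum>i\<in>insert i I. u i *\<^sub>C T (x i)) = u i *\<^sub>C T (x i) + (\<Sum>i\<in>I. u i *\<^sub>C T (x i))"
      using insert.hyps by simp_all
    show ?case
      unfolding sum using IH bop_add [OF T i(2) IH(2)] bop_scaleC [OF T i(1)] csubspace_add [OF M i(2) IH(2)]
      by simp
  qed (simp_all add: bop_0 [OF T M] csubspace_0 [OF M])
  then show "?P I" "?Q I" by auto
qed

lemma subspace_image:
  assumes T: "bounded_op M N T" and M: "closed_csubspace M"
  shows "complex_vector.subspace (T ` M)"
  unfolding complex_vector.subspace_def
proof (intro conjI ballI allI)
  show "0 \<in> T ` M" using csubspace_0 [OF M] bop_0 [OF T M] by force
  show "x + y \<in> T ` M" if xy: "x \<in> T ` M" "y \<in> T ` M" for x y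
  proof -
    obtain a b where "a \<in> M" "b \<in> M" "x = T a" "y = T b" using xy by blast
    then show ?thesis using bop_add [OF T] csubspace_add [OF M] by (metis imageI)
  qed
  show "c *\<^sub>C x \<in> T ` M" if x: "x \<in> T ` M" for x c
  proof -
    obtain a where "a \<in> M" "x = T a" using x by blast
    then show ?thesis using bop_scaleC [OF T] csubspace_scaleC [OF M] by (metis imageI)
  qed
qed

text \<open>Preimages of an orthonormal basis of the image span \<open>M\<close>, since
  \<open>x\<close> and the combination with the coefficients of \<open>F x\<close> have the same
  image.\<close>

lemma finite_dim_of_injective:
  assumes F: "bounded_op M N F" and M: "closed_csubspace M"
    and B: "finite B" "F ` M \<subseteq> complex_vector.span B"
    and inj: "\<And>x. x \<in> M \<Longrightarrow> F x = 0 \<Longrightarrow> x = 0"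
  shows "\<exists>B. finite B \<and> M \<subseteq> complex_vector.span B"
proof -
  obtain C where C: "finite C" "orthonormal_set C" "C \<subseteq> F ` M" "complex_vector.span C = F ` M"
    using orthonormal_basis_exists [OF subspace_image [OF F M] B] by blast
  have "\<forall>c\<in>C. \<exists>x. x \<in> M \<and> F x = c" using C(3) by auto
  then obtain b where b: "\<And>c. c \<in> C \<Longrightarrow> b c \<in> M" "\<And>c. c \<in> C \<Longrightarrow> F (b c) = c" by metis
  have "x \<in> complex_vector.span (b ` C)" if x: "x \<in> M" for x
  proof -
    define y where "y = (\<Sum>c\<in>C. cinner (F x) c *\<^sub>C b c)"
    have y: "y \<in> M" unfolding y_def by (rule bop_sum(2) [OF F M b(1)])
    have "F y = (\<Sum>c\<in>C. cinner (F x) c *\<^sub>C F (b c))"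
      unfolding y_def by (rule bop_sum(1) [OF F M b(1)])
    also have "\<dots> = (\<Sum>c\<in>C. cinner (F x) c *\<^sub>C c)"
      using b(2) by (intro sum.cong) auto
    also have "\<dots> = F x"
      using x C(4) by (intro orthonormal_expansion [OF C(2,1), symmetric]) simp
    finally have "F (x - y) = 0" by (simp add: bop_diff [OF F M x y])
    then have "x = y" using inj [OF csubspace_diff [OF M x y]] by simp
    moreover have "y \<in> complex_vector.span (b ` C)"
      unfolding y_def
      by (intro complex_vector.span_sum complex_vector.span_scale complex_vector.span_base imageI)
    ultimately show ?thesis by simp
  qed
  then show ?thesis using C(1) by (intro exI [of _ "b ` C"]) auto
qed

section \<open>Norm attainment\<close>

text \<open>On the zero subspace the supremum would run over the empty set; hence the assumption
  \<open>M \<noteq> {0}\<close> that accompanies its use.\<close>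

definition op_norm :: "'a::complex_hilbert set \<Rightarrow> ('a \<Rightarrow> 'b::complex_hilbert) \<Rightarrow> real" where
  "op_norm M T = (SUP x\<in>{x \<in> M. norm x = 1}. norm (T x))"

text \<open>Only norms of values occur, so the property passes freely between \<open>T\<close>, its
  modulus, and the modulus of its restriction.\<close>

definition attains_norm :: "'a::complex_hilbert set \<Rightarrow> ('a \<Rightarrow> 'b::complex_hilbert) \<Rightarrow> bool" where
  "attains_norm M T \<longleftrightarrow> (\<exists>x\<in>M. norm x = 1 \<and> (\<forall>y\<in>M. norm (T y) \<le> norm (T x) * norm y))"

lemma normalize_in:
  assumes M: "closed_csubspace M" and "x \<in> M" "x \<noteq> 0"
  shows "inverse (norm x) *\<^sub>R x \<in> M" "norm (inverse (norm x) *\<^sub>R x) = 1"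
  using assms by (simp_all add: csubspace_scaleR)

lemma unit_vector_exists:
  assumes M: "closed_csubspace M" "M \<noteq> {0}"
  obtains x where "x \<in> M" "norm x = 1"
proof -
  obtain y where "y \<in> M" "y \<noteq> 0" using M csubspace_0 [OF M(1)] by blast
  then show thesis using normalize_in [OF M(1)] that by blast
qed

context
  fixes M :: "'a::complex_hilbert set" and T :: "'a \<Rightarrow> 'b::complex_hilbert"
  assumes M: "closed_csubspace M" "M \<noteq> {0}" and T: "bounded_op M UNIV T"
begin

lemma op_norm_bdd: "bdd_above ((\<lambda>x. norm (T x)) ` {x \<in> M. norm x = 1})"
proof -
  obtain C where C: "C > 0" "\<And>x. x \<in> M \<Longrightarrow> norm (T x) \<le> C * norm x"
    using bop_bound [OF T] by blast
  show ?thesis using C(2) by (intro bdd_aboveI2 [of _ _ C]) fastforce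
qed

lemma norm_le_op_norm:
  assumes x: "x \<in> M"
  shows "norm (T x) \<le> op_norm M T * norm x"
proof (cases "x = 0")
  case True then show ?thesis using bop_0 [OF T M(1)] by simp
next
  case False
  let ?u = "inverse (norm x) *\<^sub>R x"
  have "norm (T ?u) \<le> op_norm M T"
    unfolding op_norm_def using normalize_in [OF M(1) x False] by (intro cSUP_upper op_norm_bdd) auto
  then show ?thesis using False by (simp add: bop_scaleR [OF T x] field_simps)
qed

lemma op_norm_nonneg: "0 \<le> op_norm M T"
proof -
  obtain x where "x \<in> M" "norm x = 1" using unit_vector_exists [OF M] .
  then show ?thesis using norm_le_op_norm [of x] order_trans [OF norm_ge_zero] by auto
qed

lemma op_norm_least:
  assumes "\<And>x. x \<in> M \<Longrightarrow> norm (T x) \<le> c * norm x"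
  shows "op_norm M T \<le> c"
proof -
  obtain x where "x \<in> M" "norm x = 1" using unit_vector_exists [OF M] .
  then show ?thesis unfolding op_norm_def using assms by (intro cSUP_least) force+
qed

lemma attains_norm_iff: "attains_norm M T \<longleftrightarrow> (\<exists>x\<in>M. norm x = 1 \<and> norm (T x) = op_norm M T)"
proof
  assume "attains_norm M T"
  then obtain x where x: "x \<in> M" "norm x = 1" "\<And>y. y \<in> M \<Longrightarrow> norm (T y) \<le> norm (T x) * norm y"
    unfolding attains_norm_def by blast
  have "op_norm M T \<le> norm (T x)" using x(3) by (rule op_norm_least)
  then show "\<exists>x\<in>M. norm x = 1 \<and> norm (T x) = op_norm M T"
    using x norm_le_op_norm [OF x(1)] by (intro bexI [of _ x]) auto
next
  assume "\<exists>x\<in>M. norm x = 1 \<and> norm (T x) = op_norm M T"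
  then show "attains_norm M T" unfolding attains_norm_def using norm_le_op_norm by metis
qed

lemma op_norm_sequence:
  obtains x where "\<And>n::nat. x n \<in> M" "\<And>n. norm (x n) = 1" "(\<lambda>n. norm (T (x n))) \<longlonglongrightarrow> op_norm M T"
proof -
  let ?s = "op_norm M T"
  obtain x0 where x0: "x0 \<in> M" "norm x0 = 1" using unit_vector_exists [OF M] .
  have "\<exists>x. x \<in> M \<and> norm x = 1 \<and> ?s - 1 / real (Suc n) < norm (T x)" for n
  proof -
    have "?s - 1 / real (Suc n) < Sup ((\<lambda>x. norm (T x)) ` {x \<in> M. norm x = 1})"
      by (simp add: op_norm_def)
    then show ?thesis using x0 by (subst (asm) less_cSup_iff [OF _ op_norm_bdd]) auto
  qed
  then obtain x where x: "\<And>n. x n \<in> M" "\<And>n. norm (x n) = 1" "\<And>n. ?s - 1 / real (Suc n) < norm (T (x n))"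
    by metis
  have "(\<lambda>n. norm (T (x n))) \<longlonglongrightarrow> ?s"
  proof (rule tendsto_sandwich)
    show "\<forall>\<^sub>F n in sequentially. ?s - 1 / real (Suc n) \<le> norm (T (x n))"
      using x(3) by (simp add: less_imp_le)
    show "\<forall>\<^sub>F n in sequentially. norm (T (x n)) \<le> ?s"
      using norm_le_op_norm [OF x(1)] x(2) by simp
    have "(\<lambda>n. ?s - 1 / real (Suc n)) \<longlonglongrightarrow> ?s - 0"
      by (intro tendsto_intros LIMSEQ_Suc lim_1_over_n)
    then show "(\<lambda>n. ?s - 1 / real (Suc n)) \<longlonglongrightarrow> ?s" by simp
  qed simp
  with x(1,2) show thesis by (rule that)
qed

text \<open>\<open>s\<^sup>2 - T\<^sup>*T\<close> is a positive operator bounded by \<open>s\<^sup>2\<close>, so its values are controlled by its quadratic form.\<close>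

lemma norm_defect:
  assumes s: "0 \<le> s" and le: "\<And>x. x \<in> M \<Longrightarrow> norm (T x) \<le> s * norm x" and x: "x \<in> M"
  shows "(norm (s\<^sup>2 *\<^sub>R x - adj M T (T x)))\<^sup>2 \<le> s\<^sup>2 * (s\<^sup>2 * (norm x)\<^sup>2 - (norm (T x))\<^sup>2)"
proof (cases "s = 0")
  case True
  then show ?thesis using le [OF x] bop_0 [OF bounded_op_adj [OF M(1) T] closed_csubspace_UNIV] by simp
next
  case False
  let ?D = "\<lambda>x. s\<^sup>2 *\<^sub>R x - adj M T (T x)"
  have sD: "selfadjoint_op M ?D"
  proof (rule selfadjoint_op_diff [OF M(1) selfadjoint_op_scaleR_id [OF M(1)]])
    show "selfadjoint_op M (\<lambda>x. adj M T (T x))"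
      using bounded_op_compose [OF T bounded_op_adj [OF M(1) T]]
      by (simp add: selfadjoint_op_def cinner_adj [OF M(1) T] cinner_adj_left [OF M(1) T])
  qed
  have form: "Re (cinner (?D x) x) = s\<^sup>2 * (norm x)\<^sup>2 - (norm (T x))\<^sup>2" if "x \<in> M" for x
    by (simp add: cinner_simps cinner_adj_left [OF M(1) T that] norm_sq_cinner)
  have "positive_op M ?D"
  proof (rule positive_opI [OF sD])
    fix x assume x: "x \<in> M"
    have "(norm (T x))\<^sup>2 \<le> (s * norm x)\<^sup>2" using le [OF x] by (intro power_mono) auto
    then show "0 \<le> Re (cinner (?D x) x)" by (simp add: form [OF x] power_mult_distrib)
  qed
  then show ?thesis
    using positive_norm_sq_le [OF M(1) _ _ _ x, of ?D "s\<^sup>2"] False by (simp add: form x)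
qed

text \<open>With \<open>s = norm (T x)\<close> the right-hand side of \<open>norm_defect\<close> is
  zero at the maximiser itself.\<close>

lemma maximizer_eigenvector:
  assumes x: "x \<in> M" "norm x = 1" and max: "\<And>y. y \<in> M \<Longrightarrow> norm (T y) \<le> norm (T x) * norm y"
  shows "adj M T (T x) = (norm (T x))\<^sup>2 *\<^sub>R x"
  using norm_defect [OF norm_ge_zero max x(1)] x(2) by simp

text \<open>The hypothesis \<open>sub\<close> says, in terms of sequences, that the compressed
  square of \<open>T\<close> minus \<beta> is compact. A maximising sequence consists of approximate
  eigenvectors for the squared norm \<open>s^2\<close>, so \<open>(s^2 - \<beta>) x\<close>
  converges along a subsequence, and the nonzero factor can be divided out.\<close>

lemma attains_norm_compact_perturbation:
  assumes sub: "\<And>x. (\<And>n::nat. x n \<in> M) \<Longrightarrow> (\<And>n. norm (x n) = 1) \<Longrightarrow>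
      \<exists>r l. strict_mono (r :: nat \<Rightarrow> nat) \<and> (\<lambda>n. adj M T (T (x (r n))) - \<beta> *\<^sub>R x (r n)) \<longlonglongrightarrow> l"
    and ne: "(op_norm M T)\<^sup>2 \<noteq> \<beta>"
  shows "attains_norm M T"
proof -
  let ?s = "op_norm M T"
  let ?G = "\<lambda>x. adj M T (T x)"
  obtain x where x: "\<And>n::nat. x n \<in> M" "\<And>n. norm (x n) = 1" "(\<lambda>n. norm (T (x n))) \<longlonglongrightarrow> ?s"
    using op_norm_sequence by metis
  obtain r l where r: "strict_mono (r :: nat \<Rightarrow> nat)" "(\<lambda>n. ?G (x (r n)) - \<beta> *\<^sub>R x (r n)) \<longlonglongrightarrow> l"
    using sub [of x, OF x(1,2)] by blast
  have "(\<lambda>n. (norm (?s\<^sup>2 *\<^sub>R x n - ?G (x n)))\<^sup>2) \<longlonglongrightarrow> 0"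
  proof (rule tendsto_sandwich [where f = "\<lambda>_. 0"])
    show "\<forall>\<^sub>F n in sequentially. (norm (?s\<^sup>2 *\<^sub>R x n - ?G (x n)))\<^sup>2 \<le> ?s\<^sup>2 * (?s\<^sup>2 - (norm (T (x n)))\<^sup>2)"
      using norm_defect [OF op_norm_nonneg norm_le_op_norm x(1)] x(2) by simp
    have "(\<lambda>n. ?s\<^sup>2 * (?s\<^sup>2 - (norm (T (x n)))\<^sup>2)) \<longlonglongrightarrow> ?s\<^sup>2 * (?s\<^sup>2 - ?s\<^sup>2)"
      by (intro tendsto_intros x(3))
    then show "(\<lambda>n. ?s\<^sup>2 * (?s\<^sup>2 - (norm (T (x n)))\<^sup>2)) \<longlonglongrightarrow> 0" by simp
  qed simp_all
  then have "(\<lambda>n. ?s\<^sup>2 *\<^sub>R x n - ?G (x n)) \<longlonglongrightarrow> 0"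
    by (simp add: tendsto_norm_zero_iff)
  from tendsto_add [OF LIMSEQ_subseq_LIMSEQ [OF this r(1), unfolded o_def] r(2)]
  have "(\<lambda>n. (?s\<^sup>2 - \<beta>) *\<^sub>R x (r n)) \<longlonglongrightarrow> l" by (simp add: scaleR_diff_left)
  then have "(\<lambda>n. inverse (?s\<^sup>2 - \<beta>) *\<^sub>R (?s\<^sup>2 - \<beta>) *\<^sub>R x (r n)) \<longlonglongrightarrow> inverse (?s\<^sup>2 - \<beta>) *\<^sub>R l"
    by (intro tendsto_scaleR tendsto_const)
  then have lim: "(\<lambda>n. x (r n)) \<longlonglongrightarrow> inverse (?s\<^sup>2 - \<beta>) *\<^sub>R l" (is "_ \<longlonglongrightarrow> ?z") using ne by simp
  have z: "?z \<in> M" using closed_sequentially [OF csubspace_closed [OF M(1)] _ lim] x(1) by blast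
  have "(\<lambda>n. norm (x (r n))) \<longlonglongrightarrow> norm ?z" using lim by (rule tendsto_norm)
  then have "norm ?z = 1" using x(2) LIMSEQ_unique [OF _ tendsto_const] by simp
  moreover have "(\<lambda>n. norm (T (x (r n)))) \<longlonglongrightarrow> norm (T ?z)"
    by (intro tendsto_norm bop_tendsto [OF T M(1) x(1) z lim])
  then have "norm (T ?z) = ?s"
    using LIMSEQ_subseq_LIMSEQ [OF x(3) r(1)] LIMSEQ_unique unfolding o_def by blast
  ultimately show ?thesis using z unfolding attains_norm_iff by blast
qed

lemma attains_norm_finite_dim:
  assumes B: "finite B" "M \<subseteq> complex_vector.span B"
  shows "attains_norm M T"
proof -
  obtain x where x: "\<And>n::nat. x n \<in> M" "\<And>n. norm (x n) = 1" "(\<lambda>n. norm (T (x n))) \<longlonglongrightarrow> op_norm M T"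
    using op_norm_sequence by metis
  have bnd: "norm (x n) \<le> 1" for n using x(2) by simp
  obtain z r where r: "strict_mono (r :: nat \<Rightarrow> nat)" "(x \<circ> r) \<longlonglongrightarrow> z"
    using finite_dim_subsequence [OF csubspace_subspace [OF M(1)] B, of x 1, OF x(1) bnd] by blast
  then have lim: "(\<lambda>n. x (r n)) \<longlonglongrightarrow> z" by (simp add: o_def)
  have z: "z \<in> M" using closed_sequentially [OF csubspace_closed [OF M(1)] _ lim] x(1) by blast
  have "(\<lambda>n. norm (x (r n))) \<longlonglongrightarrow> norm z" using lim by (rule tendsto_norm)
  then have "norm z = 1" using x(2) LIMSEQ_unique [OF _ tendsto_const] by simp
  moreover have "(\<lambda>n. norm (T (x (r n)))) \<longlonglongrightarrow> norm (T z)"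
    by (intro tendsto_norm bop_tendsto [OF T M(1) x(1) z lim])
  then have "norm (T z) = op_norm M T"
    using LIMSEQ_subseq_LIMSEQ [OF x(3) r(1)] LIMSEQ_unique unfolding o_def by blast
  ultimately show ?thesis using z unfolding attains_norm_iff by blast
qed

end

text \<open>The case of \<beta> equal to 0, where the square of \<open>S\<close> is itself compact.
  It serves to show that an operator not attaining its norm has infinite rank, so that the rank test
  in \<open>eig_num\<close> never succeeds for it.\<close>

lemma attains_norm_finite_rank:
  assumes M: "closed_csubspace M" "M \<noteq> {0}" and S: "selfadjoint_op M S"
    and B: "finite B" "S ` M \<subseteq> complex_vector.span B"
  shows "attains_norm M S"
proof -
  note b = sa_bounded [OF S]
  have T: "bounded_op M UNIV S" using bounded_op_mono [OF b] by blast
  obtain C where C: "C > 0" "\<And>x. x \<in> M \<Longrightarrow> norm (S x) \<le> C * norm x" using bop_bound [OF b] by blast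
  show ?thesis
  proof (cases "op_norm M S = 0")
    case True
    obtain x where x: "x \<in> M" "norm x = 1" using unit_vector_exists [OF M] .
    then show ?thesis
      using True norm_le_op_norm [OF M T] unfolding attains_norm_iff [OF M T] by force
  next
    case False
    show ?thesis
    proof (rule attains_norm_compact_perturbation [OF M T, where \<beta> = 0])
      show "(op_norm M S)\<^sup>2 \<noteq> 0" using False by simp
      fix x :: "nat \<Rightarrow> 'a" assume x: "\<And>n. x n \<in> M" "\<And>n. norm (x n) = 1"
      have "S (x n) \<in> S ` M" "norm (S (x n)) \<le> C" for n
        using x(1) C(2) [OF x(1), of n] x(2) by auto
      then obtain l r where r: "strict_mono (r :: nat \<Rightarrow> nat)" "((\<lambda>n. S (x n)) \<circ> r) \<longlonglongrightarrow> l"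
        using finite_dim_subsequence [OF subspace_image [OF b M(1)] B, of "\<lambda>n. S (x n)" C] by blast
      then have lim: "(\<lambda>n. S (x (r n))) \<longlonglongrightarrow> l" by (simp add: o_def)
      have Sx: "S (x n) \<in> M" for n using bop_in [OF b x(1)] .
      have l: "l \<in> M" using closed_sequentially [OF csubspace_closed [OF M(1)] _ lim] Sx by blast
      have "adj M S (S (x n)) = S (S (x n))" for n
        using bop_in [OF b Sx] sa_sym [OF S _ Sx] by (intro adj_eqI [OF M(1) T]) auto
      moreover have "(\<lambda>n. S (S (x (r n)))) \<longlonglongrightarrow> S l" by (rule bop_tendsto [OF b M(1) Sx l lim])
      ultimately show "\<exists>r l. strict_mono (r :: nat \<Rightarrow> nat) \<and> (\<lambda>n. adj M S (S (x (r n))) - 0 *\<^sub>R x (r n)) \<longlonglongrightarrow> l"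
        using r(1) by auto
    qed
  qed
qed

lemma attains_norm_scalar_plus_finite_plus_compact:
  fixes A :: "'a::complex_hilbert \<Rightarrow> 'a"
  assumes A: "selfadjoint_op UNIV A" and \<alpha>: "\<alpha> \<ge> 0"
    and K: "positive_op UNIV K" "compact_op UNIV K"
    and F: "selfadjoint_op UNIV F" "op_rank UNIV F < \<infinity>"
    and eq: "\<And>x. A x = \<alpha> *\<^sub>R x + F x + K x"
    and M: "closed_csubspace M" "M \<noteq> {0}"
  shows "attains_norm M A"
proof -
  have T: "bounded_op M UNIV A" using bounded_op_mono [OF sa_bounded [OF A]] by blast
  note bF = sa_bounded [OF F(1)]
  obtain B where B: "finite B" "range F \<subseteq> complex_vector.span B"
    using edim_finiteD F(2) unfolding op_rank_def by blast
  \<comment> \<open>If \<open>F\<close> is injective on \<open>M\<close>, finite rank makes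
    \<open>M\<close> finite-dimensional. Otherwise a unit vector of \<open>M\<close> in the kernel
    of \<open>F\<close> shows, by positivity of \<open>K\<close>, that the norm on \<open>M\<close>
    is at least \<alpha>.\<close>
  show ?thesis
  proof (cases "\<exists>x\<in>M. x \<noteq> 0 \<and> F x = 0")
    case False
    have "bounded_op M UNIV F" by (rule bounded_op_mono [OF bF]) auto
    moreover have "F ` M \<subseteq> complex_vector.span B" using B(2) by blast
    ultimately have "\<exists>B. finite B \<and> M \<subseteq> complex_vector.span B"
      by (rule finite_dim_of_injective [OF _ M(1) B(1)]) (use False in blast)
    then show ?thesis using attains_norm_finite_dim [OF M T] by blast
  next
    case True
    then obtain y where y: "y \<in> M" "y \<noteq> 0" "F y = 0" by blast
    define x where "x = inverse (norm y) *\<^sub>R y"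
    have x: "x \<in> M" "norm x = 1" "F x = 0"
      using normalize_in [OF M(1) y(1,2)] y(3) bop_scaleR [OF bF, of y "inverse (norm y)"] by (auto simp: x_def)
    have "\<alpha> \<le> Re (cinner (A x) x)"
      using pos_Re [OF K(1), of x] x(2,3) cinner_eq_1_norm [of x] by (simp add: eq cinner_simps)
    also have "\<dots> \<le> norm (A x)"
      using complex_Re_le_cmod [of "cinner (A x) x"] cinner_cauchy_schwarz [of "A x" x] x(2) by simp
    finally have ge: "\<alpha> \<le> norm (A x)" .
    show ?thesis
    proof (cases "op_norm M A = \<alpha>")
      case True
      then show ?thesis
        using ge x norm_le_op_norm [OF M T x(1)] unfolding attains_norm_iff [OF M T] by force
    next
      case False
      show ?thesis
      proof (rule attains_norm_compact_perturbation [OF M T, where \<beta> = "\<alpha>\<^sup>2"])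
        show "(op_norm M A)\<^sup>2 \<noteq> \<alpha>\<^sup>2"
          using False \<alpha> op_norm_nonneg [OF M T] by (simp add: power2_eq_iff_nonneg)
        fix x :: "nat \<Rightarrow> 'a" assume x: "\<And>n. x n \<in> M" "\<And>n. norm (x n) = 1"
        obtain C where C: "C > 0" "\<And>x. norm (F x) \<le> C * norm x" using bop_bound [OF bF] by auto
        have "F (x n) \<in> range F" "norm (F (x n)) \<le> C" for n
          using C(2) [of "x n"] x(2) by auto
        then obtain f r1 where r1: "strict_mono (r1 :: nat \<Rightarrow> nat)" "((\<lambda>n. F (x n)) \<circ> r1) \<longlonglongrightarrow> f"
          using finite_dim_subsequence [OF subspace_image [OF bF closed_csubspace_UNIV] B, of "\<lambda>n. F (x n)" C] by blast
        have "K (x (r1 n)) \<in> closure (K ` (UNIV \<inter> cball 0 1))" for n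
          using closure_subset x(2) by (force intro: subsetD)
        then obtain k r2 where r2: "strict_mono (r2 :: nat \<Rightarrow> nat)" "((\<lambda>n. K (x (r1 n))) \<circ> r2) \<longlonglongrightarrow> k"
          using K(2) unfolding compact_op_def compact_def by meson
        define r where "r = r1 \<circ> r2"
        define w where "w n = F (x n) + K (x n)" for n
        have r: "strict_mono r" unfolding r_def using r1(1) r2(1) by (rule strict_mono_o)
        have "(\<lambda>n. F (x (r n))) \<longlonglongrightarrow> f"
          using LIMSEQ_subseq_LIMSEQ [OF r1(2) r2(1)] by (simp add: o_def r_def)
        moreover have "(\<lambda>n. K (x (r n))) \<longlonglongrightarrow> k" using r2(2) by (simp add: o_def r_def)
        ultimately have lim: "(\<lambda>n. w (r n)) \<longlonglongrightarrow> f + k" unfolding w_def by (rule tendsto_add)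
        note ba = bounded_op_adj [OF M(1) T] and bP = bounded_op_orth_proj [OF M(1)]
        have Ax: "A (x n) = \<alpha> *\<^sub>R x n + w n" for n by (simp add: eq w_def)
        have adjx: "adj M A (x n) = orth_proj M (A (x n))" for n
        proof (rule adj_eqI [OF M(1) T orth_proj_in [OF M(1)]])
          fix y assume y: "y \<in> M"
          have "cinner y (A (x n) - orth_proj M (A (x n))) = 0"
            using cinner_orth_proj [OF M(1) y] by (simp add: cinner_eq_0_commute)
          then show "cinner (A y) (x n) = cinner y (orth_proj M (A (x n)))"
            using sa_sym [OF A, of y "x n"] by (simp add: cinner.diff_right)
        qed
        have Px: "orth_proj M (x n) = x n" for n
          by (rule orth_proj_eqI [OF M(1) x(1)]) simp
        \<comment> \<open>Writing \<open>A x = \<alpha> x + w\<close> with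
          \<open>w = (F + K) x\<close>, and using that the adjoint of \<open>A\<close> on
          \<open>M\<close> sends \<open>x\<close> to the projection of \<open>A x\<close>, leaves
          only terms in \<open>w\<close>. Bounded operators then carry over the convergence of
          \<open>w (r n)\<close>.\<close>
        have G: "adj M A (A (x n)) - \<alpha>\<^sup>2 *\<^sub>R x n = \<alpha> *\<^sub>R orth_proj M (w n) + adj M A (w n)" for n
        proof -
          have "adj M A (A (x n)) = \<alpha> *\<^sub>R adj M A (x n) + adj M A (w n)"
            unfolding Ax by (simp add: bop_add [OF ba] bop_scaleR [OF ba])
          moreover have "adj M A (x n) = \<alpha> *\<^sub>R x n + orth_proj M (w n)"
            unfolding adjx Ax by (simp add: bop_add [OF bP] bop_scaleR [OF bP] Px)
          ultimately show ?thesis by (simp add: scaleR_add_right power2_eq_square)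
        qed
        have "(\<lambda>n. adj M A (A (x (r n))) - \<alpha>\<^sup>2 *\<^sub>R x (r n)) \<longlonglongrightarrow> \<alpha> *\<^sub>R orth_proj M (f + k) + adj M A (f + k)"
          unfolding G
          by (intro tendsto_add tendsto_scaleR tendsto_const bop_tendsto [OF bP closed_csubspace_UNIV _ _ lim]
              bop_tendsto [OF ba closed_csubspace_UNIV _ _ lim]) auto
        then show "\<exists>r l. strict_mono (r :: nat \<Rightarrow> nat) \<and> (\<lambda>n. adj M A (A (x (r n))) - \<alpha>\<^sup>2 *\<^sub>R x (r n)) \<longlonglongrightarrow> l"
          using r by blast
      qed
    qed
  qed
qed

section \<open>Spectrum of positive operators\<close>

lemma bop_UNIV: "bounded_op M N T \<Longrightarrow> bounded_op M UNIV T"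
  by (auto simp: bounded_op_def)

text \<open>A solution is a fixed point of \<open>g x = (S x - y) / z\<close>, which is a
  contraction of \<open>M\<close> with constant \<open>c / cmod z\<close>.\<close>

lemma resolvent_surjective:
  assumes M: "closed_csubspace M" and S: "bounded_op M M S"
    and c: "0 \<le> c" "\<And>x. x \<in> M \<Longrightarrow> norm (S x) \<le> c * norm x" "c < cmod z" and y: "y \<in> M"
  shows "\<exists>x\<in>M. S x - z *\<^sub>C x = y"
proof -
  define g where "g x = inverse z *\<^sub>C (S x - y)" for x
  have z: "z \<noteq> 0" using c by auto
  have "\<exists>!x\<in>M. g x = x"
  proof (rule Banach_fix)
    show "complete M" by (rule closed_csubspace_complete [OF M])
    show "M \<noteq> {}" using y by auto
    show "0 \<le> c / cmod z" "c / cmod z < 1" using c z by auto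
    show "g ` M \<subseteq> M"
      using bop_in [OF S] y csubspace_diff [OF M] csubspace_scaleC [OF M] by (auto simp: g_def)
    show "dist (g u) (g v) \<le> c / cmod z * dist u v" if uv: "u \<in> M" "v \<in> M" for u v
    proof -
      have "g u - g v = inverse z *\<^sub>C S (u - v)"
        by (simp add: g_def bop_diff [OF S M uv] scaleC.diff_right)
      then have "dist (g u) (g v) = norm (S (u - v)) / cmod z"
        by (simp add: dist_norm norm_scaleC norm_inverse divide_inverse_commute)
      also have "\<dots> \<le> (c * norm (u - v)) / cmod z"
        using c(2) [OF csubspace_diff [OF M uv]] by (intro divide_right_mono) auto
      finally show ?thesis by (simp add: dist_norm)
    qed
  qed
  then obtain x where x: "x \<in> M" "g x = x" by blast
  then have "z *\<^sub>C x = z *\<^sub>C g x" by simp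
  also have "\<dots> = S x - y" using z by (simp add: g_def scaleC_scaleC scaleC_one)
  finally show ?thesis using x(1) by (intro bexI [of _ x]) auto
qed

text \<open>The lower bound gives injectivity and bounds the inverse by \<open>1 / \<delta>\<close>;
  surjectivity makes the inverse defined on all of \<open>M\<close>.\<close>

lemma not_in_spectrumI:
  assumes M: "closed_csubspace M" and S: "bounded_op M M S" and \<delta>: "\<delta> > 0"
    and below: "\<And>x. x \<in> M \<Longrightarrow> \<delta> * norm x \<le> norm (S x - z *\<^sub>C x)"
    and surj: "\<And>y. y \<in> M \<Longrightarrow> \<exists>x\<in>M. S x - z *\<^sub>C x = y"
  shows "z \<notin> spectrum M S"
proof -
  define R where "R x = S x - z *\<^sub>C x" for x
  have R_add: "R (x + y) = R x + R y" if "x \<in> M" "y \<in> M" for x y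
    using that by (simp add: R_def bop_add [OF S] scaleC_add_right)
  have R_scale: "R (c *\<^sub>C x) = c *\<^sub>C R x" if "x \<in> M" for c x
    using that by (simp add: R_def bop_scaleC [OF S] scaleC_scaleC scaleC.diff_right mult.commute)
  have R_in: "R x \<in> M" if "x \<in> M" for x
    using that M bop_in [OF S that] by (simp add: R_def csubspace_diff csubspace_scaleC)
  have inj: "x = y" if xy: "x \<in> M" "y \<in> M" "R x = R y" for x y
  proof -
    have "R (x - y) = R x - R y"
      using xy(1,2) by (simp add: R_def bop_diff [OF S M] scaleC.diff_right)
    then have "\<delta> * norm (x - y) \<le> 0"
      using below [OF csubspace_diff [OF M xy(1,2)]] xy(3) by (simp add: R_def)
    then show ?thesis using \<delta> by (simp add: mult_le_0_iff)
  qed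
  have "\<forall>y\<in>M. \<exists>x. x \<in> M \<and> R x = y" using surj by (auto simp: R_def)
  then obtain B where B: "\<And>y. y \<in> M \<Longrightarrow> B y \<in> M" "\<And>y. y \<in> M \<Longrightarrow> R (B y) = y" by metis
  have "bounded_op M M B"
  proof (rule bounded_opI [where C = "inverse \<delta>"])
    fix y assume y: "y \<in> M"
    show "norm (B y) \<le> inverse \<delta> * norm y"
      using below [OF B(1) [OF y]] B(2) [OF y] \<delta> by (simp add: R_def field_simps)
    show "B (c *\<^sub>C y) = c *\<^sub>C B y" for c
      by (rule inj) (use y B R_scale csubspace_scaleC [OF M] in simp_all)
    show "B (x + y) = B x + B y" if "x \<in> M" for x
      by (rule inj) (use that y B R_add csubspace_add [OF M] in simp_all)
  qed (use B in blast)
  moreover have "B (R x) = x" if "x \<in> M" for x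
    by (rule inj) (use that B R_in in simp_all)
  ultimately show ?thesis using B by (auto simp: spectrum_def R_def)
qed

lemma not_in_spectrumD:
  assumes M: "closed_csubspace M" and S: "bounded_op M M S" and "z \<notin> spectrum M S"
  shows "\<exists>C. \<forall>x\<in>M. norm x \<le> C * norm (S x - z *\<^sub>C x)"
proof -
  obtain B where B: "bounded_op M M B" "\<forall>x\<in>M. B (S x - z *\<^sub>C x) = x"
    using assms(3) by (auto simp: spectrum_def)
  obtain C where C: "C > 0" "\<And>x. x \<in> M \<Longrightarrow> norm (B x) \<le> C * norm x" using bop_bound [OF B(1)] by blast
  have "norm x \<le> C * norm (S x - z *\<^sub>C x)" if "x \<in> M" for x
    using C(2) [OF csubspace_diff [OF M bop_in [OF S that] csubspace_scaleC [OF M that, of z]]] B(2) that by simp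
  then show ?thesis by blast
qed

text \<open>Expand the square and use \<open>(norm (S x))^2 \<le> s * Re (cinner (S x) x)\<close>.
  Vectors that nearly maximise the norm are thus approximate eigenvectors of \<open>S\<close>
  itself, not merely of its square.\<close>

lemma norm_sub_op_norm:
  assumes M: "closed_csubspace M" and S: "positive_op M S" and s: "0 \<le> s"
    and le: "\<And>x. x \<in> M \<Longrightarrow> norm (S x) \<le> s * norm x" and x: "x \<in> M"
  shows "(norm (S x - s *\<^sub>R x))\<^sup>2 \<le> s\<^sup>2 * (norm x)\<^sup>2 - (norm (S x))\<^sup>2"
proof -
  have "(norm (S x))\<^sup>2 \<le> s * Re (cinner (S x) x)"
  proof (cases "s = 0")
    case True then show ?thesis using le [OF x] by simp
  next
    case False
    then show ?thesis
      using s le by (intro positive_norm_sq_le [OF M S _ _ x] Re_cinner_le_bound) auto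
  qed
  then show ?thesis by (simp add: norm_diff_sq cinner_scaleR_right power_mult_distrib)
qed

context
  fixes M :: "'a::complex_hilbert set" and S :: "'a \<Rightarrow> 'a"
  assumes M: "closed_csubspace M" "M \<noteq> {0}" and S: "positive_op M S"
begin

private lemma S_bounded: "bounded_op M M S" by (rule pos_bounded [OF S])

lemma maximal_norm_eigenvector:
  assumes "x \<in> M" "norm (S x) = op_norm M S * norm x"
  shows "S x = op_norm M S *\<^sub>R x"
  using norm_sub_op_norm [OF M(1) S op_norm_nonneg [OF M bop_UNIV [OF S_bounded]]
      norm_le_op_norm [OF M bop_UNIV [OF S_bounded]] assms(1)] assms(2)
  by (simp add: power_mult_distrib)

text \<open>A bounded inverse of \<open>S - s\<close> would bound \<open>S - s\<close> from below on
  unit vectors, but along a maximising sequence its values tend to 0.\<close>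

lemma op_norm_in_spectrum: "complex_of_real (op_norm M S) \<in> spectrum M S"
proof (rule ccontr)
  let ?s = "op_norm M S"
  note T = bop_UNIV [OF S_bounded]
  assume "complex_of_real ?s \<notin> spectrum M S"
  then obtain C where C: "\<And>x. x \<in> M \<Longrightarrow> norm x \<le> C * norm (S x - ?s *\<^sub>R x)"
    using not_in_spectrumD [OF M(1) S_bounded] by (metis scaleR_scaleC)
  obtain x where x: "\<And>n::nat. x n \<in> M" "\<And>n. norm (x n) = 1" "(\<lambda>n. norm (S (x n))) \<longlonglongrightarrow> ?s"
    using op_norm_sequence [OF M T] by metis
  have "1 \<le> C\<^sup>2 * (?s\<^sup>2 - (norm (S (x n)))\<^sup>2)" for n
  proof -
    have "1\<^sup>2 \<le> (C * norm (S (x n) - ?s *\<^sub>R x n))\<^sup>2"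
      using C [OF x(1), of n] x(2) [of n] by (intro power_mono) auto
    also have "\<dots> = C\<^sup>2 * (norm (S (x n) - ?s *\<^sub>R x n))\<^sup>2" by (simp add: power_mult_distrib)
    also have "\<dots> \<le> C\<^sup>2 * (?s\<^sup>2 * (norm (x n))\<^sup>2 - (norm (S (x n)))\<^sup>2)"
      by (intro mult_left_mono norm_sub_op_norm [OF M(1) S op_norm_nonneg [OF M T]
            norm_le_op_norm [OF M T] x(1)]) auto
    finally show ?thesis using x(2) by simp
  qed
  moreover have "(\<lambda>n. C\<^sup>2 * (?s\<^sup>2 - (norm (S (x n)))\<^sup>2)) \<longlonglongrightarrow> C\<^sup>2 * (?s\<^sup>2 - ?s\<^sup>2)"
    by (intro tendsto_intros x(3))
  ultimately have "1 \<le> C\<^sup>2 * (?s\<^sup>2 - ?s\<^sup>2)" by (intro LIMSEQ_le_const) auto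
  then show False by simp
qed

text \<open>Every real number above the norm is excluded from the spectrum by the contraction
  argument. From here on the spectral recursion in \<open>eig_num\<close> can be followed through
  norms.\<close>

lemma spec_sup_eq_op_norm: "spec_sup M S = op_norm M S"
  unfolding spec_sup_def
proof (rule cSup_eq_maximum)
  let ?s = "op_norm M S"
  note T = bop_UNIV [OF S_bounded]
  show "?s \<in> {r. complex_of_real r \<in> spectrum M S}" using op_norm_in_spectrum by simp
  fix r assume r: "r \<in> {r. complex_of_real r \<in> spectrum M S}"
  show "r \<le> ?s"
  proof (rule ccontr)
    assume "\<not> r \<le> ?s"
    then have lt: "?s < r" by simp
    have "complex_of_real r \<notin> spectrum M S"
    proof (rule not_in_spectrumI [OF M(1) S_bounded, of "r - ?s"])
      show "r - ?s > 0" using lt by simp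
      fix x assume x: "x \<in> M"
      show "(r - ?s) * norm x \<le> norm (S x - complex_of_real r *\<^sub>C x)"
        using norm_le_op_norm [OF M T x] norm_triangle_ineq2 [of "complex_of_real r *\<^sub>C x" "S x"] lt
          op_norm_nonneg [OF M T]
        by (simp add: norm_scaleC norm_minus_commute algebra_simps)
    next
      show "\<exists>x\<in>M. S x - complex_of_real r *\<^sub>C x = y" if "y \<in> M" for y
        using lt op_norm_nonneg [OF M T] norm_le_op_norm [OF M T]
        by (intro resolvent_surjective [OF M(1) S_bounded _ _ _ that]) auto
    qed
    then show False using r by simp
  qed
qed

end

section \<open>Eigenspaces, orthogonal splittings and counting\<close>

lemma closed_csubspace_eigenspace:
  assumes M: "closed_csubspace M" and S: "bounded_op M M S"
  shows "closed_csubspace (eigenspace M S z)"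
  unfolding closed_csubspace_def closed_sequential_limits complex_vector.subspace_def
proof (intro conjI ballI allI impI)
  let ?E = "eigenspace M S z"
  show "0 \<in> ?E" using csubspace_0 [OF M] bop_0 [OF S M] by (simp add: eigenspace_def)
  show "x + y \<in> ?E" if "x \<in> ?E" "y \<in> ?E" for x y
    using that csubspace_add [OF M] by (simp add: eigenspace_def bop_add [OF S] scaleC_add_right)
  show "c *\<^sub>C x \<in> ?E" if "x \<in> ?E" for c x
    using that csubspace_scaleC [OF M] by (simp add: eigenspace_def bop_scaleC [OF S] scaleC_scaleC mult.commute)
  fix x l assume x: "(\<forall>n. x n \<in> ?E) \<and> x \<longlonglongrightarrow> l"
  then have xM: "\<And>n. x n \<in> M" and lim: "x \<longlonglongrightarrow> l" and eq: "\<And>n. S (x n) = z *\<^sub>C x n"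
    by (auto simp: eigenspace_def)
  have l: "l \<in> M" using closed_sequentially [OF csubspace_closed [OF M] _ lim] xM by blast
  have "(\<lambda>n. S (x n)) \<longlonglongrightarrow> S l" by (rule bop_tendsto [OF S M xM l lim])
  moreover have "(\<lambda>n. S (x n)) \<longlonglongrightarrow> z *\<^sub>C l" unfolding eq by (intro scaleC.tendsto tendsto_const lim)
  ultimately show "l \<in> ?E" using l LIMSEQ_unique by (auto simp: eigenspace_def)
qed

lemma orth_decomposition:
  assumes L: "closed_csubspace L" and M: "closed_csubspace M" and "L \<subseteq> M" and x: "x \<in> M"
  obtains p q where "x = p + q" "p \<in> L" "q \<in> M" "\<And>y. y \<in> L \<Longrightarrow> cinner q y = 0"
    "p = orth_proj L x" "norm p \<le> norm x"
proof -
  define p q where "p = orth_proj L x" and "q = x - p"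
  have p: "p \<in> L" unfolding p_def by (rule orth_proj_in [OF L])
  have q: "cinner q y = 0" if "y \<in> L" for y unfolding q_def p_def by (rule cinner_orth_proj [OF L that])
  have "(norm (q + p))\<^sup>2 = (norm q)\<^sup>2 + (norm p)\<^sup>2" by (rule pythagoras [OF q [OF p]])
  then have "(norm p)\<^sup>2 \<le> (norm x)\<^sup>2" by (simp add: q_def)
  then have "norm p \<le> norm x" by (rule power2_le_imp_le) simp
  moreover have "q \<in> M" unfolding q_def using csubspace_diff [OF M x] p assms(3) by blast
  ultimately show thesis using p q that [of p q] by (simp add: p_def q_def)
qed

text \<open>The strict bound \<open>e\<close> excludes infinite dimension, where \<open>dim\<close>
  is not the value of \<open>edim\<close>.\<close>

lemma edim_eq_dim: "edim V < e \<Longrightarrow> edim V = enat (complex_vector.dim V)"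
  by (auto simp: edim_def split: if_splits)

lemma edim_span_le_card:
  assumes V: "complex_vector.subspace V" and S: "finite S" "V \<subseteq> complex_vector.span S"
  shows "edim V \<le> enat (card S)"
proof -
  have "enat n \<le> edim V \<Longrightarrow> n \<le> card S" for n
  proof -
    assume "enat n \<le> edim V"
    then obtain Z where Z: "finite Z" "orthonormal_set Z" "Z \<subseteq> V" "card Z = n"
      using enat_le_edim_iff [OF V] by blast
    have "Z \<subseteq> complex_vector.span S" using Z(3) S(2) by blast
    then show "n \<le> card S"
      using complex_vector.independent_span_bound [OF S(1) orthonormal_set_independent [OF Z(2,1)]] Z(4) by simp
  qed
  moreover have "edim V = enat (complex_vector.dim V)"
    unfolding edim_def using S by (intro if_P) blast
  ultimately show ?thesis by simp
qed

lemma orthonormal_set_extend_card: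
  assumes V: "complex_vector.subspace V" and S: "finite S" "orthonormal_set S" "S \<subseteq> V"
    and "enat (card S + n) \<le> edim V"
  shows "\<exists>Z. finite Z \<and> orthonormal_set Z \<and> S \<subseteq> Z \<and> Z \<subseteq> V \<and> card Z = card S + n"
  using assms(5)
proof (induction n)
  case 0 show ?case using S by auto
next
  case (Suc n)
  have "enat (card S + n) \<le> edim V" by (rule order_trans [OF _ Suc.prems]) simp
  from Suc.IH [OF this] obtain Z where Z: "finite Z" "orthonormal_set Z" "S \<subseteq> Z" "Z \<subseteq> V" "card Z = card S + n"
    by blast
  have "\<not> V \<subseteq> complex_vector.span Z"
  proof
    assume "V \<subseteq> complex_vector.span Z"
    from edim_span_le_card [OF V Z(1) this] Suc.prems have "enat (card S + Suc n) \<le> enat (card Z)"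
      by (rule order_trans [rotated])
    then show False using Z(5) by simp
  qed
  then obtain u where u: "u \<in> V" "norm u = 1" "\<And>z. z \<in> Z \<Longrightarrow> cinner u z = 0"
    using orthonormal_extend [OF Z(2,1,4) V] by metis
  show ?case
    using Z u orthonormal_set_insert [OF Z(2) u(2,3)] by (intro exI [of _ "insert u Z"]) auto
qed

section \<open>Eigenvalues and norming operators\<close>

lemma edim_trivial: "edim {0 :: 'a::complex_hilbert} = 0"
  using edim_span_le_card [of "{0::'a}" "{}"]
  by (simp add: complex_vector.subspace_single_0 flip: zero_enat_def)

lemma op_rank_le_edim:
  assumes "closed_csubspace M" "bounded_op M M S"
  shows "op_rank M S \<le> edim M"
  unfolding op_rank_def
  using assms bop_in [OF assms(2)]
  by (intro edim_mono subspace_image [of M M S]) (auto simp: csubspace_subspace)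

lemma eig_num_above_rank: "op_rank M S < enat j \<Longrightarrow> eig_num M S j = 0"
  by (subst eig_num.simps) (simp add: Let_def)

text \<open>A positive operator \<open>S\<close> that does not attain its norm \<open>\<mu>\<close> has no eigenvector for \<open>\<mu>\<close>, so the alternative
  \<open>m = 0\<close> in \<^const>\<open>eig_num\<close> makes all its \<open>\<lambda>\<^sub>j\<close> equal to \<open>\<mu>\<close>.\<close>

lemma norming_imp_attains_norm:
  fixes T :: "'a::complex_hilbert \<Rightarrow> 'b::complex_hilbert"
  assumes M: "closed_csubspace M" "M \<noteq> {0}" and T: "bounded_op M UNIV T"
    and k: "k \<ge> 1" and "norming k M T"
  shows "attains_norm M T"
proof (rule ccontr)
  assume na: "\<not> attains_norm M T"
  define S where "S = abs_op M T"
  have S: "positive_op M S" and nS: "\<And>x. x \<in> M \<Longrightarrow> norm (S x) = norm (T x)"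
    unfolding S_def using positive_abs_op [OF M(1) T] norm_abs_op [OF M(1) T] by auto
  note bS = pos_bounded [OF S]
  define s where "s = op_norm M S"
  have naS: "\<not> attains_norm M S" using na nS by (simp add: attains_norm_def)
  have le: "norm (S x) \<le> s * norm x" if "x \<in> M" for x
    unfolding s_def using norm_le_op_norm [OF M bop_UNIV [OF bS] that] .
  have ne: "norm (S x) \<noteq> s" if "x \<in> M" "norm x = 1" for x
    using naS that by (auto simp: attains_norm_iff [OF M bop_UNIV [OF bS]] s_def)
  have E: "eigenspace M S (complex_of_real s) = {0}"
  proof (intro equalityI subsetI)
    fix x assume "x \<in> eigenspace M S (complex_of_real s)"
    then have x: "x \<in> M" "S x = s *\<^sub>R x" by (auto simp: eigenspace_def scaleR_scaleC)
    have "norm (S (inverse (norm x) *\<^sub>R x)) = s" if "x \<noteq> 0"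
      using that op_norm_nonneg [OF M bop_UNIV [OF bS]] by (simp add: bop_scaleR [OF bS x(1)] x(2) s_def)
    then show "x \<in> {0}" using ne normalize_in [OF M(1) x(1)] by blast
  qed (use csubspace_0 [OF M(1)] bop_0 [OF bS M(1)] in \<open>auto simp: eigenspace_def\<close>)
  have dimE: "complex_vector.dim (eigenspace M S (complex_of_real s)) = 0"
    unfolding E using complex_vector.dim_eq_card_independent [OF complex_vector.independent_empty]
    by (metis card.empty complex_vector.dim_span complex_vector.span_empty)
  \<comment> \<open>This keeps the recursion out of the branch that returns 0, at every index
    \<open>j\<close>.\<close>
  have rank: "op_rank M S = \<infinity>"
  proof (rule ccontr)
    assume "op_rank M S \<noteq> \<infinity>"
    then obtain B where "finite B" "S ` M \<subseteq> complex_vector.span B"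
      unfolding op_rank_def using edim_finiteD [of "S ` M"] by auto
    then show False
      using attains_norm_finite_rank [OF M positive_selfadjoint [OF M(1) S]] naS by blast
  qed
  have "eig_num M S j = s" for j
    by (subst eig_num.simps) (simp add: Let_def rank spec_sup_eq_op_norm [OF M S] s_def [symmetric] dimE)
  then have ky: "ky_fan_norm k M T = (\<Sum>j=1..k. s)" by (simp add: ky_fan_norm_def s_num_def S_def)
  \<comment> \<open>Hence the clause for small dimension does not apply and \<open>norming\<close>
    provides exactly \<open>k\<close> vectors, each strictly below \<open>s\<close>.\<close>
  have "edim M = \<infinity>" using op_rank_le_edim [OF M(1) bS] rank by simp
  with assms(5) obtain x where x: "\<forall>i\<in>{1..k}. x i \<in> M" "orthonormal_upto k x"
    "ky_fan_norm k M T = (\<Sum>j=1..k. norm (T (x j)))"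
    by (auto simp: norming_def)
  have "norm (T (x j)) < s" if "j \<in> {1..k}" for j
  proof -
    have xj: "x j \<in> M" using x(1) that by blast
    moreover have "norm (x j) = 1"
      using x(2) that cinner_eq_1_norm [of "x j"] by (simp add: orthonormal_upto_def)
    ultimately show ?thesis using le [OF xj] ne [OF xj] nS [OF xj] by simp
  qed
  then have "(\<Sum>j=1..k. norm (T (x j))) < (\<Sum>j=1..k. s)"
    using k by (intro sum_strict_mono) auto
  then show False using ky x(3) by simp
qed

text \<open>With \<open>s\<close> the supremum of the spectrum this is the argument of the recursive
  call in \<open>eig_num\<close>. Keeping \<open>s\<close> a parameter allows the operator norm to
  be inserted for it.\<close>

definition deflate ::
  "'a::complex_hilbert set \<Rightarrow> ('a \<Rightarrow> 'a) \<Rightarrow> real \<Rightarrow> 'a \<Rightarrow> 'a" where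
  "deflate M S s x = S x - complex_of_real s *\<^sub>C orth_proj (eigenspace M S (complex_of_real s)) x"

context
  fixes M :: "'a::complex_hilbert set" and S :: "'a \<Rightarrow> 'a" and s :: real and E S1
  assumes M: "closed_csubspace M" and S: "positive_op M S"
  defines "E \<equiv> eigenspace M S (complex_of_real s)"
    and "S1 \<equiv> deflate M S s"
begin

private lemma S1_eq: "S1 x = S x - complex_of_real s *\<^sub>C orth_proj E x"
  by (simp add: S1_def deflate_def E_def)

private lemma S_bop: "bounded_op M M S" by (rule pos_bounded [OF S])

private lemma saS: "selfadjoint_op M S" by (rule positive_selfadjoint [OF M S])

lemma eigenspace_closed: "closed_csubspace E"
  unfolding E_def by (rule closed_csubspace_eigenspace [OF M S_bop])

lemma eigenspace_sub: "E \<subseteq> M"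
  by (auto simp: E_def eigenspace_def)

lemma eigenspace_eq: "e \<in> E \<Longrightarrow> S e = s *\<^sub>R e"
  by (simp add: E_def eigenspace_def scaleR_scaleC)

lemma orth_eigenspace_invariant:
  assumes "x \<in> M" "\<And>e. e \<in> E \<Longrightarrow> cinner x e = 0" "e \<in> E"
  shows "cinner (S x) e = 0"
  using sa_sym [OF saS assms(1), of e] assms eigenspace_sub eigenspace_eq [OF assms(3)]
  by (auto simp: cinner_scaleR_right)

lemma deflation_decomposition:
  assumes "x \<in> M"
  obtains p q where "x = p + q" "p \<in> E" "q \<in> M" "\<And>e. e \<in> E \<Longrightarrow> cinner q e = 0"
    "S x = s *\<^sub>R p + S q" "S1 x = S q" "norm p \<le> norm x"
proof -
  obtain p q where pq: "x = p + q" "p \<in> E" "q \<in> M" "\<And>e. e \<in> E \<Longrightarrow> cinner q e = 0"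
    "p = orth_proj E x" "norm p \<le> norm x"
    using orth_decomposition [OF eigenspace_closed M eigenspace_sub assms] by blast
  have pM: "p \<in> M" using pq(2) eigenspace_sub by blast
  have Sx: "S x = s *\<^sub>R p + S q"
    unfolding pq(1) bop_add [OF S_bop pM pq(3)] eigenspace_eq [OF pq(2)] ..
  have "S1 x = S q"
    unfolding S1_eq pq(5) [symmetric] Sx by (simp add: scaleR_scaleC)
  with pq(1-4) Sx pq(6) show thesis using that by blast
qed

lemma deflation_on_orth:
  assumes "x \<in> M" "\<And>e. e \<in> E \<Longrightarrow> cinner x e = 0"
  shows "S1 x = S x"
proof -
  have "orth_proj E x = 0"
    using assms(2) csubspace_0 [OF eigenspace_closed] by (intro orth_proj_eqI [OF eigenspace_closed]) auto
  then show ?thesis by (simp add: S1_eq)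
qed

text \<open>If \<open>q\<close> is the component of \<open>x\<close> orthogonal to \<open>E\<close>,
  then the deflated operator sends \<open>x\<close> to \<open>S q\<close>, and its form at
  \<open>x\<close> is that of \<open>S\<close> at \<open>q\<close>.\<close>

lemma deflation_positive: "positive_op M S1"
proof (rule positive_opI)
  have P: "selfadjoint_op M (orth_proj E)"
    unfolding selfadjoint_op_def
  proof (intro conjI ballI)
    show "bounded_op M M (orth_proj E)"
      using bounded_op_mono [OF bounded_op_orth_proj [OF eigenspace_closed]]
        orth_proj_in [OF eigenspace_closed] eigenspace_sub by blast
    fix x y
    have "cinner (x - orth_proj E x) (orth_proj E y) = 0" "cinner (y - orth_proj E y) (orth_proj E x) = 0"
      by (intro cinner_orth_proj [OF eigenspace_closed] orth_proj_in [OF eigenspace_closed])+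
    then have "cinner x (orth_proj E y) = cinner (orth_proj E x) (orth_proj E y)"
      "cinner y (orth_proj E x) = cinner (orth_proj E y) (orth_proj E x)"
      by (simp_all add: cinner.diff_left)
    then show "cinner (orth_proj E x) y = cinner x (orth_proj E y)"
      by (metis cinner_commute)
  qed
  then show "selfadjoint_op M S1"
    unfolding S1_eq [abs_def] using selfadjoint_op_diff [OF M saS selfadjoint_op_scaleR [OF M P, of s]]
    by (simp add: scaleR_scaleC)
  fix x assume "x \<in> M"
  then obtain p q where pq: "x = p + q" "p \<in> E" "q \<in> M" "\<And>e. e \<in> E \<Longrightarrow> cinner q e = 0" "S1 x = S q"
    using deflation_decomposition by metis
  have "cinner (S q) p = 0" using pq by (intro orth_eigenspace_invariant) auto
  then have "cinner (S1 x) x = cinner (S q) q" unfolding pq(5) using pq(1) by (simp add: cinner_add_right)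
  then show "0 \<le> Re (cinner (S1 x) x)" using pos_Re [OF S pq(3)] by simp
qed

text \<open>\<open>M\<close> splits into \<open>E\<close>, where \<open>S\<close> is
  \<open>s\<close>, and the invariant complement \<open>N\<close>, where the norm of
  \<open>S\<close> is at most \<open>c\<close>. A point \<open>z\<close> other than \<open>s\<close>
  at distance less than \<open>s - c\<close> from it satisfies \<open>c < cmod z\<close>, so
  \<open>S - z\<close> is invertible on both parts.\<close>

lemma not_limit_point:
  assumes c: "0 \<le> c" "c < s" and le: "\<And>x. x \<in> M \<Longrightarrow> norm (S1 x) \<le> c * norm x"
  shows "\<not> complex_of_real s islimpt spectrum M S"
proof
  assume "complex_of_real s islimpt spectrum M S"
  then obtain z where z: "z \<in> spectrum M S" "z \<noteq> complex_of_real s" "dist z (complex_of_real s) < s - c"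
    using c(2) unfolding islimpt_approachable by (metis diff_gt_0_iff_gt)
  have "c < cmod z"
    using z(3) norm_triangle_ineq2 [of "complex_of_real s" z] c by (simp add: dist_norm norm_minus_commute)
  define N where "N = M \<inter> {x. \<forall>e\<in>E. cinner x e = 0}"
  have N: "closed_csubspace N"
    unfolding N_def by (intro closed_csubspace_Int M closed_csubspace_orth)
  have bN: "bounded_op N N S"
    using orth_eigenspace_invariant bop_in [OF S_bop]
    by (intro bounded_op_mono [OF S_bop]) (auto simp: N_def)
  have leN: "norm (S x) \<le> c * norm x" if "x \<in> N" for x
    using le [of x] deflation_on_orth [of x] that by (simp add: N_def)
  \<comment> \<open>The first number bounds \<open>S - z\<close> from below on \<open>E\<close>, the
    second on \<open>N\<close>; the two parts stay orthogonal, so the minimum works on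
    \<open>M\<close>.\<close>
  define d where "d = min (cmod (complex_of_real s - z)) (cmod z - c)"
  have d: "0 < d" using z(2) \<open>c < cmod z\<close> by (simp add: d_def)
  have "z \<notin> spectrum M S"
  proof (rule not_in_spectrumI [OF M S_bop d])
    fix x assume "x \<in> M"
    then obtain p q where pq: "x = p + q" "p \<in> E" "q \<in> M" "\<And>e. e \<in> E \<Longrightarrow> cinner q e = 0"
      "S x = s *\<^sub>R p + S q"
      using deflation_decomposition by metis
    let ?a = "(complex_of_real s - z) *\<^sub>C p" and ?b = "S q - z *\<^sub>C q"
    have qN: "q \<in> N" using pq by (simp add: N_def)
    have eq: "S x - z *\<^sub>C x = ?b + ?a"
      unfolding pq(5) by (simp add: pq(1) scaleC_add_right scaleR_scaleC scaleC.diff_left)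
    have bp: "cinner ?b p = 0"
      using pq orth_eigenspace_invariant [OF pq(3,4,2)] by (simp add: cinner_simps)
    have "(d * norm x)\<^sup>2 = d\<^sup>2 * (norm q)\<^sup>2 + d\<^sup>2 * (norm p)\<^sup>2"
      using pythagoras [OF pq(4) [OF pq(2)]]
      by (simp add: pq(1) add.commute [of p] power_mult_distrib distrib_left)
    also have "\<dots> \<le> (norm ?b)\<^sup>2 + (norm ?a)\<^sup>2"
    proof (rule add_mono)
      have "d * norm q \<le> (cmod z - c) * norm q" by (intro mult_right_mono) (simp_all add: d_def)
      also have "\<dots> \<le> norm ?b"
        using leN [OF qN] norm_triangle_ineq2 [of "z *\<^sub>C q" "S q"]
        by (simp add: norm_scaleC norm_minus_commute left_diff_distrib)
      finally show "d\<^sup>2 * (norm q)\<^sup>2 \<le> (norm ?b)\<^sup>2"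
        using d by (simp add: power_mult_distrib [symmetric] power_mono)
      have "d * norm p \<le> norm ?a" unfolding norm_scaleC by (intro mult_right_mono) (simp_all add: d_def)
      then show "d\<^sup>2 * (norm p)\<^sup>2 \<le> (norm ?a)\<^sup>2"
        using d by (simp add: power_mult_distrib [symmetric] power_mono)
    qed
    also have "\<dots> = (norm (S x - z *\<^sub>C x))\<^sup>2"
      unfolding eq using bp by (subst pythagoras) (simp_all add: cinner_scaleC_right)
    finally show "d * norm x \<le> norm (S x - z *\<^sub>C x)" by (rule power2_le_imp_le) simp
  next
    fix y assume "y \<in> M"
    then obtain p q where pq: "y = p + q" "p \<in> E" "q \<in> M" "\<And>e. e \<in> E \<Longrightarrow> cinner q e = 0"
      using deflation_decomposition by metis
    then have "q \<in> N" by (simp add: N_def)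
    then obtain w where w: "w \<in> N" "S w - z *\<^sub>C w = q"
      using resolvent_surjective [OF N bN c(1) leN \<open>c < cmod z\<close>] by blast
    define v where "v = inverse (complex_of_real s - z) *\<^sub>C p"
    have v: "v \<in> E" unfolding v_def using csubspace_scaleC [OF eigenspace_closed pq(2)] .
    then have vM: "v \<in> M" using eigenspace_sub by blast
    have wM: "w \<in> M" using w(1) by (simp add: N_def)
    have "S v - z *\<^sub>C v = (complex_of_real s - z) *\<^sub>C v"
      using eigenspace_eq [OF v] by (simp add: scaleC.diff_left scaleR_scaleC)
    also have "\<dots> = p" using z(2) by (simp add: v_def scaleC_scaleC scaleC_one)
    finally have "S (v + w) - z *\<^sub>C (v + w) = y"
      using w(2) by (simp add: bop_add [OF S_bop vM wM] scaleC_add_right pq(1) algebra_simps)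
    then show "\<exists>x\<in>M. S x - z *\<^sub>C x = y" using csubspace_add [OF M vM wM] by blast
  qed
  then show False using z(1) by simp
qed

lemma eigenspace_image:
  assumes s: "s \<noteq> 0"
  shows "E \<subseteq> S ` M"
proof
  fix e assume e: "e \<in> E"
  have eM: "e \<in> M" using e eigenspace_sub by blast
  have "S (inverse s *\<^sub>R e) = e"
    unfolding bop_scaleR [OF S_bop eM] eigenspace_eq [OF e] using s by simp
  then show "e \<in> S ` M" using csubspace_scaleR [OF M eM] by (metis imageI)
qed

text \<open>The range of the deflated operator is orthogonal to \<open>E\<close>, and both lie in
  the range of \<open>S\<close>, for \<open>E\<close> because \<open>s\<close> is nonzero.
  Orthonormal sets in the two can therefore be united. By contraposition, an index beyond the rank
  of \<open>S\<close> stays beyond the rank after the shift in the recursion.\<close>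

lemma op_rank_deflation:
  assumes s: "s \<noteq> 0" and Z: "finite Z" "orthonormal_set Z" "Z \<subseteq> E" and i: "enat i \<le> op_rank M S1"
  shows "enat (card Z + i) \<le> op_rank M S"
proof -
  note b1 = pos_bounded [OF deflation_positive]
  obtain Y where Y: "finite Y" "orthonormal_set Y" "Y \<subseteq> S1 ` M" "card Y = i"
    using i unfolding op_rank_def enat_le_edim_iff [OF subspace_image [OF b1 M]] by blast
  have orth: "cinner y e = 0" "y \<in> S ` M" if "y \<in> S1 ` M" "e \<in> E" for y e
  proof -
    obtain x where "x \<in> M" "y = S1 x" using \<open>y \<in> S1 ` M\<close> by blast
    then obtain q where q: "q \<in> M" "\<And>e. e \<in> E \<Longrightarrow> cinner q e = 0" "y = S q"
      using deflation_decomposition by metis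
    then show "cinner y e = 0" "y \<in> S ` M" using orth_eigenspace_invariant [OF q(1,2)] \<open>e \<in> E\<close> by auto
  qed
  have disj: "Z \<inter> Y = {}"
    using orth(1) Y(3) Z(3) orthonormal_setD [OF Z(2)] by fastforce
  have "orthonormal_set (Z \<union> Y)"
    unfolding orthonormal_set_def
  proof (intro ballI)
    fix x y assume "x \<in> Z \<union> Y" "y \<in> Z \<union> Y"
    moreover have "cinner b a = 0" "cinner a b = 0" "a \<noteq> b" if "a \<in> Z" "b \<in> Y" for a b
      using orth(1) [of b a] that Z(3) Y(3) disj by (auto simp: cinner_eq_0_commute [of a b])
    ultimately show "cinner x y = (if x = y then 1 else 0)"
      using orthonormal_setD [OF Z(2)] orthonormal_setD [OF Y(2)] by (metis UnE)
  qed
  moreover have "Z \<union> Y \<subseteq> S ` M"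
    using Z(3) eigenspace_image [OF s] orth(2) [OF _ csubspace_0 [OF eigenspace_closed]] Y(3) by blast
  moreover have "card (Z \<union> Y) = card Z + i" using disj Z(1) Y(1,4) by (simp add: card_Un_disjoint)
  ultimately show ?thesis
    unfolding op_rank_def enat_le_edim_iff [OF subspace_image [OF S_bop M]] using Z(1) Y(1)
    by (intro exI [of _ "Z \<union> Y"]) simp
qed

end

section \<open>Eigenvectors realising the recursion for \<open>eig_num\<close>\<close>

lemma eig_num_rec:
  assumes M: "closed_csubspace M" "M \<noteq> {0}" and S: "positive_op M S" and j: "enat j \<le> op_rank M S"
  defines "s \<equiv> op_norm M S"
  defines "E \<equiv> eigenspace M S (complex_of_real s)"
  shows "eig_num M S j = (if complex_of_real s \<in> ess_spectrum M S \<or> j \<le> complex_vector.dim E \<or> complex_vector.dim E = 0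
    then s else eig_num M (deflate M S s) (j - complex_vector.dim E))"
  using j by (subst eig_num.simps)
    (simp add: Let_def spec_sup_eq_op_norm [OF M S] s_def [symmetric] E_def [symmetric] deflate_def [abs_def, folded E_def])

text \<open>Extend \<open>Z\<close> to an orthonormal set of size \<open>card Z + n\<close> inside
  \<open>L\<close> and discard \<open>Z\<close>.\<close>

lemma complement_dimension:
  assumes L: "complex_vector.subspace L" and Z: "finite Z" "orthonormal_set Z" "Z \<subseteq> L"
    and k: "enat (card Z + n) \<le> edim L"
    and L': "complex_vector.subspace L'" "\<And>x. x \<in> L \<Longrightarrow> (\<And>z. z \<in> Z \<Longrightarrow> cinner x z = 0) \<Longrightarrow> x \<in> L'"
  shows "enat n \<le> edim L'"
proof -
  obtain Y where Y: "finite Y" "orthonormal_set Y" "Z \<subseteq> Y" "Y \<subseteq> L" "card Y = card Z + n"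
    using orthonormal_set_extend_card [OF L Z k] by blast
  have "Y - Z \<subseteq> L'"
  proof
    fix x assume x: "x \<in> Y - Z"
    show "x \<in> L'"
    proof (rule L'(2))
      show "x \<in> L" using x Y(4) by blast
      show "cinner x z = 0" if "z \<in> Z" for z
        using orthonormal_setD [OF Y(2), of x z] x that Y(3) by auto
    qed
  qed
  moreover have "card (Y - Z) = n" using Y Z(1) by (simp add: card_Diff_subset)
  ultimately show ?thesis
    unfolding enat_le_edim_iff [OF L'(1)] using Y orthonormal_set_subset [OF Y(2), of "Y - Z"]
    by (intro exI [of _ "Y - Z"]) auto
qed

text \<open>The recursion in \<open>eig_num\<close> changes the operator but keeps \<open>M\<close>,
  while norm attainment is known only for the original operator. The induction therefore carries an
  invariant subspace \<open>L\<close> off which \<open>S\<close> vanishes and on whose closed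
  subspaces attainment holds. Each step removes the top eigenspace from \<open>L\<close>, and on
  what remains of \<open>L\<close> the deflated operator coincides with \<open>S\<close>.\<close>

lemma eigenvector_system:
  fixes M :: "'a::complex_hilbert set"
  assumes M: "closed_csubspace M"
  shows "positive_op M S \<Longrightarrow> closed_csubspace L \<Longrightarrow> L \<subseteq> M \<Longrightarrow> \<forall>x\<in>L. S x \<in> L \<Longrightarrow>
    \<forall>x\<in>M. (\<forall>y\<in>L. cinner x y = 0) \<longrightarrow> S x = 0 \<Longrightarrow>
    \<forall>N. closed_csubspace N \<longrightarrow> N \<subseteq> L \<longrightarrow> N \<noteq> {0} \<longrightarrow> attains_norm N S \<Longrightarrow> enat k \<le> edim L \<Longrightarrow>
    \<exists>x. orthonormal_upto k x \<and>
      (\<forall>i\<in>{1..k}. x i \<in> L \<and> S (x i) = eig_num M S i *\<^sub>R x i \<and> 0 \<le> eig_num M S i)"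
proof (induction k arbitrary: S L rule: less_induct)
  case (less k)
  note S = less.prems(1) and L = less.prems(2) and LM = less.prems(3) and SL = less.prems(4)
    and S0 = less.prems(5) and att = less.prems(6) and kL = less.prems(7)
  note bS = pos_bounded [OF S] and subL = csubspace_subspace [OF L]
  show ?case
  proof (cases "k = 0")
    case True
    then show ?thesis by (simp add: orthonormal_upto_def)
  next
    case False
    have L0: "L \<noteq> {0}"
    proof
      assume "L = {0}"
      then have "enat k \<le> 0" using kL by (simp add: edim_trivial)
      then show False using False by (simp add: zero_enat_def)
    qed
    then have M0: "M \<noteq> {0}" using LM csubspace_0 [OF L] by blast
    note T = bop_UNIV [OF bS]
    define s where "s = op_norm M S"
    define E where "E = eigenspace M S (complex_of_real s)"
    have s0: "0 \<le> s" unfolding s_def by (rule op_norm_nonneg [OF M M0 T])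
    have le_s: "norm (S x) \<le> s * norm x" if "x \<in> M" for x
      unfolding s_def by (rule norm_le_op_norm [OF M M0 T that])
    obtain u where u: "u \<in> L" "norm u = 1" "\<forall>y\<in>L. norm (S y) \<le> norm (S u) * norm y"
      using att L L0 by (auto simp: attains_norm_def)
    have uM: "u \<in> M" using u(1) LM by blast
    have S_proj: "S x = S p" if "p \<in> M" "q \<in> M" "x = p + q" "\<forall>y\<in>L. cinner q y = 0" for x p q
      using that S0 by (simp add: bop_add [OF bS])
    \<comment> \<open>The norm over \<open>M\<close> is already the norm over \<open>L\<close>,
      because \<open>S\<close> depends only on the component in \<open>L\<close>. So the maximiser
      in \<open>L\<close> is an eigenvector for \<open>s\<close>.\<close>
    have "s \<le> norm (S u)"
      unfolding s_def
    proof (rule op_norm_least [OF M M0 T])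
      fix x assume x: "x \<in> M"
      obtain p q where pq: "x = p + q" "p \<in> L" "q \<in> M" "\<And>y. y \<in> L \<Longrightarrow> cinner q y = 0" "norm p \<le> norm x"
        using orth_decomposition [OF L M LM x] by metis
      have "norm (S x) = norm (S p)" using S_proj [of p q x] pq LM by auto
      also have "\<dots> \<le> norm (S u) * norm p" using u(3) pq(2) by blast
      also have "\<dots> \<le> norm (S u) * norm x" using pq(5) by (intro mult_left_mono) auto
      finally show "norm (S x) \<le> norm (S u) * norm x" .
    qed
    then have nu: "norm (S u) = s" using le_s [OF uM] u(2) by simp
    then have Su: "S u = s *\<^sub>R u"
      using maximal_norm_eigenvector [OF M M0 S uM] u(2) by (simp add: s_def)
    show ?thesis
    proof (cases "s = 0")
      case True
      then have "S ` M = {0}" using le_s uM by auto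
      then have "op_rank M S = 0" by (simp add: op_rank_def edim_trivial)
      then have eig0: "eig_num M S j = 0" if "j \<ge> 1" for j
        using that by (intro eig_num_above_rank) (simp add: zero_enat_def)
      obtain x where x: "orthonormal_upto k x" "\<forall>i\<in>{1..k}. x i \<in> L"
        using kL unfolding enat_le_edim_upto [OF subL] by blast
      have "S (x i) = 0" if "i \<in> {1..k}" for i
      proof -
        have "x i \<in> M" using x(2) that LM by blast
        then show ?thesis using le_s [of "x i"] True by simp
      qed
      then show ?thesis using x eig0 by (intro exI [of _ x]) simp
    next
      case sne: False
      note cE = eigenspace_closed [OF M S, of s, folded E_def] and EM = eigenspace_sub [OF M S, of s, folded E_def]
        and Eeq = eigenspace_eq [OF M S, of _ s, folded E_def]
      \<comment> \<open>An eigenvector for a nonzero eigenvalue is a multiple of its image, and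
        images lie in \<open>L\<close>.\<close>
      have EL: "E \<subseteq> L"
      proof
        fix e assume e: "e \<in> E"
        then have eM: "e \<in> M" using EM by blast
        obtain p q where pq: "e = p + q" "p \<in> L" "q \<in> M" "\<And>y. y \<in> L \<Longrightarrow> cinner q y = 0"
          using orth_decomposition [OF L M LM eM] by metis
        have "p \<in> M" using pq(2) LM by blast
        then have "S e = S p" using S_proj [of p q e] pq by blast
        then have "s *\<^sub>R e = S p" using Eeq [OF e] by simp
        then have "inverse s *\<^sub>R s *\<^sub>R e \<in> L" using SL pq(2) csubspace_scaleR [OF L] by metis
        then show "e \<in> L" using sne by simp
      qed
      have uE: "u \<in> E" using uM Su by (simp add: E_def eigenspace_def scaleR_scaleC)
      have EI: "E \<subseteq> S ` M" unfolding E_def by (rule eigenspace_image [OF M S sne])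
      have rankE: "edim E \<le> op_rank M S"
        unfolding op_rank_def
        by (rule edim_mono [OF csubspace_subspace [OF cE] subspace_image [OF bS M] EI])
      note rec = eig_num_rec [OF M M0 S, folded s_def, folded E_def]
      show ?thesis
      proof (cases "enat k \<le> edim E")
        case True
        obtain x where x: "orthonormal_upto k x" "\<forall>i\<in>{1..k}. x i \<in> E"
          using True unfolding enat_le_edim_upto [OF csubspace_subspace [OF cE]] by blast
        have "eig_num M S i = s" if i: "i \<in> {1..k}" for i
        proof -
          have iE: "enat i \<le> edim E" using i by (intro order_trans [OF _ True]) simp
          \<comment> \<open>For infinite-dimensional \<open>E\<close> the number
            \<open>dim E\<close> says nothing, but then \<open>s\<close> has infinite multiplicity
            and is essential. Either way the recursion returns \<open>s\<close>.\<close>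
          have "complex_of_real s \<in> ess_spectrum M S \<or> i \<le> complex_vector.dim E"
          proof (cases "edim E = \<infinity>")
            case True
            then show ?thesis
              using op_norm_in_spectrum [OF M M0 S] by (simp add: ess_spectrum_def s_def E_def)
          next
            case False
            then show ?thesis using iE edim_eq_dim [of E "\<infinity>"] by simp
          qed
          then show ?thesis using rec [OF order_trans [OF iE rankE]] by auto
        qed
        then show ?thesis using x EL Eeq s0 by (intro exI [of _ x]) auto
      next
        case False
        define m where "m = complex_vector.dim E"
        have dE: "edim E = enat m" using False edim_eq_dim [of E "enat k"] by (auto simp: m_def)
        obtain Z where Z: "finite Z" "orthonormal_set Z" "Z \<subseteq> E" "card Z = m"
          using dE enat_le_edim_iff [OF csubspace_subspace [OF cE], of m] by auto
        have mk: "m < k" using False dE by simp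
        have spanZ: "complex_vector.span Z = E"
        proof (rule ccontr)
          assume "complex_vector.span Z \<noteq> E"
          then have "\<not> E \<subseteq> complex_vector.span Z"
            using complex_vector.span_minimal [OF Z(3) csubspace_subspace [OF cE]] by blast
          then obtain v where v: "v \<in> E" "norm v = 1" "\<And>z. z \<in> Z \<Longrightarrow> cinner v z = 0"
            using orthonormal_extend [OF Z(2,1,3) csubspace_subspace [OF cE]] by metis
          have "enat (Suc m) \<le> edim E"
            unfolding enat_le_edim_iff [OF csubspace_subspace [OF cE]]
            using Z v orthonormal_set_insert [OF Z(2) v(2,3)] by (intro exI [of _ "insert v Z"]) auto
          then show False using dE by simp
        qed
        \<comment> \<open>This excludes the default branch for \<open>m = 0\<close> and makes
          \<open>k - m\<close> smaller than \<open>k\<close> for the induction.\<close>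
        have m0: "m \<noteq> 0"
          using Z spanZ uE u(2) by (metis card_0_eq complex_vector.span_empty norm_zero singletonD zero_neq_one)
        define L1 where "L1 = L \<inter> {x. \<forall>e\<in>E. cinner x e = 0}"
        define S1 where "S1 = deflate M S s"
        have cL1: "closed_csubspace L1"
          unfolding L1_def by (intro closed_csubspace_Int L closed_csubspace_orth)
        have L1M: "L1 \<subseteq> M" using LM by (auto simp: L1_def)
        note dec = deflation_decomposition [OF M S, of _ s, folded E_def S1_def]
        note S1_eq = deflation_on_orth [OF M S, of _ s, folded E_def S1_def]
        note inv = orth_eigenspace_invariant [OF M S, of _ s, folded E_def]
        have S1L1: "S1 x = S x" if "x \<in> L1" for x
          using that L1M by (intro S1_eq) (auto simp: L1_def)
        have pS1: "positive_op M S1" unfolding S1_def by (rule deflation_positive [OF M S])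
        have inv1: "\<forall>x\<in>L1. S1 x \<in> L1"
        proof
          fix x assume x: "x \<in> L1"
          have "cinner (S x) e = 0" if "e \<in> E" for e
            using x L1M that by (intro inv) (auto simp: L1_def)
          then show "S1 x \<in> L1" using x SL S1L1 [OF x] by (simp add: L1_def)
        qed
        \<comment> \<open>Splitting along \<open>E\<close>, its complement \<open>L1\<close> inside
          \<open>L\<close>, and the complement of \<open>L\<close> in \<open>M\<close>: the deflated
          operator sees only the part \<open>a\<close> in \<open>L1\<close>.\<close>
        have dec1: "\<exists>p a b. x = p + a + b \<and> p \<in> E \<and> a \<in> L1 \<and> (\<forall>y\<in>L. cinner b y = 0) \<and> S1 x = S a \<and> norm a \<le> norm x"
          if x: "x \<in> M" for x
        proof -
          obtain p q where pq: "x = p + q" "p \<in> E" "q \<in> M" "\<And>e. e \<in> E \<Longrightarrow> cinner q e = 0" "S1 x = S q"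
            using dec [OF x] by metis
          obtain a b where ab: "q = a + b" "a \<in> L" "b \<in> M" "\<And>y. y \<in> L \<Longrightarrow> cinner b y = 0" "norm a \<le> norm q"
            using orth_decomposition [OF L M LM pq(3)] by metis
          have "cinner a e = 0" if "e \<in> E" for e
            using pq(4) [OF that] ab(4) [of e] EL that by (auto simp: ab(1) cinner_add_left)
          then have "a \<in> L1" using ab(2) by (simp add: L1_def)
          moreover have "S q = S a" using S_proj [of a b q] ab LM by auto
          moreover have "(norm (q + p))\<^sup>2 = (norm q)\<^sup>2 + (norm p)\<^sup>2" by (rule pythagoras [OF pq(4) [OF pq(2)]])
          then have "(norm q)\<^sup>2 \<le> (norm x)\<^sup>2" by (simp add: pq(1) add.commute)
          then have "norm q \<le> norm x" by (rule power2_le_imp_le) simp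
          ultimately show ?thesis using pq ab
            by (intro exI [of _ p] exI [of _ a] exI [of _ b]) (auto simp: add.assoc)
        qed
        have zero1: "\<forall>x\<in>M. (\<forall>y\<in>L1. cinner x y = 0) \<longrightarrow> S1 x = 0"
        proof (intro ballI impI)
          fix x assume x: "x \<in> M" "\<forall>y\<in>L1. cinner x y = 0"
          obtain p a b where d: "x = p + a + b" "p \<in> E" "a \<in> L1" "\<forall>y\<in>L. cinner b y = 0" "S1 x = S a"
            using dec1 [OF x(1)] by blast
          have "cinner p a = 0" using d(2,3) by (simp add: L1_def cinner_eq_0_commute [of p])
          moreover have "cinner b a = 0" "cinner x a = 0" using d(3,4) x(2) by (auto simp: L1_def)
          ultimately have "cinner a a = 0" by (simp add: d(1) cinner_add_left)
          then show "S1 x = 0" using d(5) bop_0 [OF bS M] by simp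
        qed
        have att1: "\<forall>N. closed_csubspace N \<longrightarrow> N \<subseteq> L1 \<longrightarrow> N \<noteq> {0} \<longrightarrow> attains_norm N S1"
        proof (intro allI impI)
          fix N assume N: "closed_csubspace N" "N \<subseteq> L1" "N \<noteq> {0}"
          then have "attains_norm N S" using att by (auto simp: L1_def)
          moreover have "S1 x = S x" if "x \<in> N" for x using S1L1 N(2) that by blast
          ultimately show "attains_norm N S1" by (simp add: attains_norm_def)
        qed
        \<comment> \<open>Attainment on \<open>L1\<close> is what produces a gap: a unit maximiser
          there with norm \<open>s\<close> would lie in \<open>E\<close> and be orthogonal to
          \<open>E\<close>. The gap isolates \<open>s\<close> in the spectrum, and as
          \<open>E\<close> has finite dimension, \<open>s\<close> is not essential.\<close>
        have "\<exists>c. 0 \<le> c \<and> c < s \<and> (\<forall>x\<in>L1. norm (S x) \<le> c * norm x)"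
        proof (cases "L1 = {0}")
          case True
          then show ?thesis using s0 sne bop_0 [OF bS M] by (intro exI [of _ 0]) auto
        next
          case False
          then obtain v where v: "v \<in> L1" "norm v = 1" "\<forall>y\<in>L1. norm (S y) \<le> norm (S v) * norm y"
            using att cL1 unfolding attains_norm_def by (metis Int_lower1 L1_def)
          have vM: "v \<in> M" using v(1) L1M by blast
          have "norm (S v) \<noteq> s"
          proof
            assume "norm (S v) = s"
            then have "v \<in> E"
              using maximal_norm_eigenvector [OF M M0 S vM] vM v(2)
              by (simp add: s_def E_def eigenspace_def scaleR_scaleC)
            then have "cinner v v = 0" using v(1) by (simp add: L1_def)
            then show False using v(2) by simp
          qed
          then show ?thesis using le_s [OF vM] v by (intro exI [of _ "norm (S v)"]) auto
        qed
        then obtain c where c: "0 \<le> c" "c < s" "\<And>x. x \<in> L1 \<Longrightarrow> norm (S x) \<le> c * norm x" by blast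
        have "norm (S1 x) \<le> c * norm x" if x: "x \<in> M" for x
        proof -
          obtain a where a: "a \<in> L1" "S1 x = S a" "norm a \<le> norm x" using dec1 [OF x] by blast
          have "norm (S a) \<le> c * norm a" by (rule c(3) [OF a(1)])
          also have "\<dots> \<le> c * norm x" using a(3) c(1) by (rule mult_left_mono)
          finally show ?thesis by (simp add: a(2))
        qed
        then have "\<not> complex_of_real s islimpt spectrum M S"
          using not_limit_point [OF M S c(1,2)] by (simp add: S1_def)
        then have ness: "complex_of_real s \<notin> ess_spectrum M S"
          using dE by (simp add: ess_spectrum_def E_def)
        have "enat (k - m) \<le> edim L1"
        proof (rule complement_dimension [OF subL Z(1,2) _ _ csubspace_subspace [OF cL1]])
          show "Z \<subseteq> L" using Z(3) EL by blast
          show "enat (card Z + (k - m)) \<le> edim L" using kL mk Z(4) by simp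
          fix x assume x: "x \<in> L" "\<And>z. z \<in> Z \<Longrightarrow> cinner x z = 0"
          have "cinner x e = 0" if "e \<in> E" for e
          proof -
            have "e = (\<Sum>z\<in>Z. cinner e z *\<^sub>C z)"
              using that spanZ by (intro orthonormal_expansion [OF Z(2,1)]) simp
            then have "cinner x e = (\<Sum>z\<in>Z. cinner x (cinner e z *\<^sub>C z))"
              by (metis cinner.sum_right)
            then show ?thesis by (simp add: cinner_scaleC_right x(2))
          qed
          then show "x \<in> L1" using x(1) by (simp add: L1_def)
        qed
        from less.IH [OF _ pS1 cL1 L1M inv1 zero1 att1 this] obtain y where y: "orthonormal_upto (k - m) y"
          "\<And>i. i \<in> {1..k - m} \<Longrightarrow> y i \<in> L1 \<and> S1 (y i) = eig_num M S1 i *\<^sub>R y i \<and> 0 \<le> eig_num M S1 i"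
          using m0 mk by auto
        obtain e where e: "orthonormal_upto m e" "e ` {1..m} = Z"
          using orthonormal_set_upto [OF Z(1,2,4)] .
        define x where "x i = (if i \<le> m then e i else y (i - m))" for i
        have eE: "e i \<in> E" if "1 \<le> i" "i \<le> m" for i using that e(2) Z(3) by auto
        have low: "eig_num M S i = s" if "1 \<le> i" "i \<le> m" for i
          using rec [of i] ness that rankE dE order_trans [of "enat i" "enat m"] by (simp add: m_def)
        \<comment> \<open>The rank test comes before the recursion. Above the rank of
          \<open>S\<close> both sides are 0, because the shifted index is then above the rank of the
          deflated operator.\<close>
        have high: "eig_num M S i = eig_num M S1 (i - m)" if "m < i" "i \<le> k" for i
        proof (cases "enat i \<le> op_rank M S")
          case True
          then show ?thesis using rec [OF True] ness that m0 by (simp add: m_def S1_def)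
        next
          case False
          have "\<not> enat (i - m) \<le> op_rank M S1"
          proof
            assume "enat (i - m) \<le> op_rank M S1"
            then have "enat (card Z + (i - m)) \<le> op_rank M S"
              using op_rank_deflation [OF M S sne Z(1,2)] Z(3) by (simp add: E_def S1_def)
            then show False using False Z(4) that by simp
          qed
          then show ?thesis using False by (simp add: eig_num_above_rank)
        qed
        have "orthonormal_upto k x"
          unfolding orthonormal_upto_def
        proof (intro ballI)
          fix i j assume ij: "i \<in> {1..k}" "j \<in> {1..k}"
          have ey: "cinner (y b) (e a) = 0" "cinner (e a) (y b) = 0" if "1 \<le> a" "a \<le> m" "b \<in> {1..k - m}" for a b
            using y(2) [OF that(3)] eE [OF that(1,2)] by (auto simp: L1_def cinner_eq_0_commute [of "e a"])
          consider "i \<le> m" "j \<le> m" | "i \<le> m" "m < j" | "m < i" "j \<le> m" | "m < i" "m < j" by linarith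
          then show "cinner (x i) (x j) = (if i = j then 1 else 0)"
          proof cases
            case 1 then show ?thesis using e(1) ij by (simp add: x_def orthonormal_upto_def)
          next
            case 2
            then have "1 \<le> i" "j - m \<in> {1..k - m}" using ij by auto
            from ey(2) [OF this(1) 2(1) this(2)] show ?thesis using 2 by (simp add: x_def)
          next
            case 3
            then have "1 \<le> j" "i - m \<in> {1..k - m}" using ij by auto
            from ey(1) [OF this(1) 3(2) this(2)] show ?thesis using 3 by (simp add: x_def)
          next
            case 4
            then have "i - m \<in> {1..k - m}" "j - m \<in> {1..k - m}" "i - m = j - m \<longleftrightarrow> i = j" using ij by auto
            then show ?thesis using 4 y(1) by (simp add: x_def orthonormal_upto_def)
          qed
        qed
        moreover have "x i \<in> L \<and> S (x i) = eig_num M S i *\<^sub>R x i \<and> 0 \<le> eig_num M S i" if i: "i \<in> {1..k}" for i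
        proof (cases "i \<le> m")
          case True
          then show ?thesis using i eE [of i] Eeq [of "e i"] EL low [of i] s0 by (auto simp: x_def)
        next
          case False
          then have "i - m \<in> {1..k - m}" using i by auto
          from y(2) [OF this] show ?thesis
            using False i high [of i] S1L1 [of "y (i - m)"] by (auto simp: x_def L1_def)
        qed
        ultimately show ?thesis by blast
      qed
    qed
  qed
qed

text \<open>\<open>eigenvector_system\<close> is applied to the modulus of the restriction with
  \<open>L = M\<close>; its eigenvectors give \<open>norm (T (x i))\<close> equal to the
  corresponding singular number, term by term.\<close>

lemma attains_norm_imp_absolutely_norming:
  fixes T :: "'a::complex_hilbert \<Rightarrow> 'b::complex_hilbert"
  assumes T: "bounded_op UNIV UNIV T"
    and att: "\<And>M. closed_csubspace M \<Longrightarrow> M \<noteq> {0} \<Longrightarrow> attains_norm M T"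
  shows "absolutely_norming k T"
  unfolding absolutely_norming_def
proof (intro allI impI, elim conjE)
  fix M :: "'a set" assume M: "closed_csubspace M" "M \<noteq> {0}"
  have TM: "bounded_op M UNIV T" by (rule bounded_op_mono [OF T]) auto
  define S where "S = abs_op M T"
  have S: "positive_op M S" and nS: "\<And>x. x \<in> M \<Longrightarrow> norm (S x) = norm (T x)"
    unfolding S_def using positive_abs_op [OF M(1) TM] norm_abs_op [OF M(1) TM] by auto
  note bS = pos_bounded [OF S]
  have "attains_norm N S" if N: "closed_csubspace N" "N \<subseteq> M" "N \<noteq> {0}" for N
  proof -
    have "norm (S x) = norm (T x)" if "x \<in> N" for x using nS N(2) that by blast
    then show ?thesis using att [OF N(1,3)] by (simp add: attains_norm_def)
  qed
  note attS = this
  define r where "r = (if edim M < enat k then complex_vector.dim M else k)"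
  have rM: "enat r \<le> edim M" "r \<le> k"
    using edim_eq_dim [of M "enat k"] by (auto simp: r_def)
  have "\<forall>x\<in>M. (\<forall>y\<in>M. cinner x y = 0) \<longrightarrow> S x = 0"
    using bop_0 [OF bS M(1)] by (metis cinner_self_eq_0)
  moreover have "\<forall>x\<in>M. S x \<in> M" using bop_in [OF bS] by blast
  ultimately obtain x where x: "orthonormal_upto r x"
    "\<And>i. i \<in> {1..r} \<Longrightarrow> x i \<in> M \<and> S (x i) = eig_num M S i *\<^sub>R x i \<and> 0 \<le> eig_num M S i"
    using eigenvector_system [OF M(1) S M(1) order_refl _ _ _ rM(1)] attS by blast
  have nT: "norm (T (x i)) = eig_num M S i" if "i \<in> {1..r}" for i
  proof -
    have "norm (x i) = 1"
      using x(1) that cinner_eq_1_norm [of "x i"] by (simp add: orthonormal_upto_def)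
    then show ?thesis using x(2) [OF that] nS [of "x i"] by simp
  qed
  \<comment> \<open>Such indices exist only if \<open>M\<close> has finite dimension
    \<open>r < k\<close>; they then exceed the rank, where \<open>eig_num\<close> is 0.\<close>
  have zero: "eig_num M S j = 0" if "j \<in> {1..k} - {1..r}" for j
  proof (rule eig_num_above_rank)
    have "edim M < enat k" using that by (auto simp: r_def split: if_splits)
    then have "edim M = enat r" using edim_eq_dim [of M "enat k"] by (auto simp: r_def)
    then have "op_rank M S \<le> enat r" using op_rank_le_edim [OF M(1) bS] by simp
    also have "enat r < enat j" using that by auto
    finally show "op_rank M S < enat j" .
  qed
  have "ky_fan_norm k M T = (\<Sum>j=1..k. eig_num M S j)" by (simp add: ky_fan_norm_def s_num_def S_def)
  also have "\<dots> = (\<Sum>j=1..r. eig_num M S j)"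
    using rM(2) zero by (intro sum.mono_neutral_right) auto
  also have "\<dots> = (\<Sum>j=1..r. norm (T (x j)))" using nT by (intro sum.cong) auto
  finally show "norming k M T"
    unfolding norming_def Let_def r_def [symmetric] using x by (intro exI [of _ x]) auto
qed

section \<open>Diagonalisation from norm attainment\<close>

lemma closure_span_minimal:
  assumes "closed_csubspace N" "S \<subseteq> N"
  shows "closure (complex_vector.span S) \<subseteq> N"
  using assms by (intro closure_minimal complex_vector.span_minimal) (auto simp: closed_csubspace_def)

lemma closed_csubspace_closure_span: "closed_csubspace (closure (complex_vector.span S))"
  by (rule closed_csubspace_closure) (rule complex_vector.subspace_span)

lemma subset_closure_span: "S \<subseteq> closure (complex_vector.span S)"
  using complex_vector.span_superset closure_subset by blast

lemma orth_closure_span: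
  assumes "\<And>y. y \<in> S \<Longrightarrow> cinner y x = 0" "y \<in> closure (complex_vector.span S)"
  shows "cinner y x = 0"
  using closure_span_minimal [OF closed_csubspace_orth [of "{x}"], of S] assms by auto

lemma closed_csubspace_vimage:
  assumes T: "bounded_op UNIV UNIV T" and N: "closed_csubspace N"
  shows "closed_csubspace {x. T x \<in> N}"
  unfolding closed_csubspace_def complex_vector.subspace_def closed_sequential_limits
proof (intro conjI ballI allI impI)
  fix x l assume x: "(\<forall>n. x n \<in> {x. T x \<in> N}) \<and> x \<longlonglongrightarrow> l"
  then have lim: "(\<lambda>n. T (x n)) \<longlonglongrightarrow> T l"
    by (intro bop_tendsto [OF T closed_csubspace_UNIV]) auto
  have "T l \<in> N" using x by (intro closed_sequentially [OF csubspace_closed [OF N] _ lim]) auto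
  then show "l \<in> {x. T x \<in> N}" by simp
qed (use csubspace_0 [OF N] csubspace_add [OF N] csubspace_scaleC [OF N] bop_0 [OF T closed_csubspace_UNIV]
    bop_add [OF T] bop_scaleC [OF T] in auto)

lemma positive_op_mono:
  assumes "positive_op M A" "N \<subseteq> M" "\<And>x. x \<in> N \<Longrightarrow> A x \<in> N"
  shows "positive_op N A"
  using assms bounded_op_mono [of M M A N N] by (auto simp: positive_op_def)

lemma attains_norm_eigenvector:
  assumes V: "closed_csubspace V" "V \<noteq> {0}" and A: "positive_op V A" and "attains_norm V A"
  shows "\<exists>x\<in>V. norm x = 1 \<and> A x = op_norm V A *\<^sub>R x"
proof -
  obtain x where x: "x \<in> V" "norm x = 1" "norm (A x) = op_norm V A"
    using assms(4) attains_norm_iff [OF V bop_UNIV [OF pos_bounded [OF A]]] by blast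
  then show ?thesis using maximal_norm_eigenvector [OF V A x(1)] by auto
qed

text \<open>Greedy choice: a norm maximiser on the complement, inside \<open>V\<close>, of the
  eigenvectors already found. This complement is invariant, and nonzero because \<open>V\<close> is
  infinite-dimensional. The last clause records that \<open>l n\<close> bounds \<open>A\<close> on
  the complement of the first \<open>n\<close> vectors, whence monotonicity and the later
  compactness estimate.\<close>

lemma eigenvector_sequence:
  fixes A :: "'a::complex_hilbert \<Rightarrow> 'a"
  assumes V: "closed_csubspace V" and A: "positive_op V A" and inf: "edim V = \<infinity>"
    and att: "\<forall>N. closed_csubspace N \<longrightarrow> N \<subseteq> V \<longrightarrow> N \<noteq> {0} \<longrightarrow> attains_norm N A"
  shows "\<exists>(e :: nat \<Rightarrow> 'a) (l :: nat \<Rightarrow> real). (\<forall>n. e n \<in> V) \<and>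
    (\<forall>m n. cinner (e m) (e n) = (if m = n then 1 else 0)) \<and> (\<forall>n. A (e n) = l n *\<^sub>R e n) \<and> (\<forall>n. 0 \<le> l n) \<and>
    (\<forall>n. \<forall>x\<in>V. (\<forall>i<n. cinner x (e i) = 0) \<longrightarrow> norm (A x) \<le> l n * norm x)"
proof -
  note bA = pos_bounded [OF A]
  define W where "W S = V \<inter> {x. \<forall>y\<in>S. cinner x y = 0}" for S
  define good where "good S \<longleftrightarrow> finite S \<and> orthonormal_set S \<and> S \<subseteq> V \<and> (\<forall>s\<in>S. \<exists>r::real. A s = r *\<^sub>R s)" for S
  have W: "closed_csubspace (W S)" for S
    unfolding W_def by (intro closed_csubspace_Int V closed_csubspace_orth)
  have W0: "W S \<noteq> {0}" if S: "good S" for S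
  proof -
    have "\<not> V \<subseteq> complex_vector.span S"
      using inf edim_span_le_card [OF csubspace_subspace [OF V]] S by (fastforce simp: good_def)
    then obtain u where "u \<in> V" "norm u = 1" "\<And>s. s \<in> S \<Longrightarrow> cinner u s = 0"
      using orthonormal_extend [OF _ _ _ csubspace_subspace [OF V], of S] S unfolding good_def by metis
    then have "u \<in> W S" "u \<noteq> 0" by (auto simp: W_def)
    then show ?thesis by blast
  qed
  have WA: "A x \<in> W S" if S: "good S" and x: "x \<in> W S" for S x
  proof -
    have "cinner (A x) s = 0" if s: "s \<in> S" for s
    proof -
      obtain r where "A s = r *\<^sub>R s" using S s unfolding good_def by blast
      moreover have "cinner (A x) s = cinner x (A s)"
        using x S s by (intro sa_sym [OF positive_selfadjoint [OF V A]]) (auto simp: W_def good_def)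
      ultimately show ?thesis using x s by (simp add: cinner_scaleR_right W_def)
    qed
    then show ?thesis using x bop_in [OF bA] by (simp add: W_def)
  qed
  have pW: "positive_op (W S) A" if "good S" for S
    using WA [OF that] by (intro positive_op_mono [OF A]) (auto simp: W_def)
  have "\<exists>u. u \<in> W S \<and> norm u = 1 \<and> A u = op_norm (W S) A *\<^sub>R u" if "good S" for S
    using attains_norm_eigenvector [OF W W0 [OF that] pW [OF that] att [rule_format, OF W _ W0 [OF that]]]
    by (auto simp: W_def)
  then obtain f where f: "\<And>S. good S \<Longrightarrow> f S \<in> W S" "\<And>S. good S \<Longrightarrow> norm (f S) = 1"
    "\<And>S. good S \<Longrightarrow> A (f S) = op_norm (W S) A *\<^sub>R f S" by metis
  have good_insert: "good (insert (f S) S)" if "good S" for S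
    using that f [OF that] orthonormal_set_insert [of S "f S"] by (auto simp: good_def W_def)
  \<comment> \<open>The set of eigenvectors chosen so far; the choice \<open>f\<close> depends on
    this set only, so a plain recursion suffices.\<close>
  define U where "U = rec_nat {} (\<lambda>_ S. insert (f S) S)"
  have U0: "U 0 = {}" and US: "U (Suc n) = insert (f (U n)) (U n)" for n by (simp_all add: U_def)
  have goodU: "good (U n)" for n
  proof (induction n)
    case 0 show ?case by (simp add: U0 good_def orthonormal_set_def)
  next
    case (Suc n) then show ?case by (simp add: US good_insert)
  qed
  define e where "e n = f (U n)" for n
  have Ue: "U n = e ` {..<n}" for n
    by (induction n) (auto simp: U0 US e_def lessThan_Suc)
  define l where "l n = op_norm (W (U n)) A" for n
  have eW: "e n \<in> W (U n)" "norm (e n) = 1" "A (e n) = l n *\<^sub>R e n" for n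
    using f [OF goodU] by (simp_all add: e_def l_def)
  have lt: "cinner (e n) (e m) = 0" if "m < n" for m n
    using eW(1) [of n] that by (auto simp: W_def Ue)
  have "cinner (e m) (e n) = (if m = n then 1 else 0)" for m n
    using lt [of m n] lt [of n m] eW(2) [of m] cinner_eq_1_norm [of "e m"] cinner_eq_0_commute [of "e m" "e n"]
    by (cases m n rule: linorder_cases) auto
  moreover have "0 \<le> l n" for n
    unfolding l_def by (rule op_norm_nonneg [OF W W0 [OF goodU] bop_UNIV [OF pos_bounded [OF pW [OF goodU]]]])
  moreover have "norm (A x) \<le> l n * norm x" if "x \<in> V" "\<forall>i<n. cinner x (e i) = 0" for n x
    unfolding l_def
  proof (rule norm_le_op_norm [OF W W0 [OF goodU] bop_UNIV [OF pos_bounded [OF pW [OF goodU]]]])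
    show "x \<in> W (U n)" using that by (auto simp: W_def Ue)
  qed
  moreover have "e n \<in> V" for n using eW(1) [of n] by (simp add: W_def)
  ultimately show ?thesis using eW(3) by (intro exI [of _ e] exI [of _ l]) blast
qed

text \<open>On the closed span of the \<open>g\<^sub>n\<close> the supremum of the \<open>c\<^sub>n\<close> is the squared norm, but a maximising vector
  would be orthogonal to every \<open>g\<^sub>n\<close>.\<close>

lemma no_increasing_system:
  fixes A :: "'a::complex_hilbert \<Rightarrow> 'a" and g :: "nat \<Rightarrow> 'a"
  assumes A: "selfadjoint_op UNIV A"
    and att: "\<And>M. closed_csubspace M \<Longrightarrow> M \<noteq> {0} \<Longrightarrow> attains_norm M A"
    and g: "\<And>m n. cinner (g m) (g n) = (if m = n then 1 else 0)"
    and Ag: "\<And>m n. cinner (A (g m)) (A (g n)) = (if m = n then complex_of_real (c n) else 0)"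
    and c: "\<And>n. c n < c (Suc n)"
  shows False
proof -
  define M where "M = closure (complex_vector.span (range g))"
  have M: "closed_csubspace M" unfolding M_def by (rule closed_csubspace_closure_span)
  have gM: "g n \<in> M" for n unfolding M_def by (rule subsetD [OF subset_closure_span]) simp
  have g1: "norm (g n) = 1" for n using g [of n n] cinner_eq_1_norm [of "g n"] by simp
  have T: "bounded_op M UNIV A" by (rule bounded_op_mono [OF sa_bounded [OF A]]) auto
  have "M \<noteq> {0}"
  proof
    assume "M = {0}"
    then have "g 0 = 0" using gM [of 0] by blast
    then show False using g1 [of 0] by simp
  qed
  then obtain x where x: "x \<in> M" "norm x = 1" and max: "\<forall>y\<in>M. norm (A y) \<le> norm (A x) * norm y"
    using att [OF M] unfolding attains_norm_def by blast
  have G: "adj M A (A x) = (norm (A x))\<^sup>2 *\<^sub>R x"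
    by (rule maximizer_eigenvector [OF M \<open>M \<noteq> {0}\<close> T x]) (use max in blast)
  have "cinner (g n) x = 0" for n
  proof -
    \<comment> \<open>Orthogonality of \<open>y\<close> to every \<open>g m\<close>, hence to
      \<open>M\<close>, says that \<open>g n\<close> is an eigenvector of the compressed square for
      \<open>c n\<close>. Since \<open>x\<close> is one for \<open>(norm (A x))^2\<close>, the two
      are orthogonal as soon as the eigenvalues differ.\<close>
    define y where "y = A (A (g n)) - c n *\<^sub>R g n"
    have gy: "cinner (g m) y = 0" for m
      using Ag [of m n] g [of m n] sa_sym [OF A, of "g m" "A (g n)"]
      by (simp add: y_def cinner.diff_right cinner_scaleR_right scaleR_conv_of_real)
    have "cinner x y = 0"
      by (rule orth_closure_span [OF _ x(1) [unfolded M_def]]) (use gy in blast)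
    then have "cinner (A (g n)) (A x) = c n *\<^sub>R cinner (g n) x"
      using sa_sym [OF A, of "A (g n)" x] cinner_eq_0_commute [of x y] by (simp add: y_def cinner_simps)
    moreover have "cinner (A (g n)) (A x) = (norm (A x))\<^sup>2 *\<^sub>R cinner (g n) x"
      using cinner_adj [OF M T gM [of n], of "A x"] by (simp add: G cinner_scaleR_right)
    \<comment> \<open>The next vector \<open>g (Suc n)\<close> already has squared image norm
      \<open>c (Suc n)\<close>, so a maximum can equal none of the \<open>c n\<close>.\<close>
    moreover have "c n < (norm (A x))\<^sup>2"
    proof -
      have "c (Suc n) = (norm (A (g (Suc n))))\<^sup>2" using Ag [of "Suc n" "Suc n"] by (simp add: norm_sq_cinner)
      also have "\<dots> \<le> (norm (A x))\<^sup>2" using max gM [of "Suc n"] g1 [of "Suc n"] by (intro power_mono) fastforce+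
      finally show ?thesis using c [of n] by simp
    qed
    ultimately show ?thesis by (metis less_irrefl scaleR_cancel_right)
  qed
  note gx = this
  have "cinner x x = 0"
    by (rule orth_closure_span [OF _ x(1) [unfolded M_def]]) (use gx in blast)
  then show False using x(2) by simp
qed

text \<open>Invariance of \<open>V\<close> gives \<open>D P = P D P\<close> for the projection
  \<open>P\<close> onto \<open>V\<close>, which is symmetric. Both \<open>F\<close> and
  \<open>K\<close> will be of this form.\<close>

lemma selfadjoint_compression:
  assumes D: "selfadjoint_op UNIV D" and V: "closed_csubspace V" and inv: "\<And>x. x \<in> V \<Longrightarrow> D x \<in> V"
  shows "selfadjoint_op UNIV (\<lambda>x. D (orth_proj V x))"
    and "cinner (D (orth_proj V x)) x = cinner (D (orth_proj V x)) (orth_proj V x)"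
proof -
  have *: "cinner z y = cinner z (orth_proj V y)" if "z \<in> V" for y z
    using cinner_orth_proj [OF V that, of y] by (simp add: cinner.diff_right cinner_eq_0_commute [of _ z])
  note P = orth_proj_in [OF V]
  show "cinner (D (orth_proj V x)) x = cinner (D (orth_proj V x)) (orth_proj V x)"
    by (rule * [OF inv [OF P]])
  show "selfadjoint_op UNIV (\<lambda>x. D (orth_proj V x))"
    unfolding selfadjoint_op_def
  proof (intro conjI ballI)
    show "bounded_op UNIV UNIV (\<lambda>x. D (orth_proj V x))"
      using bounded_op_compose [OF bop_UNIV [OF bounded_op_orth_proj [OF V]] sa_bounded [OF D]] .
    fix x y
    have "cinner (D (orth_proj V x)) y = cinner (D (orth_proj V x)) (orth_proj V y)"
      by (rule * [OF inv [OF P]])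
    also have "\<dots> = cinner (orth_proj V x) (D (orth_proj V y))" by (rule sa_sym [OF D]) auto
    also have "\<dots> = cnj (cinner (D (orth_proj V y)) (orth_proj V x))" by (rule cinner_commute)
    also have "\<dots> = cnj (cinner (D (orth_proj V y)) x)"
      by (rule arg_cong [of _ _ cnj]) (rule * [OF inv [OF P], symmetric])
    also have "\<dots> = cinner x (D (orth_proj V y))" by (rule cinner_commute [symmetric])
    finally show "cinner (D (orth_proj V x)) y = cinner x (D (orth_proj V y))" .
  qed
qed

text \<open>On a finite combination with coefficients \<open>a s\<close> the form is the sum of
  \<open>r s * (cmod (a s))^2\<close>; the closure follows by continuity.\<close>

lemma form_nonneg_on_closed_span:
  fixes D :: "'a::complex_hilbert \<Rightarrow> 'a"
  assumes D: "selfadjoint_op UNIV D" and S: "orthonormal_set S"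
    and r: "\<And>s. s \<in> S \<Longrightarrow> D s = r s *\<^sub>R s" "\<And>s. s \<in> S \<Longrightarrow> 0 \<le> r s"
    and y: "y \<in> closure (complex_vector.span S)"
  shows "0 \<le> Re (cinner (D y) y)"
proof -
  note bD = sa_bounded [OF D]
  have *: "0 \<le> Re (cinner (D y) y)" if y: "y \<in> complex_vector.span S" for y
  proof -
    obtain t a where t: "finite t" "t \<subseteq> S" "y = (\<Sum>s\<in>t. a s *\<^sub>C s)"
      using y unfolding complex_vector.span_explicit by auto
    have ont: "orthonormal_set t" using S t(2) by (rule orthonormal_set_subset)
    have "D y = (\<Sum>s\<in>t. a s *\<^sub>C D s)"
      unfolding t(3) by (rule bop_sum(1) [OF bD closed_csubspace_UNIV]) simp
    also have "\<dots> = (\<Sum>s\<in>t. (a s * r s) *\<^sub>C s)"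
      using t(2) r(1) by (intro sum.cong) (auto simp: scaleR_scaleC scaleC_scaleC)
    finally have Dy: "D y = (\<Sum>s\<in>t. (a s * r s) *\<^sub>C s)" .
    have "cinner (D y) y = (\<Sum>s\<in>t. cnj (a s) * cinner (D y) s)"
      by (subst (2) t(3)) (simp add: cinner.sum_right cinner_scaleC_right)
    also have "\<dots> = (\<Sum>s\<in>t. complex_of_real (r s * (cmod (a s))\<^sup>2))"
    proof (rule sum.cong)
      fix s assume s: "s \<in> t"
      have "cinner (D y) s = a s * r s" unfolding Dy by (rule cinner_orthonormal_sum [OF ont t(1) s])
      then have "cnj (a s) * cinner (D y) s = r s * (a s * cnj (a s))" by simp
      also have "\<dots> = complex_of_real (r s * (cmod (a s))\<^sup>2)"
        by (simp only: complex_norm_square [symmetric] of_real_mult)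
      finally show "cnj (a s) * cinner (D y) s = complex_of_real (r s * (cmod (a s))\<^sup>2)" .
    qed simp
    also have "Re \<dots> = (\<Sum>s\<in>t. r s * (cmod (a s))\<^sup>2)" by simp
    finally have "Re (cinner (D y) y) = (\<Sum>s\<in>t. r s * (cmod (a s))\<^sup>2)" .
    then show ?thesis using t(2) r(2) by (simp add: sum_nonneg subset_iff)
  qed
  obtain x where x: "\<And>n. x n \<in> complex_vector.span S" "x \<longlonglongrightarrow> y"
    using y unfolding closure_sequential by blast
  have "(\<lambda>n. Re (cinner (D (x n)) (x n))) \<longlonglongrightarrow> Re (cinner (D y) y)"
    using x(2) by (intro tendsto_Re cinner.tendsto bop_tendsto [OF bD closed_csubspace_UNIV]) auto
  then show ?thesis using * [OF x(1)] by (intro LIMSEQ_le_const) auto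
qed

text \<open>Approximability by compact sets gives total boundedness. It replaces the statement that
  norm limits of finite-rank operators are compact.\<close>

lemma compact_closureI:
  fixes X :: "'a::banach set"
  assumes "\<And>\<epsilon>. \<epsilon> > 0 \<Longrightarrow> \<exists>Q. compact Q \<and> (\<forall>x\<in>X. \<exists>q\<in>Q. dist q x < \<epsilon>)"
  shows "compact (closure X)"
  unfolding compact_eq_totally_bounded
proof (intro conjI allI impI)
  show "complete (closure X)" by (simp add: complete_eq_closed)
  fix \<epsilon> :: real assume \<epsilon>: "\<epsilon> > 0"
  then obtain Q where Q: "compact Q" "\<forall>x\<in>X. \<exists>q\<in>Q. dist q x < \<epsilon> / 4" using assms [of "\<epsilon> / 4"] by auto
  obtain k where k: "finite k" "Q \<subseteq> (\<Union>x\<in>k. ball x (\<epsilon> / 4))"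
    using Q(1) \<epsilon> compact_eq_totally_bounded [of Q] by (auto dest: spec [of _ "\<epsilon> / 4"])
  have "X \<subseteq> (\<Union>z\<in>k. cball z (\<epsilon> / 2))"
  proof
    fix x assume "x \<in> X"
    then obtain q where q: "q \<in> Q" "dist q x < \<epsilon> / 4" using Q(2) by blast
    then obtain z where "z \<in> k" "dist z q < \<epsilon> / 4" using k(2) by auto
    then show "x \<in> (\<Union>z\<in>k. cball z (\<epsilon> / 2))"
      using q(2) dist_triangle [of z x q] by (intro UN_I [of z]) auto
  qed
  then have "closure X \<subseteq> (\<Union>z\<in>k. cball z (\<epsilon> / 2))"
    using k(1) by (intro closure_minimal closed_UN) auto
  also have "\<dots> \<subseteq> (\<Union>z\<in>k. ball z \<epsilon>)" using \<epsilon> by (intro UN_mono) auto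
  finally show "\<exists>k. finite k \<and> closure X \<subseteq> (\<Union>x\<in>k. ball x \<epsilon>)" using k(1) by blast
qed

text \<open>Mixing eigenvectors \<open>e\<^sub>n\<close>, \<open>f\<^sub>n\<close> with eigenvalues \<open>l\<^sub>n \<ge> \<alpha> > r\<^sub>0 \<ge> r\<^sub>n\<close> produces unit vectors with
  \<open>\<parallel>A g\<^sub>n\<parallel>\<^sup>2\<close> strictly increasing to \<open>\<alpha>\<^sup>2\<close>.\<close>

lemma no_eigenvalues_on_both_sides:
  fixes A :: "'a::complex_hilbert \<Rightarrow> 'a" and e f :: "nat \<Rightarrow> 'a" and l r :: "nat \<Rightarrow> real"
  assumes A: "selfadjoint_op UNIV A"
    and att: "\<And>M. closed_csubspace M \<Longrightarrow> M \<noteq> {0} \<Longrightarrow> attains_norm M A"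
    and e: "\<And>m n. cinner (e m) (e n) = (if m = n then 1 else 0)" "\<And>n. A (e n) = l n *\<^sub>R e n"
    and f: "\<And>m n. cinner (f m) (f n) = (if m = n then 1 else 0)" "\<And>n. A (f n) = r n *\<^sub>R f n"
    and ef: "\<And>m n. cinner (e m) (f n) = 0"
    and l: "0 \<le> \<alpha>" "\<And>n. \<alpha> \<le> l n" and r: "\<And>n. 0 \<le> r n" "\<And>n. r n \<le> r 0" "r 0 < \<alpha>"
  shows False
proof -
  \<comment> \<open>These numbers start at \<open>(r 0)^2\<close>, hence dominate all
    \<open>(r n)^2\<close>, and increase strictly towards \<open>\<alpha>\<^sup>2\<close> without
    reaching it, hence stay below all \<open>(l n)^2\<close>.\<close>
  define c where "c n = \<alpha>\<^sup>2 - (\<alpha>\<^sup>2 - (r 0)\<^sup>2) / real (Suc n)" for n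
  have d: "0 < \<alpha>\<^sup>2 - (r 0)\<^sup>2" using r by (simp add: power_strict_mono)
  have c: "c n < c (Suc n)" for n
  proof -
    have "(\<alpha>\<^sup>2 - (r 0)\<^sup>2) / real (Suc (Suc n)) < (\<alpha>\<^sup>2 - (r 0)\<^sup>2) / real (Suc n)"
      using d by (intro divide_strict_left_mono) auto
    then show ?thesis by (simp add: c_def)
  qed
  have c_up: "c n < \<alpha>\<^sup>2" for n using d by (simp add: c_def)
  have c_low: "(r n)\<^sup>2 \<le> c n" for n
  proof -
    have "(\<alpha>\<^sup>2 - (r 0)\<^sup>2) / real (Suc n) \<le> (\<alpha>\<^sup>2 - (r 0)\<^sup>2) / 1"
      using d by (intro divide_left_mono) auto
    moreover have "(r n)\<^sup>2 \<le> (r 0)\<^sup>2" using r by (intro power_mono) auto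
    ultimately show ?thesis by (simp add: c_def)
  qed
  have l_up: "\<alpha>\<^sup>2 \<le> (l n)\<^sup>2" for n using l by (intro power_mono) auto
  \<comment> \<open>The weight in [0, 1] that writes \<open>c n\<close> as a convex combination of
    \<open>(l n)^2\<close> and \<open>(r n)^2\<close>; square roots of the weights make
    \<open>g n\<close> a unit vector.\<close>
  define t where "t n = (c n - (r n)\<^sup>2) / ((l n)\<^sup>2 - (r n)\<^sup>2)" for n
  have pos: "0 < (l n)\<^sup>2 - (r n)\<^sup>2" for n using c_up [of n] c_low [of n] l_up [of n] by linarith
  have t0: "0 \<le> t n" for n unfolding t_def using c_low [of n] pos [of n] by (intro divide_nonneg_pos) auto
  have t1: "t n \<le> 1" for n
    unfolding t_def using c_up [of n] l_up [of n] pos [of n] by (simp add: divide_le_eq_1)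
  have tc: "t n * (l n)\<^sup>2 + (1 - t n) * (r n)\<^sup>2 = c n" for n
  proof -
    have "t n * ((l n)\<^sup>2 - (r n)\<^sup>2) = c n - (r n)\<^sup>2" using pos [of n] by (simp add: t_def)
    then show ?thesis by (simp add: algebra_simps)
  qed
  have fe: "cinner (f m) (e n) = 0" for m n using ef [of n m] by (simp add: cinner_eq_0_commute)
  define g where "g n = sqrt (t n) *\<^sub>R e n + sqrt (1 - t n) *\<^sub>R f n" for n
  note bA = sa_bounded [OF A]
  have Ag: "A (g n) = (sqrt (t n) * l n) *\<^sub>R e n + (sqrt (1 - t n) * r n) *\<^sub>R f n" for n
    by (simp add: g_def bop_add [OF bA] bop_scaleR [OF bA] e(2) f(2))
  have sq: "sqrt (t n) * sqrt (t n) = t n" "sqrt (1 - t n) * sqrt (1 - t n) = 1 - t n" for n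
    using t0 [of n] t1 [of n] by simp_all
  have gg: "cinner (g m) (g n) = (if m = n then 1 else 0)" for m n
  proof (cases "m = n")
    case True
    have "cinner (g n) (g n) = (sqrt (t n) * sqrt (t n)) *\<^sub>R 1 + (sqrt (1 - t n) * sqrt (1 - t n)) *\<^sub>R 1"
      by (simp add: g_def cinner_simps e(1) f(1) ef fe)
    also have "\<dots> = 1" unfolding sq by (simp add: scaleR_left_diff_distrib)
    finally show ?thesis using True by simp
  qed (simp add: g_def cinner_simps e(1) f(1) ef fe)
  have AgAg: "cinner (A (g m)) (A (g n)) = (if m = n then complex_of_real (c n) else 0)" for m n
  proof (cases "m = n")
    case True
    have "cinner (A (g n)) (A (g n)) = (sqrt (t n) * sqrt (t n) * (l n)\<^sup>2) *\<^sub>R 1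
        + (sqrt (1 - t n) * sqrt (1 - t n) * (r n)\<^sup>2) *\<^sub>R 1"
      unfolding Ag by (simp add: cinner_simps e(1) f(1) ef fe power2_eq_square ac_simps)
    also have "\<dots> = complex_of_real (t n * (l n)\<^sup>2 + (1 - t n) * (r n)\<^sup>2)"
      unfolding sq scaleR_conv_of_real by (simp only: of_real_add mult_1_right)
    finally show ?thesis using True by (simp add: tc)
  qed (simp add: Ag cinner_simps e(1) f(1) ef fe)
  show False by (rule no_increasing_system [OF A att gg AgAg c])
qed

text \<open>Split the projection of \<open>x\<close> to \<open>E\<close> into a part in the span
  \<open>L\<close> of the first \<open>n\<close> vectors and a part orthogonal to them. The image of
  the unit ball of \<open>L\<close> is compact, and the image of the other part is small once
  \<open>d n\<close> is small.\<close>

lemma compact_compression: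
  fixes D :: "'a::complex_hilbert \<Rightarrow> 'a" and e :: "nat \<Rightarrow> 'a"
  assumes D: "selfadjoint_op UNIV D"
    and e: "\<And>m n. cinner (e m) (e n) = (if m = n then 1 else 0)"
    and De: "\<And>n. D (e n) = d n *\<^sub>R e n" and d: "\<And>n. 0 \<le> d n" "d \<longlonglongrightarrow> 0"
    and E: "E = closure (complex_vector.span (range e))"
    and le: "\<And>n x. x \<in> E \<Longrightarrow> (\<And>i. i < n \<Longrightarrow> cinner x (e i) = 0) \<Longrightarrow> Re (cinner (D x) x) \<le> d n * (norm x)\<^sup>2"
  shows "positive_op UNIV (\<lambda>x. D (orth_proj E x))" "compact_op UNIV (\<lambda>x. D (orth_proj E x))"
proof -
  note bD = sa_bounded [OF D]
  have cE: "closed_csubspace E" unfolding E by (rule closed_csubspace_closure_span)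
  have eE: "e n \<in> E" for n unfolding E by (rule subsetD [OF subset_closure_span]) simp
  have "E \<subseteq> {x. D x \<in> E}"
    unfolding E
  proof (rule closure_span_minimal [OF closed_csubspace_vimage [OF bD]])
    show "closed_csubspace (closure (complex_vector.span (range e)))" by (rule closed_csubspace_closure_span)
    show "range e \<subseteq> {x. D x \<in> closure (complex_vector.span (range e))}"
      using csubspace_scaleR [OF cE eE] by (auto simp: De E)
  qed
  then have DE: "D x \<in> E" if "x \<in> E" for x using that by blast
  note comp = selfadjoint_compression [OF D cE DE]
  have inj: "inj e"
  proof (rule injI)
    fix m n assume "e m = e n"
    then show "m = n" using e [of m m] e [of m n] by (auto split: if_splits)
  qed
  then have on: "orthonormal_set (range e)"
    unfolding orthonormal_set_def by (auto simp: e inj_eq)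
  have nonneg: "0 \<le> Re (cinner (D y) y)" if y: "y \<in> E" for y
  proof (rule form_nonneg_on_closed_span [OF D on])
    \<comment> \<open>The vectors \<open>e n\<close> are distinct, so the eigenvalue can be indexed
      by the vector itself.\<close>
    show "D s = d (inv e s) *\<^sub>R s" "0 \<le> d (inv e s)" if "s \<in> range e" for s
      using that inj De d(1) by auto
    show "y \<in> closure (complex_vector.span (range e))" using y E by simp
  qed
  show "positive_op UNIV (\<lambda>x. D (orth_proj E x))"
    by (rule positive_opI [OF comp(1)]) (simp_all add: comp(2) nonneg orth_proj_in [OF cE])
  have "\<exists>Q. compact Q \<and> (\<forall>x\<in>(\<lambda>x. D (orth_proj E x)) ` (UNIV \<inter> cball 0 1). \<exists>q\<in>Q. dist q x < \<epsilon>)"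
    if \<epsilon>: "\<epsilon> > 0" for \<epsilon>
  proof -
    obtain n where n: "d n < \<epsilon> / 2"
      using order_tendstoD(2) [OF d(2), of "\<epsilon> / 2"] \<epsilon> by (auto simp: eventually_sequentially)
    define L where "L = complex_vector.span (e ` {..<n})"
    have fin: "finite (e ` {..<n})" "orthonormal_set (e ` {..<n})"
      by (auto intro: orthonormal_set_subset [OF on])
    have cL: "closed_csubspace L" unfolding L_def by (rule closed_csubspace_span_orthonormal [OF fin(2,1)])
    have eL: "e i \<in> L" if "i < n" for i
      unfolding L_def using that by (intro complex_vector.span_base) simp
    have LE: "L \<subseteq> E"
      unfolding L_def using eE by (intro complex_vector.span_minimal csubspace_subspace [OF cE]) auto
    define Q where "Q = D ` {x \<in> L. norm x \<le> 1}"
    have "continuous_on UNIV D"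
      unfolding continuous_on_sequentially
      using bop_tendsto [OF bD closed_csubspace_UNIV] by (auto simp: o_def)
    then have "continuous_on {x \<in> L. norm x \<le> 1} D" by (rule continuous_on_subset) simp
    moreover have "compact {x \<in> L. norm x \<le> 1}"
      by (rule compact_finite_dim_ball [OF csubspace_subspace [OF cL] fin(1)]) (simp add: L_def)
    ultimately have "compact Q" unfolding Q_def by (rule compact_continuous_image)
    moreover have "\<exists>q\<in>Q. dist q (D (orth_proj E x)) < \<epsilon>" if x: "norm x \<le> 1" for x
    proof -
      obtain y where y: "y = orth_proj E x" "y \<in> E" "norm y \<le> norm x"
        using orth_decomposition [OF cE closed_csubspace_UNIV subset_UNIV UNIV_I, of x] by metis
      obtain p q where pq: "y = p + q" "p \<in> L" "q \<in> E" "\<And>z. z \<in> L \<Longrightarrow> cinner q z = 0" "norm p \<le> norm y"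
        using orth_decomposition [OF cL cE LE y(2)] by metis
      have "(norm (q + p))\<^sup>2 = (norm q)\<^sup>2 + (norm p)\<^sup>2" by (rule pythagoras [OF pq(4) [OF pq(2)]])
      then have "(norm q)\<^sup>2 \<le> (norm y)\<^sup>2" by (simp add: pq(1) add.commute)
      then have nq: "norm q \<le> 1" using x y(3) power2_le_imp_le [of "norm q" "norm y"] by simp
      \<comment> \<open>On this invariant subspace \<open>D\<close> is positive, which turns the
        bound on its form into a bound on its norm.\<close>
      define R where "R = E \<inter> {x. \<forall>z\<in>e ` {..<n}. cinner x z = 0}"
      have cR: "closed_csubspace R" unfolding R_def by (intro closed_csubspace_Int cE closed_csubspace_orth)
      have DR: "D z \<in> R" if z: "z \<in> R" for z
      proof -
        have "cinner (D z) (e i) = 0" if "i < n" for i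
          using sa_sym [OF D, of z "e i"] z that by (simp add: De cinner_scaleR_right R_def)
        then show ?thesis using z DE by (auto simp: R_def)
      qed
      have pR: "positive_op R D"
      proof (rule positive_opI)
        show "selfadjoint_op R D"
          using bounded_op_mono [OF bD, of R R] DR sa_sym [OF D] by (simp add: selfadjoint_op_def)
        show "0 \<le> Re (cinner (D z) z)" if "z \<in> R" for z using nonneg that by (simp add: R_def)
      qed
      have "norm (D q) \<le> \<epsilon> / 2 * norm q"
      proof (rule positive_norm_le [OF cR pR])
        show "0 < \<epsilon> / 2" using \<epsilon> by simp
        show "q \<in> R" using pq(3,4) eL by (auto simp: R_def)
        fix z assume z: "z \<in> R"
        then have "Re (cinner (D z) z) \<le> d n * (norm z)\<^sup>2" by (intro le) (auto simp: R_def)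
        also have "\<dots> \<le> \<epsilon> / 2 * (norm z)\<^sup>2" using n by (intro mult_right_mono) auto
        finally show "Re (cinner (D z) z) \<le> \<epsilon> / 2 * (norm z)\<^sup>2" .
      qed
      also have "\<dots> \<le> \<epsilon> / 2 * 1" using nq \<epsilon> by (intro mult_left_mono) auto
      also have "\<dots> < \<epsilon>" using \<epsilon> by simp
      finally have "dist (D p) (D y) < \<epsilon>"
        by (simp add: pq(1) bop_add [OF bD] dist_norm)
      moreover have "D p \<in> Q" using pq(2,5) x y(3) by (auto simp: Q_def)
      ultimately show ?thesis using y(1) by blast
    qed
    ultimately show ?thesis by auto
  qed
  then have "compact (closure ((\<lambda>x. D (orth_proj E x)) ` (UNIV \<inter> cball 0 1)))"
    by (rule compact_closureI)
  then show "compact_op UNIV (\<lambda>x. D (orth_proj E x))"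
    using sa_bounded [OF comp(1)] by (simp add: compact_op_def)
qed

text \<open>In finite dimension \<open>A\<close> itself serves as \<open>F\<close>, with \<alpha>
  and \<open>K\<close> zero. Otherwise \<alpha> is the limit of the decreasing eigenvalues, and
  \<open>D = A - \<alpha>\<close> is cut along \<open>E\<close>, \<open>N\<close> and
  \<open>V\<close>.\<close>

lemma attains_norm_imp_decomposition:
  fixes A :: "'a::complex_hilbert \<Rightarrow> 'a"
  assumes A: "positive_op UNIV A"
    and att: "\<And>M. closed_csubspace M \<Longrightarrow> M \<noteq> {0} \<Longrightarrow> attains_norm M A"
  shows "\<exists>(\<alpha>::real) F K. \<alpha> \<ge> 0 \<and> positive_op UNIV K \<and> compact_op UNIV K \<and>
     selfadjoint_op UNIV F \<and> op_rank UNIV F < \<infinity> \<and> (\<forall>x. A x = \<alpha> *\<^sub>R x + F x + K x)"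
proof (cases "edim (UNIV :: 'a set) = \<infinity>")
  case False
  have sA: "selfadjoint_op UNIV A" by (rule positive_selfadjoint [OF closed_csubspace_UNIV A])
  have s0: "selfadjoint_op UNIV (\<lambda>x::'a. 0 :: 'a)"
    using selfadjoint_op_scaleR_id [OF closed_csubspace_UNIV, of 0] by simp
  have "positive_op UNIV (\<lambda>x::'a. 0 :: 'a)" by (rule positive_opI [OF s0]) simp
  moreover have "compact_op UNIV (\<lambda>x::'a. 0 :: 'a)"
    using sa_bounded [OF s0] by (simp add: compact_op_def image_constant_conv)
  moreover have "op_rank UNIV A < \<infinity>"
    by (rule le_less_trans [OF op_rank_le_edim [OF closed_csubspace_UNIV pos_bounded [OF A]]])
      (use False in simp)
  ultimately show ?thesis
    using sA by (intro exI [of _ 0] exI [of _ A] exI [of _ "\<lambda>x. 0"]) simp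
next
  case True
  have sA: "selfadjoint_op UNIV A" by (rule positive_selfadjoint [OF closed_csubspace_UNIV A])
  note bA = sa_bounded [OF sA]
  have att': "\<forall>N. closed_csubspace N \<longrightarrow> N \<subseteq> V \<longrightarrow> N \<noteq> {0} \<longrightarrow> attains_norm N A" for V
    using att by blast
  obtain e :: "nat \<Rightarrow> 'a" and l where e: "\<forall>m n. cinner (e m) (e n) = (if m = n then 1 else 0)" "\<forall>n. A (e n) = l n *\<^sub>R e n"
    and l0: "\<forall>n. 0 \<le> (l n :: real)"
    and le: "\<forall>n. \<forall>x\<in>UNIV. (\<forall>i<n. cinner x (e i) = 0) \<longrightarrow> norm (A x) \<le> l n * norm x"
    using eigenvector_sequence [OF closed_csubspace_UNIV A True att'] by blast
  have e1: "norm (e n) = 1" for n using e(1) cinner_eq_1_norm [of "e n"] by simp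
  have "decseq l"
  proof (rule decseq_SucI)
    fix n
    have "norm (A (e (Suc n))) \<le> l n * norm (e (Suc n))" using le e(1) by auto
    then show "l (Suc n) \<le> l n" using e(2) e1 l0 by simp
  qed
  then obtain \<alpha> where \<alpha>: "l \<longlonglongrightarrow> \<alpha>" "\<And>n. \<alpha> \<le> l n"
    using decseq_convergent [of l 0] l0 by blast
  have \<alpha>0: "0 \<le> \<alpha>" using LIMSEQ_le_const [OF \<alpha>(1)] l0 by blast
  define D where "D x = A x - \<alpha> *\<^sub>R x" for x
  have sD: "selfadjoint_op UNIV D"
    unfolding D_def
    by (intro selfadjoint_op_diff sA selfadjoint_op_scaleR_id closed_csubspace_UNIV)
  note bD = sa_bounded [OF sD]
  define E where "E = closure (complex_vector.span (range e))"
  define W where "W = {x. \<forall>y\<in>range e. cinner x y = 0}"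
  \<comment> \<open>This space may be infinite-dimensional, but \<open>D\<close> vanishes on it.
    Removing it leaves in \<open>V\<close> no eigenvector for \<alpha>.\<close>
  define N where "N = W \<inter> eigenspace UNIV A (complex_of_real \<alpha>)"
  define V where "V = W \<inter> {x. \<forall>y\<in>N. cinner x y = 0}"
  have cE: "closed_csubspace E" unfolding E_def by (rule closed_csubspace_closure_span)
  have cW: "closed_csubspace W" unfolding W_def by (rule closed_csubspace_orth)
  have cN: "closed_csubspace N"
    unfolding N_def by (intro closed_csubspace_Int cW closed_csubspace_eigenspace closed_csubspace_UNIV bA)
  have cV: "closed_csubspace V" unfolding V_def by (intro closed_csubspace_Int cW closed_csubspace_orth)
  have AN: "A x = \<alpha> *\<^sub>R x" if "x \<in> N" for x using that by (simp add: N_def eigenspace_def scaleR_scaleC)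
  have AV: "A x \<in> V" if x: "x \<in> V" for x
  proof -
    have "cinner (A x) (e n) = 0" for n
      using sa_sym [OF sA, of x "e n"] x e(2) by (simp add: V_def W_def cinner_scaleR_right)
    moreover have "cinner (A x) y = 0" if "y \<in> N" for y
      using sa_sym [OF sA, of x y] x AN [OF that] that by (simp add: V_def cinner_scaleR_right)
    ultimately show ?thesis by (auto simp: V_def W_def)
  qed
  have pV: "positive_op V A" by (rule positive_op_mono [OF A subset_UNIV AV])
  have finV: "edim V < \<infinity>"
  proof (rule ccontr)
    assume "\<not> edim V < \<infinity>"
    then have inf: "edim V = \<infinity>" by simp
    obtain f :: "nat \<Rightarrow> 'a" and r where f: "\<forall>n. f n \<in> V" "\<forall>m n. cinner (f m) (f n) = (if m = n then 1 else 0)"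
      "\<forall>n. A (f n) = r n *\<^sub>R f n" and r0: "\<forall>n. 0 \<le> (r n :: real)"
      and ler: "\<forall>n. \<forall>x\<in>V. (\<forall>i<n. cinner x (f i) = 0) \<longrightarrow> norm (A x) \<le> r n * norm x"
      using eigenvector_sequence [OF cV pV inf att'] by blast
    have f1: "norm (f n) = 1" for n using f(2) cinner_eq_1_norm [of "f n"] by simp
    have Af: "norm (A (f n)) = r n" for n using f(3) f1 r0 by simp
    have fW: "cinner (f n) (e m) = 0" for m n using f(1) by (simp add: V_def W_def)
    have "r n \<le> r 0" for n
    proof -
      have "norm (A (f n)) \<le> r 0 * norm (f n)" using ler f(1) by blast
      then show ?thesis using Af [of n] f1 [of n] by simp
    qed
    \<comment> \<open>The vector \<open>f 0\<close> is orthogonal to all \<open>e n\<close>, so its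
      eigenvalue is at most every \<open>l n\<close>, hence at most \<alpha>; equality would put it
      in \<open>N\<close>, to which \<open>V\<close> is orthogonal.\<close>
    moreover have "r 0 < \<alpha>"
    proof -
      have "r 0 \<le> l n" for n
      proof -
        have "norm (A (f 0)) \<le> l n * norm (f 0)" using le fW by blast
        then show ?thesis using Af f1 by simp
      qed
      then have "r 0 \<le> \<alpha>" using LIMSEQ_le_const [OF \<alpha>(1)] by blast
      moreover have "r 0 \<noteq> \<alpha>"
      proof
        assume "r 0 = \<alpha>"
        then have "f 0 \<in> N" using f(1,3) by (simp add: N_def V_def eigenspace_def scaleR_scaleC)
        then have "cinner (f 0) (f 0) = 0" using f(1) by (simp add: V_def)
        then show False using f1 [of 0] by simp
      qed
      ultimately show ?thesis by simp
    qed
    ultimately show False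
      using e f r0 fW \<alpha>0 \<alpha>(2)
      by (intro no_eigenvalues_on_both_sides [OF sA att, of e l f r \<alpha>]) (auto simp: cinner_eq_0_commute [of "e _"])
  qed
  define K where "K x = D (orth_proj E x)" for x
  define F where "F x = D (orth_proj V x)" for x
  have DV: "D x \<in> V" if "x \<in> V" for x
    unfolding D_def using AV [OF that] that by (intro csubspace_diff [OF cV] csubspace_scaleR [OF cV])
  have sF: "selfadjoint_op UNIV F" unfolding F_def by (rule selfadjoint_compression [OF sD cV DV])
  have "op_rank UNIV F \<le> edim V"
    unfolding op_rank_def
    using DV orth_proj_in [OF cV]
    by (intro edim_mono subspace_image [OF sa_bounded [OF sF] closed_csubspace_UNIV] csubspace_subspace [OF cV])
      (auto simp: F_def)
  then have rF: "op_rank UNIV F < \<infinity>" using finV by (rule le_less_trans)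
  have K: "positive_op UNIV K" "compact_op UNIV K"
  proof -
    have De: "D (e n) = (l n - \<alpha>) *\<^sub>R e n" for n using e(2) by (simp add: D_def scaleR_diff_left)
    have d: "0 \<le> l n - \<alpha>" for n using \<alpha>(2) [of n] by simp
    have lim: "(\<lambda>n. l n - \<alpha>) \<longlonglongrightarrow> 0" using \<alpha>(1) by (simp add: LIM_zero)
    have form: "Re (cinner (D x) x) \<le> (l n - \<alpha>) * (norm x)\<^sup>2" if "\<And>i. i < n \<Longrightarrow> cinner x (e i) = 0" for n x
    proof -
      have "Re (cinner (A x) x) \<le> l n * (norm x)\<^sup>2" using le that by (intro Re_cinner_le_bound) auto
      then show ?thesis by (simp add: D_def cinner_simps norm_sq_cinner left_diff_distrib)
    qed
    show "positive_op UNIV K" "compact_op UNIV K"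
      unfolding K_def
      using compact_compression [OF sD _ De d lim E_def form] e(1) by auto
  qed
  have "A x = \<alpha> *\<^sub>R x + F x + K x" for x
  proof -
    define p where "p = orth_proj E x"
    define w where "w = x - p"
    define q where "q = orth_proj N w"
    define v where "v = w - q"
    have pE: "p \<in> E" unfolding p_def by (rule orth_proj_in [OF cE])
    have eE: "e n \<in> E" for n unfolding E_def by (rule subsetD [OF subset_closure_span]) simp
    have w: "w \<in> W" using cinner_orth_proj [OF cE eE] by (auto simp: W_def w_def p_def)
    have q: "q \<in> N" unfolding q_def by (rule orth_proj_in [OF cN])
    have v: "v \<in> V"
      using cinner_orth_proj [OF cN, of _ w] csubspace_diff [OF cW w] q by (simp add: V_def v_def q_def N_def)
    have "orth_proj V x = v"
    proof (rule orth_proj_eqI [OF cV v])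
      fix z assume z: "z \<in> V"
      have "cinner p z = 0"
      proof (rule orth_closure_span [OF _ pE [unfolded E_def]])
        show "cinner y z = 0" if "y \<in> range e" for y
          using z that by (auto simp: V_def W_def cinner_eq_0_commute [of y])
      qed
      moreover have "cinner q z = 0" using z q by (simp add: V_def cinner_eq_0_commute [of q])
      moreover have "x - v = p + q" by (simp add: v_def w_def)
      ultimately show "cinner (x - v) z = 0" by (simp add: cinner_add_left)
    qed
    moreover have "D x = D p + D q + D v"
    proof -
      have "x = p + q + v" by (simp add: v_def w_def)
      then show ?thesis by (simp add: bop_add [OF bD])
    qed
    moreover have "D q = 0" by (simp add: D_def AN [OF q])
    ultimately have "D x = F x + K x" by (simp add: F_def K_def p_def)
    then show ?thesis by (simp add: D_def algebra_simps)
  qed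
  then show ?thesis using \<alpha>0 K sF rF by blast
qed

theorem theorem5p2:
  fixes T U :: "'h::complex_hilbert \<Rightarrow> 'k::complex_hilbert"
  assumes "bounded_op UNIV UNIV T"
    and "polar_decomposition T U"
  shows "((\<forall>k\<ge>1. absolutely_norming k T) \<longleftrightarrow> (\<exists>k\<ge>1. absolutely_norming k T)) \<and>
         ((\<exists>k\<ge>1. absolutely_norming k T) \<longleftrightarrow>
          (\<exists>(\<alpha>::real) F K. \<alpha> \<ge> 0 \<and>
             positive_op UNIV K \<and> compact_op UNIV K \<and>
             selfadjoint_op UNIV F \<and> op_rank UNIV F < \<infinity> \<and>
             (\<forall>x. abs_op UNIV T x = \<alpha> *\<^sub>R x + F x + K x)))"
    (is "(?all \<longleftrightarrow> ?ex) \<and> (?ex \<longleftrightarrow> ?form)")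
proof -
  note T = assms(1)
  define A where "A = abs_op UNIV T"
  have A: "positive_op UNIV A" and nA: "norm (A x) = norm (T x)" for x
    unfolding A_def using positive_abs_op [OF closed_csubspace_UNIV T] norm_abs_op [OF closed_csubspace_UNIV T] by auto
  \<comment> \<open>Attainment is transferred from \<open>T\<close> to its modulus on every subspace
    at once; the modulus here is the one on the whole space, not that of a restriction.\<close>
  have attA: "attains_norm M A \<longleftrightarrow> attains_norm M T" for M
    by (simp add: attains_norm_def nA)
  have "?form" if ex: ?ex
  proof -
    obtain k where k: "k \<ge> 1" "absolutely_norming k T" using ex by blast
    have "attains_norm M A" if M: "closed_csubspace M" "M \<noteq> {0}" for M
    proof -
      have "bounded_op M UNIV T" by (rule bounded_op_mono [OF T]) auto
      moreover have "norming k M T" using k(2) M by (simp add: absolutely_norming_def)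
      ultimately show ?thesis unfolding attA using norming_imp_attains_norm [OF M _ k(1)] by blast
    qed
    then show ?form using attains_norm_imp_decomposition [OF A] unfolding A_def by blast
  qed
  moreover have "?all" if form: ?form
  proof -
    obtain \<alpha> F K where FK: "\<alpha> \<ge> 0" "positive_op UNIV K" "compact_op UNIV K" "selfadjoint_op UNIV F"
      "op_rank UNIV F < \<infinity>" "\<forall>x. A x = \<alpha> *\<^sub>R x + F x + K x"
      using form unfolding A_def by blast
    have "attains_norm M T" if "closed_csubspace M" "M \<noteq> {0}" for M
      using attains_norm_scalar_plus_finite_plus_compact
        [OF positive_selfadjoint [OF closed_csubspace_UNIV A] FK(1-5) _ that] FK(6)
      unfolding attA by blast
    then show ?all using attains_norm_imp_absolutely_norming [OF T] by blast
  qed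
  moreover have "?ex" if ?all using that by blast
  ultimately show ?thesis by blast
qed

end
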